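(* The BBSA algorithm (described in the context), applied to the bi-objective linear program $$\text{(BLP)}\quad \min\ \begin{pmatrix}(c^1)^\top x+(f^1)^\top y\\ (c^2)^\top x+(f^2)^\top y\end{pmatrix}\quad\text{s.t. } Ax+By\geq b,\ Dy\geq d,\ x\geq 0,\ y\geq 0,$$ terminates with a bi-objective master problem $\mathrm{BR}\{\bar{\mathcal D}_r,\Lambda,\bar{\mathcal D}_p\}$ whose set of non-dominated extreme points $\mathcal Z_{nx}$ is equal to that of (BLP).
   Context: All data are real: $x\in\mathbb R^n$, $y\in\mathbb R^p$, and the vectors $c^1,c^2,f^1,f^2,b,d$ and matrices $A,B,D$ have matching dimensions ($b\in\mathbb R^m$). Inequalities between vectors in constraints are componentwise. Bi-objective notions. For a bi-objective linear program with objective vector $z=(z_1,z_2)$ (both minimised), $z$ dominates $\bar z$ if $z_i\le\bar z_i$ for $i=1,2$ and $z\ne\bar z$. A feasible solution is efficient if its objective vector is not dominated by that of any other feasible solution; objective vectors of efficient solutions are the non-dominated points. A non-dominated extreme point is a non-dominated point that is an extreme point of the feasible set in objective space; an efficient extreme solution is an efficient solution whose objective vector is such a point. For $\lambda\in[0,1]$, $\lambda$-(P) is the problem (P) with the single objective $\lambda z_1+(1-\lambda)z_2$. Standing assumptions: (BLP) is feasible, and the set of efficient solutions of every bi-objective problem considered is bounded (no unbounded efficient edges), so that $\lambda$-(BLP) has an optimal solution for every $\lambda\in[0,1]$. Master and subproblem. For $\lambda\in[0,1]$ let $c^\lambda=\lambda c^1+(1-\lambda)c^2$, let $\mathcal D_p^\lambda$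 be the set of extreme points of $\{\pi\in\mathbb R^m:A^\top\pi\leq c^\lambda,\pi\geq0\}$, and let $\mathcal D_r$ be the set of extreme rays of $\{\pi:A^\top\pi\leq0,\pi\geq0\}$. For $\Lambda\subseteq[0,1]$, $\bar{\mathcal D}_r\subseteq\mathcal D_r$, $\bar{\mathcal D}_p(\lambda)\subseteq\mathcal D_p^\lambda$, the master problem $\mathrm{BM}=\mathrm{BR}\{\bar{\mathcal D}_r,\Lambda,\bar{\mathcal D}_p\}$ is, with $\theta_1,\theta_2\in\mathbb R$ free, $$\min\begin{pmatrix}\theta_1+(f^1)^\top y\\ \theta_2+(f^2)^\top y\end{pmatrix}\ \text{s.t. } Dy\geq d,\ y\geq0,\ (b-By)^\top\pi_r\leq0\ \forall\pi_r\in\bar{\mathcal D}_r,$$ $$(b-By)^\top\pi\leq\lambda\theta_1+(1-\lambda)\theta_2\ \ \forall\lambda\in\Lambda,\ \pi\in\bar{\mathcal D}_p(\lambda).$$ The image of $(\theta_1,\theta_2,y)$ is $z=(\theta_1+(f^1)^\top y,\theta_2+(f^2)^\top y)$. Given $\bar y$, the subproblem $\mathrm{BS}(\bar y)$ is $\min\,((c^1)^\top x,(c^2)^\top x)$ s.t. $Ax\geq b-B\bar y$, $x\geq0$. The routine Explore$(\bar y)$. Solve $\mathrm{BS}(\bar y)$ with the bi-objective parametric simplex method. If it is infeasible, return an extreme ray $\pi_r\in\mathcal D_r$ along which the dual of the subproblem is unbounded. Otherwise one obtains efficient extreme solutions $x^1,\dots,x^k$ of $\mathrm{BS}(\bar y)$,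 weights $a_1,\dots,a_k,a_{k+1}$ with $a_1=1$, $a_{k+1}=0$ such that $x^i$ is optimal for $\lambda$-$\mathrm{BS}(\bar y)$ for all $\lambda\in[a_{i+1},a_i]$, and, for each $x^i$, vectors $(\pi_1^i,\pi_2^i)$ of dual values of the subproblem constraints with respect to objectives 1 and 2; return the weights and the weighted duals $\pi_p^{a_i}=a_i\pi_1^i+(1-a_i)\pi_2^i$. An efficient solution $(\bar\theta_1,\bar\theta_2,\bar y)$ of BM is called explored if the subproblem has been solved for $\bar y$, and unexplored otherwise. The BBSA algorithm. (1) Set $\bar{\mathcal X}_e=\bar{\mathcal Z}_n=\emptyset$, $\Lambda=\{1\}$. Solve $1$-$\mathrm{BR}\{\emptyset,\emptyset,\emptyset\}$ (first objective only) by standard single-objective Benders decomposition; the generated cuts initialise $\bar{\mathcal D}_r$ and $\bar{\mathcal D}_p(1)$, and the solution found is the current candidate $(\bar\theta_1,\bar\theta_2,\bar y)$ with image $\bar z$. (2) Run Explore$(\bar y)$. If a ray $\pi_r$ is returned, add it to $\bar{\mathcal D}_r$. Otherwise add the returned weights and $0$ to $\Lambda$, add $\pi_p^{a_i}$ to $\bar{\mathcal D}_p(a_i)$ for each $i=1,\dots,k$, and add $\pi_2^k$ to $\bar{\mathcal D}_p(0)$. This updates BM. (3) In the first iteration only, replace the candidate by the first efficient solution of the updated BM, found by performing steps of the bi-objective parametric simplex method until the first efficient solution (minimising the first objective) is reached. (4) If the candidate is a feasible solution of the current BM, store it in $\bar{\mathcal X}_e$ and its image in $\bar{\mathcal Z}_n$,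 and let it be the last solution, with image $z^{last}$. (5) Starting from the last solution, perform single pivots of the bi-objective parametric simplex method on the current BM until an unexplored solution with second objective value strictly smaller than $z_2^{last}$ is reached; this becomes the next candidate, and go to (2). If no further pivot exists (a minimiser of the second objective has been reached), go to (6). (6) Discard the non-extreme and the weakly non-dominated points from $\bar{\mathcal Z}_n$ and the corresponding solutions from $\bar{\mathcal X}_e$, so that only extreme ones are kept; output the remaining sets $\mathcal Z_{nx}$ and $\mathcal X_{ex}$.
   Formalization: Step (3) is corrected: an unexplored replacement candidate is first explored, and step (3) repeats until a solution is stored (as written, the claim fails). Z_nx means the final master problem's non-dominated extreme points, not the list output in step (6). *)

theory Defs
  imports "HOL-Analysis.Analysis"
begin

section \<open>Bi-objective optimisation\<close>

text \<open>A bi-objective problem is given by its feasible set \<open>S\<close> and its objective map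
  \<open>F\<close>; both components of \<open>F\<close> are minimised.\<close>

definition dominates :: "real \<times> real \<Rightarrow> real \<times> real \<Rightarrow> bool" where
  "dominates z w \<longleftrightarrow> fst z \<le> fst w \<and> snd z \<le> snd w \<and> z \<noteq> w"

definition efficient :: "'a set \<Rightarrow> ('a \<Rightarrow> real \<times> real) \<Rightarrow> 'a set" where
  "efficient S F = {v \<in> S. \<not> (\<exists>w\<in>S. dominates (F w) (F v))}"

definition nondominated :: "'a set \<Rightarrow> ('a \<Rightarrow> real \<times> real) \<Rightarrow> (real \<times> real) set" where
  "nondominated S F = F ` efficient S F"

definition nondominated_extreme :: "'a set \<Rightarrow> ('a \<Rightarrow> real \<times> real) \<Rightarrow> (real \<times> real) set" where
  "nondominated_extreme S F = {z \<in> nondominated S F. z extreme_point_of (F ` S)}"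

definition efficient_extreme :: "'a set \<Rightarrow> ('a \<Rightarrow> real \<times> real) \<Rightarrow> 'a set" where
  "efficient_extreme S F = {v \<in> efficient S F. F v \<in> nondominated_extreme S F}"

definition weighted :: "real \<Rightarrow> real \<times> real \<Rightarrow> real" where
  "weighted l z = l * fst z + (1 - l) * snd z"

definition weighted_optimal :: "'a set \<Rightarrow> ('a \<Rightarrow> real \<times> real) \<Rightarrow> real \<Rightarrow> 'a \<Rightarrow> bool" where
  "weighted_optimal S F l v \<longleftrightarrow> v \<in> S \<and> (\<forall>w\<in>S. weighted l (F v) \<le> weighted l (F w))"

text \<open>Boundedness alone does not exclude a problem without any efficient solution, so the
  solvability of all weighted problems is stated as well.\<close>

definition well_posed :: "'a::metric_space set \<Rightarrow> ('a \<Rightarrow> real \<times> real) \<Rightarrow> bool" where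
  "well_posed S F \<longleftrightarrow>
     bounded (efficient S F) \<and> (\<forall>l\<in>{0..1}. \<exists>v. weighted_optimal S F l v)"


section \<open>The problem, its subproblems and its master problems\<close>

record ('n::finite, 'p::finite, 'm::finite, 'q::finite) blp =
  Amat :: "real^'n^'m"
  Bmat :: "real^'p^'m"
  Dmat :: "real^'p^'q"
  cvec1 :: "real^'n"
  cvec2 :: "real^'n"
  fvec1 :: "real^'p"
  fvec2 :: "real^'p"
  bvec :: "real^'m"
  dvec :: "real^'q"

definition blp_feasible ::
    "('n::finite, 'p::finite, 'm::finite, 'q::finite) blp \<Rightarrow> ((real^'n) \<times> (real^'p)) set" where
  "blp_feasible P = {(x, y).
     bvec P \<le> Amat P *v x + Bmat P *v y \<and> dvec P \<le> Dmat P *v y \<and> 0 \<le> x \<and> 0 \<le> y}"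

definition blp_objective ::
    "('n::finite, 'p::finite, 'm::finite, 'q::finite) blp \<Rightarrow> (real^'n) \<times> (real^'p) \<Rightarrow> real \<times> real" where
  "blp_objective P = (\<lambda>(x, y).
     (cvec1 P \<bullet> x + fvec1 P \<bullet> y, cvec2 P \<bullet> x + fvec2 P \<bullet> y))"

definition sub_rhs ::
    "('n::finite, 'p::finite, 'm::finite, 'q::finite) blp \<Rightarrow> real^'p \<Rightarrow> real^'m" where
  "sub_rhs P y = bvec P - Bmat P *v y"

definition sub_feasible ::
    "('n::finite, 'p::finite, 'm::finite, 'q::finite) blp \<Rightarrow> real^'p \<Rightarrow> (real^'n) set" where
  "sub_feasible P y = {x. sub_rhs P y \<le> Amat P *v x \<and> 0 \<le> x}"

definition sub_objective ::
    "('n::finite, 'p::finite, 'm::finite, 'q::finite) blp \<Rightarrow> real^'n \<Rightarrow> real \<times> real" where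
  "sub_objective P x = (cvec1 P \<bullet> x, cvec2 P \<bullet> x)"

definition cost ::
    "('n::finite, 'p::finite, 'm::finite, 'q::finite) blp \<Rightarrow> real \<Rightarrow> real^'n" where
  "cost P l = l *\<^sub>R cvec1 P + (1 - l) *\<^sub>R cvec2 P"

definition dual_points ::
    "('n::finite, 'p::finite, 'm::finite, 'q::finite) blp \<Rightarrow> real \<Rightarrow> (real^'m) set" where
  "dual_points P l =
     {p. p extreme_point_of {p. transpose (Amat P) *v p \<le> cost P l \<and> 0 \<le> p}}"

text \<open>An extreme ray is represented by any of its nonzero vectors.\<close>

definition dual_rays ::
    "('n::finite, 'p::finite, 'm::finite, 'q::finite) blp \<Rightarrow> (real^'m) set" where
  "dual_rays P = {r. r \<noteq> 0 \<and>
     {t *\<^sub>R r |t. 0 \<le> t} face_of {p. transpose (Amat P) *v p \<le> 0 \<and> 0 \<le> p}}"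

text \<open>A master solution is a triple \<open>(\<theta>\<^sub>1, \<theta>\<^sub>2, y)\<close>.\<close>

type_synonym 'p master_sol = "real \<times> real \<times> (real^'p)"

definition master_feasible ::
    "('n::finite, 'p::finite, 'm::finite, 'q::finite) blp \<Rightarrow> (real^'m) set \<Rightarrow> real set
     \<Rightarrow> (real \<Rightarrow> (real^'m) set) \<Rightarrow> 'p master_sol set" where
  "master_feasible P Dr L Dp = {(t1, t2, y).
     dvec P \<le> Dmat P *v y \<and> 0 \<le> y \<and>
     (\<forall>r\<in>Dr. sub_rhs P y \<bullet> r \<le> 0) \<and>
     (\<forall>l\<in>L. \<forall>p\<in>Dp l. sub_rhs P y \<bullet> p \<le> l * t1 + (1 - l) * t2)}"

definition master_objective ::
    "('n::finite, 'p::finite, 'm::finite, 'q::finite) blp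
     \<Rightarrow> 'p master_sol \<Rightarrow> real \<times> real" where
  "master_objective P = (\<lambda>(t1, t2, y). (t1 + fvec1 P \<bullet> y, t2 + fvec2 P \<bullet> y))"


section \<open>Results of the simplex method\<close>

text \<open>Bases of the standard form \<open>A x - s = r\<close>, \<open>x \<ge> 0\<close>, \<open>s \<ge> 0\<close>: \<open>Inl j\<close> stands for the
  variable \<open>x\<^sub>j\<close> and \<open>Inr i\<close> for the slack variable \<open>s\<^sub>i\<close>.\<close>

definition std_column :: "real^'n^'m \<Rightarrow> 'n::finite + 'm::finite \<Rightarrow> real^'m" where
  "std_column A = case_sum (\<lambda>j. column j A) (\<lambda>i. - axis i 1)"

definition simplex_basis :: "real^'n^'m \<Rightarrow> ('n::finite + 'm::finite) set \<Rightarrow> bool" where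
  "simplex_basis A W \<longleftrightarrow> card W = CARD('m) \<and> inj_on (std_column A) W \<and>
     independent (std_column A ` W)"

definition basic_solution ::
    "real^'n^'m \<Rightarrow> real^'m \<Rightarrow> ('n::finite + 'm::finite) set \<Rightarrow> real^'n \<Rightarrow> bool" where
  "basic_solution A r W x \<longleftrightarrow>
     (\<forall>j. Inl j \<notin> W \<longrightarrow> x $ j = 0) \<and> (\<forall>i. Inr i \<notin> W \<longrightarrow> (A *v x) $ i = r $ i)"

text \<open>The dual values of the constraints \<open>A x \<ge> r\<close> at a basis make the reduced costs of all
  basic variables vanish; slack variables have cost \<open>0\<close>.\<close>

definition dual_values ::
    "real^'n^'m \<Rightarrow> real^'n \<Rightarrow> ('n::finite + 'm::finite) set \<Rightarrow> real^'m \<Rightarrow> bool" where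
  "dual_values A c W p \<longleftrightarrow>
     (\<forall>j. Inl j \<in> W \<longrightarrow> column j A \<bullet> p = c $ j) \<and> (\<forall>i. Inr i \<in> W \<longrightarrow> p $ i = 0)"

definition optimal_basis ::
    "real^'n^'m \<Rightarrow> real^'m \<Rightarrow> real^'n \<Rightarrow> ('n::finite + 'm::finite) set \<Rightarrow> bool" where
  "optimal_basis A r c W \<longleftrightarrow> simplex_basis A W \<and>
     (\<exists>x. basic_solution A r W x \<and> 0 \<le> x \<and> r \<le> A *v x) \<and>
     (\<exists>p. dual_values A c W p \<and> transpose A *v p \<le> c \<and> 0 \<le> p)"

text \<open>What the parametric simplex method returns for a feasible subproblem, with indices
  \<open>1..k\<close> (and \<open>1..k+1\<close> for the weights).  The weight \<open>a (i + 1)\<close> is the critical weight at which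
  the \<open>i\<close>-th basis ceases to be optimal.  Under degeneracy one solution may occur with several
  bases, hence \<open>x i = x (i + 1)\<close> is possible; bases that are optimal for a single weight only
  are not listed.\<close>

definition explore_cuts ::
    "('n::finite, 'p::finite, 'm::finite, 'q::finite) blp \<Rightarrow> real^'p \<Rightarrow> nat \<Rightarrow> (nat \<Rightarrow> real)
     \<Rightarrow> (nat \<Rightarrow> real^'m) \<Rightarrow> (nat \<Rightarrow> real^'m) \<Rightarrow> bool" where
  "explore_cuts P y k a p1 p2 \<longleftrightarrow>
     1 \<le> k \<and> a 1 = 1 \<and> a (k + 1) = 0 \<and>
     (\<exists>x W. \<forall>i\<in>{1..k}. a (i + 1) < a i \<and>
        x i \<in> efficient_extreme (sub_feasible P y) (sub_objective P) \<and>
        basic_solution (Amat P) (sub_rhs P y) (W i) (x i) \<and>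
        dual_values (Amat P) (cvec1 P) (W i) (p1 i) \<and>
        dual_values (Amat P) (cvec2 P) (W i) (p2 i) \<and>
        (\<forall>l\<in>{a (i + 1)..a i}.
           weighted_optimal (sub_feasible P y) (sub_objective P) l (x i) \<and>
           optimal_basis (Amat P) (sub_rhs P y) (cost P l) (W i)) \<and>
        (\<forall>l\<in>{0..1}. optimal_basis (Amat P) (sub_rhs P y) (cost P l) (W i) \<longrightarrow> a (i + 1) \<le> l))"

text \<open>The dual of the subproblem is unbounded along \<open>r\<close>.\<close>

definition explore_ray ::
    "('n::finite, 'p::finite, 'm::finite, 'q::finite) blp \<Rightarrow> real^'p \<Rightarrow> real^'m \<Rightarrow> bool" where
  "explore_ray P y r \<longleftrightarrow>
     sub_feasible P y = {} \<and> r \<in> dual_rays P \<and> 0 < sub_rhs P y \<bullet> r"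

definition first_efficient :: "'a::real_vector set \<Rightarrow> ('a \<Rightarrow> real \<times> real) \<Rightarrow> 'a \<Rightarrow> bool" where
  "first_efficient S F v \<longleftrightarrow> v extreme_point_of S \<and> v \<in> efficient S F \<and>
     (\<forall>w\<in>S. fst (F v) \<le> fst (F w))"

text \<open>A pivot of the parametric simplex method, seen on solutions: it traverses an edge of
  solutions that are optimal for a common (critical) weight, and since the entering variable
  has negative reduced cost with respect to the second objective, that objective decreases.
  Degenerate pivots do not change the solution and are not visible here.\<close>

definition pivot :: "'a::euclidean_space set \<Rightarrow> ('a \<Rightarrow> real \<times> real) \<Rightarrow> 'a \<Rightarrow> 'a \<Rightarrow> bool" where
  "pivot S F v w \<longleftrightarrow> v extreme_point_of S \<and> w extreme_point_of S \<and>
     closed_segment v w edge_of S \<and>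
     (\<exists>l\<in>{0<..<1}. weighted_optimal S F l v \<and> weighted_optimal S F l w) \<and>
     snd (F w) < snd (F v)"

text \<open>Result of single-objective Benders decomposition for the first objective: the relaxed
  master problem with the generated cuts is solved, and its optimal solution attains the value
  of the subproblem.  The second component of the solution is arbitrary.\<close>

definition benders_first ::
    "('n::finite, 'p::finite, 'm::finite, 'q::finite) blp \<Rightarrow> (real^'m) set \<Rightarrow> (real^'m) set
     \<Rightarrow> 'p master_sol \<Rightarrow> bool" where
  "benders_first P R Q v \<longleftrightarrow>
     finite R \<and> R \<subseteq> dual_rays P \<and> finite Q \<and> Q \<subseteq> dual_points P 1 \<and>
     weighted_optimal (master_feasible P R {1} (\<lambda>l. if l = 1 then Q else {}))
       (master_objective P) 1 v \<and>
     (\<exists>x. weighted_optimal (sub_feasible P (snd (snd v))) (sub_objective P) 1 x \<and>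
        cvec1 P \<bullet> x = fst v)"


section \<open>The algorithm as a transition system\<close>

text \<open>\<open>StepN\<close> means that step \<open>N\<close> is executed next; \<open>Step1\<close> solves the problem for the first
  objective, \<open>Step2\<close> explores the candidate, \<open>Step3\<close> replaces the candidate by the first
  efficient solution, \<open>Step4\<close> stores it, \<open>Step5\<close> pivots, \<open>Step6\<close> produces the output.\<close>

datatype phase = Step1 | Step2 | Step3 | Step4 | Step5 | Step6 | Finished

record ('m::finite, 'p::finite) bbsa_state =
  phase :: phase
  rays :: "(real^'m) set"
  weights :: "real set"
  points :: "real \<Rightarrow> (real^'m) set"
  explored :: "(real^'p) set"                  \<comment> \<open>the \<open>y\<close> for which the subproblem was solved\<close>
  candidate :: "'p master_sol"
  last_sol :: "'p master_sol"
  position :: "'p master_sol"         \<comment> \<open>current solution while pivoting\<close>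
  stored_sols :: "'p master_sol set"
  stored_images :: "(real \<times> real) set"

definition bm_feasible ::
    "('n::finite, 'p::finite, 'm::finite, 'q::finite) blp \<Rightarrow> ('m, 'p) bbsa_state
     \<Rightarrow> 'p master_sol set" where
  "bm_feasible P s = master_feasible P (rays s) (weights s) (points s)"

definition bm_valid ::
    "('n::finite, 'p::finite, 'm::finite, 'q::finite) blp \<Rightarrow> ('m, 'p) bbsa_state \<Rightarrow> bool" where
  "bm_valid P s \<longleftrightarrow> rays s \<subseteq> dual_rays P \<and> weights s \<subseteq> {0..1} \<and>
     (\<forall>l\<in>weights s. points s l \<subseteq> dual_points P l)"

text \<open>The values of \<open>candidate\<close>, \<open>last_sol\<close> and \<open>position\<close> below are placeholders; each is
  assigned before it is read.\<close>

definition bbsa_start :: "('m::finite, 'p::finite) bbsa_state" where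
  "bbsa_start = \<lparr>phase = Step1, rays = {}, weights = {1}, points = (\<lambda>_. {}), explored = {},
     candidate = 0, last_sol = 0, position = 0, stored_sols = {}, stored_images = {}\<rparr>"

text \<open>An unexplored solution whose second objective is below that of the last solution.\<close>

definition next_candidate ::
    "('n::finite, 'p::finite, 'm::finite, 'q::finite) blp \<Rightarrow> ('m, 'p) bbsa_state
     \<Rightarrow> 'p master_sol \<Rightarrow> bool" where
  "next_candidate P s w \<longleftrightarrow> snd (snd w) \<notin> explored s \<and>
     snd (master_objective P w) < snd (master_objective P (last_sol s))"

text \<open>The first iteration lasts until a solution is stored.  In rule \<open>first\<close> the new candidate
  may have a \<open>y\<close> for which the subproblem has not been solved.  It then need not be compatible
  with the original problem although it is feasible for the master problem, so it is explored
  before it can be stored.\<close>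

inductive bbsa_step ::
    "('n::finite, 'p::finite, 'm::finite, 'q::finite) blp
     \<Rightarrow> ('m, 'p) bbsa_state \<Rightarrow> ('m, 'p) bbsa_state \<Rightarrow> bool"
  for P :: "('n, 'p, 'm, 'q) blp" where
  init: "\<lbrakk>phase s = Step1; benders_first P R Q v\<rbrakk> \<Longrightarrow>
    bbsa_step P s (s\<lparr>phase := Step2, rays := R, points := (points s)(1 := Q), candidate := v\<rparr>)"
| ray: "\<lbrakk>phase s = Step2; y = snd (snd (candidate s)); explore_ray P y r\<rbrakk> \<Longrightarrow>
    bbsa_step P s (s\<lparr>phase := Step3, explored := insert y (explored s),
      rays := insert r (rays s)\<rparr>)"
| cuts: "\<lbrakk>phase s = Step2; y = snd (snd (candidate s)); explore_cuts P y k a p1 p2\<rbrakk> \<Longrightarrow>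
    bbsa_step P s (s\<lparr>phase := Step3, explored := insert y (explored s),
      weights := weights s \<union> a ` {1..k + 1} \<union> {0},
      points := (\<lambda>l. points s l
        \<union> {a i *\<^sub>R p1 i + (1 - a i) *\<^sub>R p2 i |i. i \<in> {1..k} \<and> a i = l}
        \<union> (if l = 0 then {p2 k} else {}))\<rparr>)"
| first: "\<lbrakk>phase s = Step3; stored_sols s = {};
      first_efficient (bm_feasible P s) (master_objective P) v\<rbrakk> \<Longrightarrow>
    bbsa_step P s (s\<lparr>phase := (if snd (snd v) \<in> explored s then Step4 else Step2),
      candidate := v\<rparr>)"
| not_first: "\<lbrakk>phase s = Step3; stored_sols s \<noteq> {}\<rbrakk> \<Longrightarrow> bbsa_step P s (s\<lparr>phase := Step4\<rparr>)"
| store: "\<lbrakk>phase s = Step4; candidate s \<in> bm_feasible P s\<rbrakk> \<Longrightarrow>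
    bbsa_step P s (s\<lparr>phase := Step5, last_sol := candidate s, position := candidate s,
      stored_sols := insert (candidate s) (stored_sols s),
      stored_images := insert (master_objective P (candidate s)) (stored_images s)\<rparr>)"
| reject: "\<lbrakk>phase s = Step4; candidate s \<notin> bm_feasible P s\<rbrakk> \<Longrightarrow>
    bbsa_step P s (s\<lparr>phase := Step5, position := last_sol s\<rparr>)"
| pivot_on: "\<lbrakk>phase s = Step5; pivot (bm_feasible P s) (master_objective P) (position s) w;
      \<not> next_candidate P s w\<rbrakk> \<Longrightarrow>
    bbsa_step P s (s\<lparr>position := w\<rparr>)"
| pivot_found: "\<lbrakk>phase s = Step5; pivot (bm_feasible P s) (master_objective P) (position s) w;
      next_candidate P s w\<rbrakk> \<Longrightarrow>
    bbsa_step P s (s\<lparr>phase := Step2, position := w, candidate := w\<rparr>)"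
| pivot_none: "\<lbrakk>phase s = Step5;
      \<not> (\<exists>w. pivot (bm_feasible P s) (master_objective P) (position s) w)\<rbrakk> \<Longrightarrow>
    bbsa_step P s (s\<lparr>phase := Step6\<rparr>)"
| discard: "phase s = Step6 \<Longrightarrow>
    bbsa_step P s (s\<lparr>phase := Finished,
      stored_sols := {v \<in> stored_sols s. master_objective P v
        \<in> nondominated_extreme (bm_feasible P s) (master_objective P)},
      stored_images := stored_images s
        \<inter> nondominated_extreme (bm_feasible P s) (master_objective P)\<rparr>)"

end

theory Submission
  imports Defs
begin

text \<open>By linear programming duality, a master solution \<open>(\<theta>\<^sub>1, \<theta>\<^sub>2, y)\<close> whose \<open>y\<close> has been explored lies
  above the objective vector of some \<open>x\<close> that is feasible for the subproblem at \<open>y\<close>: the returned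
  weights contain all breakpoints of the concave, piecewise linear value function of the weighted
  subproblem, so the cuts at these weights imply the cuts at all weights.  Hence, starting from a
  minimiser of the first objective and pivoting through explored vertices only, every point of the
  master problem whose second objective is at least that of the current vertex is weakly dominated
  by a point of the original problem.  This property survives the addition of cuts, and at the last
  vertex it covers the whole master problem, which forces equality of the non-dominated extreme
  points.

  For termination, all weights that can be returned are end points of the intervals on which one of
  the finitely many bases is dual feasible, so up to scaling of rays there are finitely many cuts.
  An exploration adds a new cut or makes one of the finitely many vertices of the unchanged master
  problem explored, and pivots decrease the second objective.\<close>

section \<open>Farkas' lemma and duality\<close>

text \<open>Two requirements shape the proof. A run that gets stuck must be in
  \<open>Finished\<close>, so every step has to be shown executable; this is why extreme rays,
  optimal bases and descending edges are constructed. And the cuts must be bounded in number over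
  infinitely many \<open>y\<close>. For this, optimality of a basis is split into primal
  feasibility, which depends on \<open>y\<close> only, and dual feasibility, which depends on the
  weight only: a critical weight is the left end of an interval that does not mention
  \<open>y\<close>.

  A further obstacle is that a candidate may be cut off by its own exploration. The argument is
  therefore anchored at the last stored vertex. It lies above a point of the original problem, so by
  weak duality no later cut removes it, and extremality, efficiency and weighted optimality pass to
  any smaller feasible set that still contains it.\<close>

declare transpose_matrix_vector [simp del]

lemma vec_inner_mono:
  fixes p :: "real^'n"
  assumes "0 \<le> p" "x \<le> y"
  shows "p \<bullet> x \<le> p \<bullet> y"
  using assms by (auto simp: inner_vec_def less_eq_vec_def intro!: sum_mono mult_left_mono)

lemma inner_transpose:
  fixes A :: "real^'n^'m"
  shows "(transpose A *v p) \<bullet> x = p \<bullet> (A *v x)"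
  by (simp add: transpose_matrix_vector dot_lmul_matrix)

lemma nonneg_combinations_separation:
  fixes g :: "'i \<Rightarrow> 'a::euclidean_space"
  assumes "finite I"
  defines "C \<equiv> {\<Sum>i\<in>I. u i *\<^sub>R g i |u. \<forall>i\<in>I. 0 \<le> u i}"
  shows closed_nonneg_combinations: "closed C"
    and "w \<notin> C \<Longrightarrow> \<exists>a. a \<bullet> w < 0 \<and> (\<forall>i\<in>I. 0 \<le> a \<bullet> g i)"
proof -
  have cc: "convex_cone C"
    unfolding convex_cone_iff
  proof (intro conjI ballI allI impI)
    show "0 \<in> C" unfolding C_def by (rule CollectI, rule exI[of _ "\<lambda>_. 0"]) simp
  next
    fix x y assume "x \<in> C" "y \<in> C"
    then obtain u v where "x = (\<Sum>i\<in>I. u i *\<^sub>R g i)" "\<forall>i\<in>I. 0 \<le> u i"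
      "y = (\<Sum>i\<in>I. v i *\<^sub>R g i)" "\<forall>i\<in>I. 0 \<le> v i" unfolding C_def by blast
    then show "x + y \<in> C" unfolding C_def
      by (intro CollectI exI[of _ "\<lambda>i. u i + v i"]) (simp add: sum.distrib scaleR_add_left)
  next
    fix x and c :: real assume "x \<in> C" "0 \<le> c"
    then obtain u where "x = (\<Sum>i\<in>I. u i *\<^sub>R g i)" "\<forall>i\<in>I. 0 \<le> u i" unfolding C_def by blast
    with \<open>0 \<le> c\<close> show "c *\<^sub>R x \<in> C" unfolding C_def
      by (intro CollectI exI[of _ "\<lambda>i. c * u i"]) (simp add: scaleR_sum_right)
  qed
  have gC: "g i \<in> C" if "i \<in> I" for i
    unfolding C_def using that assms(1)
    by (intro CollectI exI[of _ "\<lambda>j. if j = i then 1 else 0"])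
      (simp add: if_distrib[of "\<lambda>t. t *\<^sub>R _"] cong: if_cong)
  have "C = convex_cone hull (g ` I)"
  proof
    show "convex_cone hull (g ` I) \<subseteq> C" by (rule hull_minimal) (use gC cc in auto)
    have "(\<Sum>i\<in>J. u i *\<^sub>R g i) \<in> convex_cone hull (g ` I)"
      if "J \<subseteq> I" "\<forall>i\<in>J. 0 \<le> u i" for u J
      using finite_subset[OF that(1) assms(1)] that
    proof (induction J rule: finite_induct)
      case empty
      then show ?case by (simp add: convex_cone_hull_contains_0)
    next
      case (insert j J)
      have "u j *\<^sub>R g j \<in> convex_cone hull (g ` I)"
        using insert.prems by (intro convex_cone_hull_mul hull_inc) auto
      with insert show ?case by (simp add: convex_cone_hull_add)
    qed
    then show "C \<subseteq> convex_cone hull (g ` I)" unfolding C_def by auto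
  qed
  then show cl: "closed C" using assms(1) by (simp add: closed_convex_cone_hull)
  assume "w \<notin> C"
  then obtain a b where ab: "a \<bullet> w < b" "\<And>x. x \<in> C \<Longrightarrow> b < a \<bullet> x"
    using separating_hyperplane_closed_point[of C w] cl cc by (auto simp: convex_cone_def)
  have b0: "b < 0" using ab(2)[OF convex_cone_contains_0[OF cc]] by simp
  have "0 \<le> a \<bullet> g i" if "i \<in> I" for i
  proof (rule ccontr)
    assume neg: "\<not> 0 \<le> a \<bullet> g i"
    \<comment> \<open>This multiple of \<open>g i\<close> lies on the hyperplane
      \<open>a \<bullet> x = b\<close>, whereas the whole cone lies strictly above it. Hence the
      bound \<open>b\<close> can be replaced by 0.\<close>
    have "(b / (a \<bullet> g i)) *\<^sub>R g i \<in> C"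
      using convex_cone_scaleR[OF cc _ gC[OF that]] neg b0 by (simp add: divide_nonpos_neg)
    from ab(2)[OF this] neg show False by simp
  qed
  with ab b0 show "\<exists>a. a \<bullet> w < 0 \<and> (\<forall>i\<in>I. 0 \<le> a \<bullet> g i)" by (intro exI[of _ a]) auto
qed

text \<open>A coefficient family on the sum type encodes variables and slacks at once, so a
  combination of columns is a right-hand side of the standard form.\<close>

lemma sum_std_column:
  "(\<Sum>w\<in>UNIV. u w *\<^sub>R std_column A w) = A *v (\<chi> j. u (Inl j)) - (\<chi> i. u (Inr i))"
proof -
  have "(\<Sum>w\<in>UNIV. u w *\<^sub>R std_column A w)
      = (\<Sum>j\<in>UNIV. u (Inl j) *\<^sub>R column j A) + (\<Sum>i\<in>UNIV. u (Inr i) *\<^sub>R (- axis i 1))"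
    by (simp add: UNIV_Plus_UNIV[symmetric] sum.Plus std_column_def del: UNIV_Plus_UNIV scaleR_minus_right)
  also have "(\<Sum>j\<in>UNIV. u (Inl j) *\<^sub>R column j A) = A *v (\<chi> j. u (Inl j))"
    by (simp add: matrix_mult_sum scalar_mult_eq_scaleR)
  also have "(\<Sum>i\<in>UNIV. u (Inr i) *\<^sub>R (- axis i 1)) = - (\<chi> i. u (Inr i))"
    by (simp add: sum_negf vec_eq_iff axis_def sum.delta' if_distrib[of "\<lambda>t. _ * t"] cong: if_cong)
  finally show ?thesis by simp
qed

lemma inner_std_column:
  "p \<bullet> std_column A (Inl j) = (transpose A *v p) $ j" "p \<bullet> std_column A (Inr i) = - p $ i"
  by (simp_all add: std_column_def inner_axis column_def matrix_vector_mult_def transpose_def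
      inner_vec_def[of p "\<chi> i. _ i"] mult.commute)

text \<open>Farkas' lemma for two objectives: the multiplier \<open>(p, a\<^sub>1, a\<^sub>2)\<close> covers dual solutions of all
  weighted problems as well as dual rays.\<close>

lemma biobjective_farkas:
  fixes A :: "real^'n^'m"
  assumes "\<And>p a1 a2. 0 \<le> p \<Longrightarrow> 0 \<le> a1 \<Longrightarrow> 0 \<le> a2 \<Longrightarrow>
      transpose A *v p \<le> a1 *\<^sub>R c1 + a2 *\<^sub>R c2 \<Longrightarrow> r \<bullet> p \<le> a1 * t1 + a2 * t2"
  shows "\<exists>x\<ge>0. r \<le> A *v x \<and> c1 \<bullet> x \<le> t1 \<and> c2 \<bullet> x \<le> t2"
proof -
  \<comment> \<open>The system in standard form: a column is extended by its two costs, which are 0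
    for slack variables, and \<open>Inr True\<close>, \<open>Inr False\<close> are the slacks of the
    two objective bounds.\<close>
  define g where "g = case_sum
    (\<lambda>w. (std_column A w, case_sum (\<lambda>j. c1 $ j) (\<lambda>i. 0) w, case_sum (\<lambda>j. c2 $ j) (\<lambda>i. 0) w))
    (\<lambda>b. if b then (0 :: real^'m, 1 :: real, 0 :: real) else (0, 0, 1))"
  let ?C = "{\<Sum>i\<in>UNIV. u i *\<^sub>R g i |u. \<forall>i\<in>UNIV. 0 \<le> u i}"
  have "(r, t1, t2) \<in> ?C"
  proof (rule ccontr)
    assume "(r, t1, t2) \<notin> ?C"
    then obtain a where a: "a \<bullet> (r, t1, t2) < 0" "\<And>i. 0 \<le> a \<bullet> g i"
      using nonneg_combinations_separation(2)[OF finite_class.finite_UNIV, of "(r, t1, t2)" g] by auto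
    obtain q a1 a2 where aq: "a = (q, a1, a2)" by (cases a)
    have 1: "0 \<le> (transpose A *v q) $ j + (a1 * c1 $ j + a2 * c2 $ j)" for j
      using a(2)[of "Inl (Inl j)"] by (simp add: g_def aq inner_std_column)
    have 2: "q $ i \<le> 0" for i
      using a(2)[of "Inl (Inr i)"] by (simp add: g_def aq inner_std_column)
    have 3: "0 \<le> a1" "0 \<le> a2"
      using a(2)[of "Inr True"] a(2)[of "Inr False"] by (simp_all add: g_def aq)
    have "r \<bullet> (- q) \<le> a1 * t1 + a2 * t2"
    proof (rule assms)
      show "transpose A *v (- q) \<le> a1 *\<^sub>R c1 + a2 *\<^sub>R c2"
        unfolding linear_neg[OF matrix_vector_mul_linear] less_eq_vec_def
        using 1 by (simp add: minus_le_iff) (smt (verit))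
    qed (use 2 3 in \<open>auto simp: less_eq_vec_def\<close>)
    with a(1) show False by (simp add: aq inner_commute)
  qed
  then obtain u where u: "\<And>i. 0 \<le> u i" "(r, t1, t2) = (\<Sum>i\<in>UNIV. u i *\<^sub>R g i)" by auto
  have s: "(\<Sum>i\<in>UNIV. u i *\<^sub>R g i) = (\<Sum>w\<in>UNIV. u (Inl w) *\<^sub>R g (Inl w)) + (\<Sum>b\<in>UNIV. u (Inr b) *\<^sub>R g (Inr b))"
    by (simp add: UNIV_Plus_UNIV[symmetric] sum.Plus del: UNIV_Plus_UNIV)
  define x where "x = (\<chi> j. u (Inl (Inl j)))"
  have c: "(\<Sum>w\<in>UNIV. u (Inl w) * case_sum (\<lambda>j. c $ j) (\<lambda>i. 0) w) = c \<bullet> x" for c :: "real^'n"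
    by (simp add: UNIV_Plus_UNIV[symmetric] sum.Plus inner_vec_def x_def mult.commute del: UNIV_Plus_UNIV)
  have r: "r = A *v x - (\<chi> i. u (Inl (Inr i)))" and t1: "t1 = c1 \<bullet> x + u (Inr True)"
    and t2: "t2 = c2 \<bullet> x + u (Inr False)"
    using u(2)[unfolded s] sum_std_column[of "\<lambda>w. u (Inl w)" A]
    by (simp_all add: prod_eq_iff fst_sum snd_sum g_def UNIV_bool c x_def)
  show ?thesis
  proof (intro exI[of _ x] conjI)
    show "0 \<le> x" using u(1) by (simp add: x_def less_eq_vec_def)
    show "r \<le> A *v x" using u(1) by (simp add: r less_eq_vec_def)
  qed (use u(1) t1 t2 in auto)
qed

lemma weak_duality:
  fixes A :: "real^'n^'m"
  assumes "0 \<le> p" "transpose A *v p \<le> c" "0 \<le> x" "r \<le> A *v x"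
  shows "r \<bullet> p \<le> c \<bullet> x"
proof -
  have "r \<bullet> p \<le> p \<bullet> (A *v x)" using vec_inner_mono[OF assms(1,4)] by (simp add: inner_commute)
  also have "\<dots> = x \<bullet> (transpose A *v p)" using inner_transpose[of A p x] by (simp add: inner_commute)
  also have "\<dots> \<le> c \<bullet> x" using vec_inner_mono[OF assms(3,2)] by (simp add: inner_commute)
  finally show ?thesis .
qed

text \<open>Attainment without compactness: weak duality against every value in \<open>V\<close>
  passes to the infimum, so the system with the bound \<open>Inf V\<close> satisfies the Farkas
  condition. Both objectives are taken to be \<open>c\<close>.\<close>

lemma primal_optimum_exists:
  fixes A :: "real^'n^'m"
  assumes x0: "0 \<le> x0" "r \<le> A *v x0" and p0: "0 \<le> p0" "transpose A *v p0 \<le> c"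
  shows "\<exists>x\<ge>0. r \<le> A *v x \<and> (\<forall>x'\<ge>0. r \<le> A *v x' \<longrightarrow> c \<bullet> x \<le> c \<bullet> x')"
proof -
  define V where "V = {c \<bullet> x |x. 0 \<le> x \<and> r \<le> A *v x}"
  have V0: "V \<noteq> {}" using x0 by (auto simp: V_def)
  have bdd: "bdd_below V" unfolding bdd_below_def V_def using weak_duality[OF p0] by blast
  have "\<exists>x\<ge>0. r \<le> A *v x \<and> c \<bullet> x \<le> Inf V \<and> c \<bullet> x \<le> Inf V"
  proof (rule biobjective_farkas)
    fix p and a1 a2 :: real
    assume p: "0 \<le> p" "0 \<le> a1" "0 \<le> a2" "transpose A *v p \<le> a1 *\<^sub>R c + a2 *\<^sub>R c"
    have *: "r \<bullet> p \<le> (a1 + a2) * v" if "v \<in> V" for v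
    proof -
      obtain x where x: "v = c \<bullet> x" "0 \<le> x" "r \<le> A *v x" using \<open>v \<in> V\<close> by (auto simp: V_def)
      show ?thesis using weak_duality[OF p(1,4) x(2,3)] by (simp add: x(1) algebra_simps)
    qed
    show "r \<bullet> p \<le> a1 * Inf V + a2 * Inf V"
    proof (cases "a1 + a2 = 0")
      case True
      moreover obtain v where "v \<in> V" using V0 by blast
      ultimately have "r \<bullet> p \<le> 0" using *[of v] by simp
      with True p(2,3) show ?thesis by (simp add: add_nonneg_eq_0_iff)
    next
      case False
      then have pos: "0 < a1 + a2" using p by simp
      have "r \<bullet> p / (a1 + a2) \<le> Inf V"
        by (rule cInf_greatest[OF V0]) (use * pos in \<open>simp add: pos_divide_le_eq mult.commute\<close>)
      then show ?thesis using pos by (simp add: pos_divide_le_eq algebra_simps)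
    qed
  qed
  then obtain x where x: "0 \<le> x" "r \<le> A *v x" "c \<bullet> x \<le> Inf V" by blast
  have "c \<bullet> x \<le> c \<bullet> x'" if "0 \<le> x'" "r \<le> A *v x'" for x'
    using cInf_lower[OF _ bdd, of "c \<bullet> x'"] that x(3) by (force simp: V_def)
  with x show ?thesis by blast
qed

text \<open>Farkas for the dual system, with matrix \<open>- transpose A\<close> and both objectives
  \<open>- r\<close>. A multiplier \<open>y\<close> with total weight \<open>a\<close> is a
  recession direction if \<open>a = 0\<close>, and otherwise \<open>y / a\<close> is a primal point;
  both cases are compared with the optimum \<open>x\<close>.\<close>

lemma strong_duality:
  fixes A :: "real^'n^'m"
  assumes x: "0 \<le> x" "r \<le> A *v x" and opt: "\<And>x'. 0 \<le> x' \<Longrightarrow> r \<le> A *v x' \<Longrightarrow> c \<bullet> x \<le> c \<bullet> x'"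
  shows "\<exists>p\<ge>0. transpose A *v p \<le> c \<and> r \<bullet> p = c \<bullet> x"
proof -
  have minus: "(- M) *v v = - (M *v v)" for M :: "real^'a^'b" and v
    by (simp add: matrix_vector_mult_def vec_eq_iff sum_negf)
  have tm: "transpose (- transpose A) = - A" by (simp add: transpose_def vec_eq_iff)
  have "\<exists>p\<ge>0. - c \<le> (- transpose A) *v p \<and> - r \<bullet> p \<le> - (c \<bullet> x) \<and> - r \<bullet> p \<le> - (c \<bullet> x)"
  proof (rule biobjective_farkas)
    fix y and a1 a2 :: real
    assume y: "0 \<le> y" "0 \<le> a1" "0 \<le> a2"
      "transpose (- transpose A) *v y \<le> a1 *\<^sub>R - r + a2 *\<^sub>R - r"
    define a where "a = a1 + a2"
    have Ay: "a *\<^sub>R r \<le> A *v y"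
      using y(4) by (simp add: tm minus a_def less_eq_vec_def algebra_simps)
    have "a * (c \<bullet> x) \<le> c \<bullet> y"
    proof (cases "a = 0")
      case True
      have "c \<bullet> x \<le> c \<bullet> (x + y)"
        by (rule opt) (use x y Ay True in \<open>auto simp: less_eq_vec_def matrix_vector_right_distrib
            intro: add_nonneg_nonneg add_increasing2\<close>)
      then show ?thesis by (simp add: True inner_add_right)
    next
      case False
      then have pos: "0 < a" using y by (simp add: a_def)
      have "c \<bullet> x \<le> c \<bullet> ((1 / a) *\<^sub>R y)"
        by (rule opt) (use y Ay pos in \<open>auto simp: less_eq_vec_def matrix_vector_mult_scaleR
            field_simps\<close>)
      then show ?thesis using pos by (simp add: field_simps)
    qed
    then show "- c \<bullet> y \<le> a1 * - (c \<bullet> x) + a2 * - (c \<bullet> x)" by (simp add: a_def algebra_simps)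
  qed
  then obtain p where p: "0 \<le> p" "- c \<le> (- transpose A) *v p" "c \<bullet> x \<le> r \<bullet> p" by auto
  have "transpose A *v p \<le> c" using p(2) by (simp add: minus less_eq_vec_def)
  with weak_duality[OF p(1) this x] p show ?thesis by (intro exI[of _ p]) auto
qed

section \<open>Extreme points and extreme rays\<close>

lemma linear_functional_inner:
  fixes f :: "'a::euclidean_space \<Rightarrow> real"
  assumes "linear f"
  shows "f x = adjoint f 1 \<bullet> x"
  using adjoint_works[OF assms, of x 1] by (simp add: inner_commute)

lemma polyhedron_linear_le:
  fixes f :: "'a::euclidean_space \<Rightarrow> real"
  assumes "linear f"
  shows "polyhedron {x. f x \<le> b}"
  by (subst linear_functional_inner[OF assms]) (rule polyhedron_halfspace_le)

lemma face_of_linear_argmin: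
  fixes f :: "'a::euclidean_space \<Rightarrow> real"
  assumes "convex S" "linear f"
  shows "{x \<in> S. \<forall>y\<in>S. f x \<le> f y} face_of S"
proof (cases "{x \<in> S. \<forall>y\<in>S. f x \<le> f y} = {}")
  case False
  then obtain x where x: "x \<in> S" "\<And>y. y \<in> S \<Longrightarrow> f x \<le> f y" by blast
  have "{x \<in> S. \<forall>y\<in>S. f x \<le> f y} = S \<inter> {y. adjoint f 1 \<bullet> y = f x}"
    using x by (auto simp flip: linear_functional_inner[OF assms(2)] intro: antisym)
  also have "\<dots> face_of S"
    using x(2) by (intro face_of_Int_supporting_hyperplane_ge[OF assms(1)])
      (simp flip: linear_functional_inner[OF assms(2)])
  finally show ?thesis .
qed (simp only: empty_face_of)

lemma extreme_point_in_bounded_face: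
  fixes S :: "'a::euclidean_space set"
  assumes "T face_of S" "closed S" "convex S" "bounded T" "T \<noteq> {}"
  obtains v where "v \<in> T" "v extreme_point_of S"
proof -
  have "closed T" using face_of_imp_closed assms by blast
  then obtain v where "v extreme_point_of T"
    using extreme_point_exists_convex[of T] assms face_of_imp_convex
    by (metis compact_eq_bounded_closed)
  then show ?thesis using that extreme_point_of_face[OF assms(1)] by blast
qed

text \<open>The face of minimisers may be unbounded. Minimising the coordinate sum over it selects a
  bounded subface, since sublevel sets of this sum are bounded in the orthant, and a bounded
  nonempty face has an extreme point.\<close>

lemma extreme_minimiser_in_orthant:
  fixes S :: "(real^'n) set"
  assumes S: "closed S" "convex S" "S \<subseteq> {x. 0 \<le> x}" and f: "linear f"
    and x0: "x0 \<in> S" "\<And>y. y \<in> S \<Longrightarrow> f x0 \<le> (f y :: real)"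
  obtains x where "x extreme_point_of S" "\<And>y. y \<in> S \<Longrightarrow> f x \<le> f y"
proof -
  define T where "T = {x \<in> S. \<forall>y\<in>S. f x \<le> f y}"
  have T: "T face_of S" unfolding T_def by (rule face_of_linear_argmin[OF S(2) f])
  then have cT: "closed T" "convex T"
    using face_of_imp_closed face_of_imp_convex S by blast+
  have TS: "T \<subseteq> {x. 0 \<le> x}" using S(3) by (auto simp: T_def)
  define K where "K = T \<inter> {x. 1 \<bullet> x \<le> 1 \<bullet> x0}"
  have bK: "bounded K"
  proof (rule bounded_subset)
    show "K \<subseteq> cbox 0 ((1 \<bullet> x0) *\<^sub>R 1)"
    proof
      fix x assume x: "x \<in> K"
      then have "0 \<le> x $ i" for i using TS by (auto simp: K_def less_eq_vec_def)
      moreover from this have "x $ i \<le> 1 \<bullet> x" for i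
        by (auto simp: inner_vec_def intro: member_le_sum)
      ultimately show "x \<in> cbox 0 ((1 \<bullet> x0) *\<^sub>R 1)"
        using x unfolding K_def by (auto simp: mem_box_cart intro: order_trans)
    qed
  qed simp
  moreover have "closed K" unfolding K_def by (intro closed_Int cT closed_halfspace_le)
  moreover have x0K: "x0 \<in> K" using x0 by (auto simp: K_def T_def)
  ultimately obtain z where z: "z \<in> K" "\<And>y. y \<in> K \<Longrightarrow> 1 \<bullet> z \<le> 1 \<bullet> y"
    using continuous_attains_inf[of K "\<lambda>x. 1 \<bullet> x"]
    by (auto simp: compact_eq_bounded_closed continuous_on_inner)
  define U where "U = {x \<in> T. \<forall>y\<in>T. 1 \<bullet> x \<le> 1 \<bullet> y}"
  have UT: "U face_of T" unfolding U_def
    by (rule face_of_linear_argmin[OF cT(2)]) (simp add: linear_iff inner_simps)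
  have "U \<subseteq> K" using x0K by (auto simp: U_def K_def)
  moreover have "z \<in> U"
    using z x0K unfolding U_def K_def by simp (metis linorder_le_cases order_trans)
  ultimately obtain v where v: "v \<in> U" "v extreme_point_of S"
    using extreme_point_in_bounded_face[OF face_of_trans[OF UT T] S(1,2)] bounded_subset[OF bK]
    by (metis empty_iff)
  with that show thesis by (auto simp: U_def T_def)
qed

section \<open>Dual regions: polyhedrality and extreme rays\<close>

definition dual_region :: "real^'n^'m \<Rightarrow> real^'n \<Rightarrow> (real^'m) set" where
  "dual_region A c = {p. transpose A *v p \<le> c \<and> 0 \<le> p}"

lemma polyhedron_vec_le:
  fixes f :: "'a::euclidean_space \<Rightarrow> real^'k"
  assumes "linear f"
  shows "polyhedron {x. f x \<le> c}"
proof -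
  have "{x. f x \<le> c} = \<Inter>((\<lambda>i. {x. f x $ i \<le> c $ i}) ` UNIV)" by (auto simp: less_eq_vec_def)
  moreover have "linear (\<lambda>x. f x $ i)" for i
    using assms by (simp add: linear_iff)
  ultimately show ?thesis by (auto intro!: polyhedron_linear_le)
qed

lemma polyhedron_vec_ge:
  fixes f :: "'a::euclidean_space \<Rightarrow> real^'k"
  assumes "linear f"
  shows "polyhedron {x. c \<le> f x}"
proof -
  have "{x. c \<le> f x} = {x. - f x \<le> - c}" by (auto simp: less_eq_vec_def)
  moreover have "linear (\<lambda>x. - f x)" using assms by (rule linear_compose_neg)
  ultimately show ?thesis by (metis polyhedron_vec_le)
qed

lemma polyhedron_orthant: "polyhedron {x :: real^'k. 0 \<le> x}"
  using polyhedron_vec_ge[OF linear_id] by simp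

lemma polyhedron_dual_region: "polyhedron (dual_region A c)"
  using polyhedron_Int[OF polyhedron_vec_le[OF matrix_vector_mul_linear] polyhedron_orthant]
  by (simp add: dual_region_def Collect_conj_eq)

lemma polyhedron_primal_region: "polyhedron {x. r \<le> A *v x \<and> 0 \<le> (x :: real^'n)}"
  using polyhedron_Int[OF polyhedron_vec_ge[OF matrix_vector_mul_linear] polyhedron_orthant]
  by (simp add: Collect_conj_eq)

text \<open>A polyhedron has finitely many faces, and a unit vector can be recovered from the ray
  that it spans.\<close>

lemma dual_region_rays_finite:
  "finite {r. norm r = 1 \<and> {t *\<^sub>R r |t. 0 \<le> t} face_of dual_region A 0}"
proof (rule finite_imageD)
  let ?f = "\<lambda>r :: real^'m. {t *\<^sub>R r |t. 0 \<le> t}"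
  let ?R = "{r. norm r = 1 \<and> ?f r face_of dual_region A 0}"
  have "?f ` ?R \<subseteq> {F. F face_of dual_region A 0}" by auto
  then show "finite (?f ` ?R)"
    using finite_subset finite_polyhedron_faces[OF polyhedron_dual_region] by blast
  show "inj_on ?f ?R"
  proof (rule inj_onI)
    fix r q assume rq: "r \<in> ?R" "q \<in> ?R" "?f r = ?f q"
    have "r \<in> ?f r" by (auto intro: exI[of _ 1])
    then obtain t where "0 \<le> t" "r = t *\<^sub>R q" using rq(3) by auto
    with rq show "r = q" by simp
  qed
qed

text \<open>The slice of the cone at \<open>1 \<bullet> v = 1\<close> is compact and contains a
  positive multiple of \<open>p\<close>. An extreme point of the slice that maximises
  \<open>r \<bullet> v\<close> spans an extreme ray.\<close>

lemma extreme_ray_exists: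
  fixes A :: "real^'n^'m"
  assumes p: "p \<in> dual_region A 0" "0 < r \<bullet> p"
  obtains q where "q \<noteq> 0" "{t *\<^sub>R q |t. 0 \<le> t} face_of dual_region A 0" "0 < r \<bullet> q"
proof -
  define K where "K = dual_region A 0"
  have K: "convex K" "closed K"
    using polyhedron_dual_region polyhedron_imp_convex polyhedron_imp_closed by (auto simp: K_def)
  have scale: "t *\<^sub>R v \<in> K" if "0 \<le> t" "v \<in> K" for t v
    using that by (auto simp: K_def dual_region_def less_eq_vec_def matrix_vector_mult_scaleR
        mult_nonneg_nonpos)
  have nonneg: "0 \<le> v $ i" if "v \<in> K" for v i using that by (auto simp: K_def dual_region_def less_eq_vec_def)
  have pos: "0 < 1 \<bullet> v" if "v \<in> K" "v \<noteq> 0" for v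
  proof -
    have "1 \<bullet> v = (\<Sum>i\<in>UNIV. v $ i)" by (simp add: inner_vec_def)
    moreover have "\<dots> \<noteq> 0" using that nonneg by (subst sum_nonneg_eq_0_iff) (auto simp: vec_eq_iff)
    ultimately show ?thesis using nonneg[OF that(1)] by (simp add: sum_nonneg order_less_le)
  qed
  define N where "N = K \<inter> {v. 1 \<bullet> v = 1}"
  have N: "convex N" "closed N" unfolding N_def
    by (intro convex_Int convex_hyperplane closed_Int closed_hyperplane K)+
  have "N \<subseteq> cbox 0 1"
  proof
    fix v assume v: "v \<in> N"
    then have vK: "v \<in> K" and sum: "(\<Sum>j\<in>UNIV. v $ j) = 1" by (auto simp: N_def inner_vec_def)
    have "v $ i \<le> 1" for i
      unfolding sum[symmetric] by (rule member_le_sum) (simp_all add: nonneg[OF vK])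
    then show "v \<in> cbox 0 1" using nonneg[OF vK] by (simp add: mem_box_cart)
  qed
  then have bN: "bounded N" using bounded_cbox bounded_subset by blast
  define p' where "p' = (1 / (1 \<bullet> p)) *\<^sub>R p"
  have "p \<noteq> 0" using p by auto
  then have pp: "0 < 1 \<bullet> p" using pos p(1) by (simp add: K_def)
  have p': "p' \<in> N" "0 < r \<bullet> p'"
    using pp p scale[of "1 / (1 \<bullet> p)" p] by (auto simp: N_def p'_def K_def)
  define T where "T = {x \<in> N. \<forall>y\<in>N. - (r \<bullet> x) \<le> - (r \<bullet> y)}"
  have T: "T face_of N" unfolding T_def
    by (rule face_of_linear_argmin[OF N(1)]) (simp add: linear_iff inner_simps)
  have "\<exists>x\<in>N. \<forall>y\<in>N. - (r \<bullet> x) \<le> - (r \<bullet> y)"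
    using bN N(2) p' by (intro continuous_attains_inf continuous_intros) (auto simp: compact_eq_bounded_closed)
  then have "T \<noteq> {}" by (auto simp: T_def)
  then obtain q where q: "q \<in> T" "q extreme_point_of N"
    using extreme_point_in_bounded_face[OF T N(2,1) bounded_subset[OF bN face_of_imp_subset[OF T]]] by blast
  have qN: "q \<in> K" "1 \<bullet> q = 1" using q(1) by (auto simp: T_def N_def)
  then have q0: "q \<noteq> 0" by auto
  have "{t *\<^sub>R q |t. 0 \<le> t} face_of K"
    unfolding face_of_def
  proof (intro conjI ballI impI)
    show "{t *\<^sub>R q |t. 0 \<le> t} \<subseteq> K" using scale qN by auto
    have "{t *\<^sub>R q |t. 0 \<le> t} = (\<lambda>t. t *\<^sub>R q) ` {0..}" by auto
    then show "convex {t *\<^sub>R q |t. 0 \<le> t}"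
      using convex_linear_image[of "\<lambda>t. t *\<^sub>R q" "{0..}"] by (simp add: linear_iff scaleR_add_left)
    fix a b x assume ab: "a \<in> K" "b \<in> K" and x: "x \<in> {t *\<^sub>R q |t. 0 \<le> t}" "x \<in> open_segment a b"
    obtain t where t: "0 \<le> t" "x = t *\<^sub>R q" using x by auto
    obtain u where u: "0 < u" "u < 1" "x = (1 - u) *\<^sub>R a + u *\<^sub>R b"
      using x(2) by (auto simp: in_segment)
    have tu: "t = (1 - u) * (1 \<bullet> a) + u * (1 \<bullet> b)"
      using arg_cong[OF u(3), of "\<lambda>v. 1 \<bullet> v"] qN by (simp add: t inner_simps)
    have *: "v \<in> {t *\<^sub>R q |t. 0 \<le> t}" if "0 < s" "v \<in> K" "s *\<^sub>R v = t *\<^sub>R q" for s v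
    proof -
      have "v = (1 / s) *\<^sub>R (s *\<^sub>R v)" using that(1) by simp
      also have "\<dots> = (t / s) *\<^sub>R q" by (simp add: that(3))
      finally show ?thesis using that(1) t(1) by (intro CollectI exI[of _ "t / s"]) auto
    qed
    have "a \<in> {t *\<^sub>R q |t. 0 \<le> t} \<and> b \<in> {t *\<^sub>R q |t. 0 \<le> t}"
    proof (cases "a = 0 \<or> b = 0")
      case True
      then show ?thesis
      proof
        assume "a = 0"
        with *[OF u(1) ab(2)] u t show ?thesis by auto
      next
        assume "b = 0"
        with *[of "1 - u" a] ab u t show ?thesis by auto
      qed
    next
      case False
      define a' where "a' = (1 / (1 \<bullet> a)) *\<^sub>R a"
      define b' where "b' = (1 / (1 \<bullet> b)) *\<^sub>R b"
      have pa: "0 < 1 \<bullet> a" "0 < 1 \<bullet> b" using pos ab False by auto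
      then have tp: "0 < t" using tu u by (simp add: add_pos_pos)
      have mem: "a' \<in> N" "b' \<in> N"
        using pa ab scale[of "1 / (1 \<bullet> a)" a] scale[of "1 / (1 \<bullet> b)" b]
        by (auto simp: N_def a'_def b'_def)
      \<comment> \<open>Rescaling both end points into the slice turns the representation of
        \<open>x\<close> into one of \<open>q\<close>; \<open>w\<close> is the resulting weight of
        \<open>b'\<close>.\<close>
      define w where "w = u * (1 \<bullet> b) / t"
      have w: "0 < w" "w < 1" using u pa tp by (auto simp: w_def tu field_simps)
      have w1: "1 - w = (1 - u) * (1 \<bullet> a) / t" using tp by (simp add: w_def tu field_simps)
      have "q = (1 / t) *\<^sub>R ((1 - u) *\<^sub>R a + u *\<^sub>R b)" using u(3) t tp by (metis (no_types, opaque_lifting) divide_self_if less_irrefl scaleR_one scaleR_scaleR times_divide_eq_left mult_1)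
      also have "\<dots> = (1 - w) *\<^sub>R a' + w *\<^sub>R b'"
        unfolding w1 using pa by (simp add: w_def a'_def b'_def scaleR_add_right)
      finally have qw: "q = (1 - w) *\<^sub>R a' + w *\<^sub>R b'" .
      have "q \<notin> open_segment a' b'" using q(2) mem by (auto simp: extreme_point_of_def)
      then have ab': "a' = b'" using w qw unfolding in_segment by blast
      then have "q = a'" using qw by (simp flip: scaleR_add_left)
      have "(1 \<bullet> a) *\<^sub>R a' = a" "(1 \<bullet> b) *\<^sub>R b' = b" using pa by (simp_all add: a'_def b'_def)
      then have "a = (1 \<bullet> a) *\<^sub>R q" "b = (1 \<bullet> b) *\<^sub>R q" using \<open>q = a'\<close> ab' by simp_all
      with pa show ?thesis using less_imp_le by blast
    qed
    then show "a \<in> {t *\<^sub>R q |t. 0 \<le> t}" "b \<in> {t *\<^sub>R q |t. 0 \<le> t}" by simp_all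
  qed
  moreover have "r \<bullet> p' \<le> r \<bullet> q" using q(1) p'(1) by (simp add: T_def)
  ultimately show thesis using that[OF q0] p'(2) by (simp add: K_def)
qed

section \<open>Optimal bases\<close>

lemma simplex_basis_span:
  fixes A :: "real^'n^'m"
  assumes "simplex_basis A W"
  shows "span (std_column A ` W) = UNIV"
proof -
  have "card (std_column A ` W) = CARD('m)" "independent (std_column A ` W)"
    using assms by (simp_all add: simplex_basis_def card_image)
  then have "dim (span (std_column A ` W)) = DIM(real^'m)" by (simp add: dim_eq_card_independent)
  then show ?thesis by (metis dim_eq_full dim_span span_span)
qed

lemma dual_values_iff:
  "dual_values A c W p \<longleftrightarrow> (\<forall>w\<in>W. p \<bullet> std_column A w = case_sum (\<lambda>j. c $ j) (\<lambda>i. 0) w)"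
  unfolding dual_values_def
proof safe
  fix w assume "\<forall>j. Inl j \<in> W \<longrightarrow> column j A \<bullet> p = c $ j" "\<forall>i. Inr i \<in> W \<longrightarrow> p $ i = 0" "w \<in> W"
  then show "p \<bullet> std_column A w = case_sum (\<lambda>j. c $ j) (\<lambda>i. 0) w"
    by (cases w) (auto simp: std_column_def inner_axis inner_commute)
qed (fastforce simp: std_column_def inner_axis inner_commute)+

lemma dual_values_unique:
  assumes "simplex_basis A W" "dual_values A c W p" "dual_values A c W q"
  shows "p = q"
proof -
  have "orthogonal (p - q) v" for v
    by (rule orthogonal_to_span[of v "std_column A ` W"])
      (use assms in \<open>auto simp: simplex_basis_span dual_values_iff orthogonal_def inner_diff_left\<close>)
  from this[of "p - q"] show ?thesis by (simp add: orthogonal_def)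
qed

lemma dual_values_exist:
  assumes "simplex_basis A W"
  obtains p where "dual_values A c W p"
proof -
  have W: "inj_on (std_column A) W" "independent (std_column A ` W)"
    using assms by (simp_all add: simplex_basis_def)
  obtain g where g: "linear g" "\<And>v. v \<in> std_column A ` W \<Longrightarrow>
      g v = case_sum (\<lambda>j. c $ j) (\<lambda>i. 0) (the_inv_into W (std_column A) v)"
    using linear_independent_extend[OF W(2),
        of "\<lambda>v. case_sum (\<lambda>j. c $ j) (\<lambda>i. 0) (the_inv_into W (std_column A) v)"] by auto
  have "dual_values A c W (adjoint g 1)"
    unfolding dual_values_iff using g W(1)
    by (simp add: the_inv_into_f_f flip: linear_functional_inner)
  then show thesis by (rule that)
qed

lemma dual_values_combine:
  assumes "dual_values A c1 W p1" "dual_values A c2 W p2"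
  shows "dual_values A (s *\<^sub>R c1 + t *\<^sub>R c2) W (s *\<^sub>R p1 + t *\<^sub>R p2)"
  using assms by (auto simp: dual_values_def inner_simps)

text \<open>All constraints belonging to \<open>W\<close> are tight at \<open>p\<close>. If
  \<open>p\<close> lies strictly between two points of the region, they are tight at these points as
  well, and dual values are unique.\<close>

lemma dual_values_extreme:
  assumes W: "simplex_basis A W" and p: "dual_values A c W p" "p \<in> dual_region A c"
  shows "p extreme_point_of dual_region A c"
  unfolding extreme_point_of_def
proof (intro conjI ballI)
  fix q q' assume q: "q \<in> dual_region A c" "q' \<in> dual_region A c"
  show "p \<notin> open_segment q q'"
  proof
    assume "p \<in> open_segment q q'"
    then obtain u where u: "0 < u" "u < 1" "p = (1 - u) *\<^sub>R q + u *\<^sub>R q'" and ne: "q \<noteq> q'"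
      by (auto simp: in_segment)
    have *: "s = b \<and> t = b" if "(1 - u) * s + u * t = b" "s \<le> b" "t \<le> b" for s t b :: real
    proof -
      have "(1 - u) * (b - s) + u * (b - t) = 0" using that(1) by (simp add: algebra_simps)
      moreover have "0 \<le> (1 - u) * (b - s)" "0 \<le> u * (b - t)" using u that by auto
      ultimately have "(1 - u) * (b - s) = 0" "u * (b - t) = 0" by linarith+
      then show ?thesis using u by auto
    qed
    have v: "v \<bullet> std_column A w \<le> case_sum (\<lambda>j. c $ j) (\<lambda>i. 0) w" if "v \<in> dual_region A c" for v w
      using that by (cases w) (auto simp: inner_std_column dual_region_def less_eq_vec_def)
    have "q \<bullet> std_column A w = case_sum (\<lambda>j. c $ j) (\<lambda>i. 0) w \<and>
        q' \<bullet> std_column A w = case_sum (\<lambda>j. c $ j) (\<lambda>i. 0) w" if "w \<in> W" for w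
      using p(1) that by (intro *[OF _ v[OF q(1)] v[OF q(2)]]) (simp add: dual_values_iff u(3) inner_simps)
    then have "dual_values A c W q" "dual_values A c W q'" by (simp_all add: dual_values_iff)
    with dual_values_unique[OF W] ne show False by blast
  qed
qed (rule p)

text \<open>Complementary slackness holds by construction: every variable or slack is either
  nonbasic, hence zero, or its dual constraint is tight.\<close>

lemma basis_duality:
  fixes A :: "real^'n^'m"
  assumes "basic_solution A r W x" "dual_values A c W p"
  shows "r \<bullet> p = c \<bullet> x"
proof -
  have "x $ j * (transpose A *v p) $ j = x $ j * c $ j" for j
    using assms by (cases "Inl j \<in> W") (auto simp: basic_solution_def dual_values_def
        matrix_vector_mult_def transpose_def column_def inner_vec_def)
  then have "x \<bullet> (transpose A *v p) = c \<bullet> x"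
    by (subst inner_commute[of c]) (simp only: inner_vec_def inner_real_def)
  moreover have "(A *v x) $ i * p $ i = r $ i * p $ i" for i
    using assms by (cases "Inr i \<in> W") (auto simp: basic_solution_def dual_values_def)
  then have "(A *v x) \<bullet> p = r \<bullet> p" by (simp only: inner_vec_def inner_real_def)
  ultimately show ?thesis by (metis inner_commute inner_transpose)
qed

text \<open>The two halves of \<open>optimal_basis\<close>: this one sees only the right-hand side,
  \<open>dual_feasible_basis\<close> only the cost.\<close>

definition primal_feasible_basis :: "real^'n^'m \<Rightarrow> real^'m \<Rightarrow> ('n::finite + 'm::finite) set \<Rightarrow> bool" where
  "primal_feasible_basis A r W \<longleftrightarrow> (\<exists>x. basic_solution A r W x \<and> 0 \<le> x \<and> r \<le> A *v x)"

definition dual_feasible_basis :: "real^'n^'m \<Rightarrow> real^'n \<Rightarrow> ('n::finite + 'm::finite) set \<Rightarrow> bool" where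
  "dual_feasible_basis A c W \<longleftrightarrow> simplex_basis A W \<and> (\<exists>p\<in>dual_region A c. dual_values A c W p)"

lemma optimal_basis_iff:
  "optimal_basis A r c W \<longleftrightarrow> primal_feasible_basis A r W \<and> dual_feasible_basis A c W"
  by (auto simp: optimal_basis_def primal_feasible_basis_def dual_feasible_basis_def dual_region_def)

text \<open>The set is the cone generated by the columns of \<open>W\<close>, with the basic
  variables and slacks as coefficients.\<close>

lemma closed_primal_feasible_basis:
  fixes A :: "real^'n^'m"
  shows "closed {r. primal_feasible_basis A r W}"
proof -
  have "{r. primal_feasible_basis A r W}
      = {\<Sum>w\<in>W. u w *\<^sub>R std_column A w |u. \<forall>w\<in>W. 0 \<le> u w}"
  proof (intro set_eqI iffI; clarsimp simp: primal_feasible_basis_def)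
    fix r x assume x: "basic_solution A r W x" "0 \<le> x" "r \<le> A *v x"
    define u where "u = case_sum (\<lambda>j. x $ j) (\<lambda>i. (A *v x) $ i - r $ i)"
    have "r = (\<Sum>w\<in>UNIV. u w *\<^sub>R std_column A w)"
      unfolding sum_std_column by (simp add: u_def vec_eq_iff)
    also have "\<dots> = (\<Sum>w\<in>W. u w *\<^sub>R std_column A w)"
      by (rule sum.mono_neutral_right)
        (use x(1) in \<open>auto simp: u_def basic_solution_def split: sum.splits\<close>)
    finally show "\<exists>u. r = (\<Sum>w\<in>W. u w *\<^sub>R std_column A w) \<and> (\<forall>w\<in>W. 0 \<le> u w)"
      using x(2,3) by (intro exI[of _ u]) (auto simp: u_def less_eq_vec_def split: sum.splits)
  next
    fix v :: "_ \<Rightarrow> real" assume v: "\<forall>w\<in>W. 0 \<le> v w"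
    define u where "u w = (if w \<in> W then v w else 0 :: real)" for w
    define x where "x = (\<chi> j. u (Inl j))"
    have "(\<Sum>w\<in>W. v w *\<^sub>R std_column A w) = (\<Sum>w\<in>UNIV. u w *\<^sub>R std_column A w)"
      by (rule sum.mono_neutral_cong_left) (auto simp: u_def)
    then have r: "(\<Sum>w\<in>W. v w *\<^sub>R std_column A w) = A *v x - (\<chi> i. u (Inr i))"
      by (simp add: sum_std_column x_def)
    show "\<exists>x. basic_solution A (\<Sum>w\<in>W. v w *\<^sub>R std_column A w) W x \<and> 0 \<le> x \<and>
        (\<Sum>w\<in>W. v w *\<^sub>R std_column A w) \<le> A *v x"
      unfolding r using v
      by (intro exI[of _ x]) (auto simp: basic_solution_def less_eq_vec_def x_def u_def)
  qed
  then show ?thesis using closed_nonneg_combinations[of W] by simp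
qed

text \<open>\<open>u\<close> lists the variables and slacks of \<open>x\<close>, and
  \<open>v\<close> is a dependence among the columns in its support. Moving \<open>x\<close> a
  little along \<open>v\<close> in either direction stays feasible, so a nonzero \<open>v\<close>
  would put \<open>x\<close> inside a segment.\<close>

lemma extreme_support_independent:
  fixes A :: "real^'n^'m"
  assumes x: "x extreme_point_of {x. r \<le> A *v x \<and> 0 \<le> x}"
  defines "u \<equiv> case_sum (\<lambda>j. x $ j) (\<lambda>i. (A *v x) $ i - r $ i)"
  assumes v: "\<And>w. u w = 0 \<Longrightarrow> v w = 0" "(\<Sum>w\<in>UNIV. v w *\<^sub>R std_column A w) = 0"
  shows "v w = 0"
proof -
  define y where "y = (\<chi> j. v (Inl j))"
  have Ay: "A *v y = (\<chi> i. v (Inr i))" using v(2) by (simp add: sum_std_column y_def)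
  have xf: "r \<le> A *v x" "0 \<le> x" using x by (auto simp: extreme_point_of_def)
  then have u0: "0 \<le> u w" for w by (auto simp: u_def less_eq_vec_def split: sum.splits)
  \<comment> \<open>Small enough that \<open>t * \<bar>v w\<bar> \<le> u w\<close> throughout. The
    summand 1 avoids a zero denominator, and the inserted 1 covers an empty support.\<close>
  define t where "t = Min (insert 1 ((\<lambda>w. u w / (1 + \<bar>v w\<bar>)) ` {w. u w \<noteq> 0}))"
  have "0 < t" unfolding t_def using u0 by (subst Min_gr_iff) (auto simp: order_less_le intro!: divide_pos_pos add_pos_nonneg)
  have tv: "t * \<bar>v w\<bar> \<le> u w" for w
  proof (cases "u w = 0")
    case False
    then have "t \<le> u w / (1 + \<bar>v w\<bar>)" unfolding t_def by (intro Min_le) auto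
    then have "t * (1 + \<bar>v w\<bar>) \<le> u w" by (simp add: pos_le_divide_eq)
    with \<open>0 < t\<close> show ?thesis by (simp add: algebra_simps)
  qed (simp add: v(1))
  have mem: "x + s *\<^sub>R y \<in> {x. r \<le> A *v x \<and> 0 \<le> x}" if "\<bar>s\<bar> = t" for s
  proof -
    have *: "- (s * v w) \<le> u w" for w
      using tv[of w] abs_ge_minus_self[of "s * v w"] that by (simp add: abs_mult)
    have "0 \<le> x $ j + s * v (Inl j)" for j using *[of "Inl j"] by (simp add: u_def)
    moreover have "r $ i \<le> (A *v x) $ i + s * v (Inr i)" for i using *[of "Inr i"] by (simp add: u_def)
    ultimately show ?thesis
      by (simp add: less_eq_vec_def matrix_vector_right_distrib matrix_vector_mult_scaleR Ay)
        (simp add: y_def)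
  qed
  have "y = 0"
  proof (rule ccontr)
    assume "y \<noteq> 0"
    then have ne: "x + t *\<^sub>R y \<noteq> x + (- t) *\<^sub>R y" using \<open>0 < t\<close> by (auto simp: eq_neg_iff_add_eq_0 simp flip: scaleR_add_left)
    have "x = midpoint (x + t *\<^sub>R y) (x + (- t) *\<^sub>R y)"
      by (simp add: midpoint_def flip: scaleR_2)
    then have "x \<in> open_segment (x + t *\<^sub>R y) (x + (- t) *\<^sub>R y)"
      using ne midpoint_in_open_segment by metis
    with x mem[of t] mem[of "- t"] \<open>0 < t\<close> show False by (auto simp: extreme_point_of_def)
  qed
  moreover from this Ay have "v (Inr i) = 0" for i
    by (metis matrix_vector_mult_0_right vec_lambda_beta zero_index)
  ultimately show ?thesis by (cases w) (auto simp: vec_eq_iff y_def)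
qed

text \<open>Independence is assumed of the family, so that two equal columns count as dependent;
  this yields injectivity on \<open>W\<close>.\<close>

lemma independent_image_if_family_independent:
  fixes g :: "'i::finite \<Rightarrow> 'a::real_vector"
  assumes "\<And>v i. \<forall>i. i \<notin> W \<longrightarrow> v i = 0 \<Longrightarrow> (\<Sum>i\<in>UNIV. v i *\<^sub>R g i) = 0 \<Longrightarrow> v i = 0"
  shows "inj_on g W" "independent (g ` W)"
proof -
  show inj: "inj_on g W"
  proof (rule inj_onI, rule ccontr)
    fix i j assume ij: "i \<in> W" "j \<in> W" "g i = g j" "i \<noteq> j"
    define v where "v k = (if k = i then 1 else if k = j then -1 else 0 :: real)" for k
    have "(\<Sum>k\<in>UNIV. v k *\<^sub>R g k) = (\<Sum>k\<in>{i, j}. v k *\<^sub>R g k)"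
      by (rule sum.mono_neutral_right) (auto simp: v_def)
    also have "\<dots> = 0" using ij by (simp add: v_def)
    finally have "v i = 0" using ij by (intro assms) (auto simp: v_def)
    then show False by (simp add: v_def)
  qed
  show "independent (g ` W)"
  proof
    assume "dependent (g ` W)"
    then obtain c where c: "\<exists>i\<in>W. c (g i) \<noteq> 0" "(\<Sum>a\<in>g ` W. c a *\<^sub>R a) = 0"
      by (auto simp: dependent_finite)
    define v where "v i = (if i \<in> W then c (g i) else 0)" for i
    have "(\<Sum>i\<in>UNIV. v i *\<^sub>R g i) = (\<Sum>i\<in>W. c (g i) *\<^sub>R g i)"
      by (rule sum.mono_neutral_cong_right) (auto simp: v_def)
    also have "\<dots> = 0" using c(2) by (simp add: sum.reindex[OF inj])
    finally have "\<forall>i. v i = 0" by (intro allI assms) (auto simp: v_def)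
    with c(1) show False by (auto simp: v_def split: if_splits)
  qed
qed

text \<open>An optimal extreme point of a problem whose right-hand side lies in no proper subspace
  spanned by columns is nondegenerate, so its support is a basis.  Since primal feasibility of a
  basis is a closed condition on the right-hand side, an arbitrary right-hand side is reached by
  generic ones from below.\<close>

lemma optimal_basis_exists:
  fixes A :: "real^'n^'m"
  assumes x0: "0 \<le> x0" "r \<le> A *v x0" and p0: "p0 \<in> dual_region A c"
  obtains W where "optimal_basis A r c W"
proof -
  define G where "G = (\<Union>W\<in>{W. dual_feasible_basis A c W}. {r. primal_feasible_basis A r W})"
  have "closed G" unfolding G_def
    by (intro closed_UN) (simp_all add: closed_primal_feasible_basis)
  have "r \<in> G"
  proof (rule ccontr)
    assume "r \<notin> G"
    then obtain e where e: "0 < e" "ball r e \<subseteq> - G"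
      using \<open>closed G\<close> openE[of "- G" r] by (auto simp: open_closed)
    \<comment> \<open>Right-hand sides in \<open>U\<close> avoid \<open>G\<close> and lie below
      \<open>r\<close>, so \<open>x0\<close> stays feasible for them.\<close>
    define U where "U = ball r e \<inter> (\<Inter>i. {s. s $ i < r $ i})"
    have "open U" unfolding U_def
      by (intro open_Int open_INT open_ball ballI open_halfspace_component_lt_cart finite_class.finite_UNIV)
    have n1: "0 < norm (1 :: real^'m)" by simp
    have "r - (e / (2 * norm (1 :: real^'m))) *\<^sub>R 1 \<in> U"
      using e n1 by (auto simp: U_def dist_norm)
    then have "\<not> negligible U" using open_not_negligible[OF \<open>open U\<close>] by blast
    \<comment> \<open>A finite union of proper subspaces is null, so the open set \<open>U\<close>
      contains a point \<open>r'\<close> outside it. The columns used in any representation of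
      \<open>r'\<close> then span the whole space.\<close>
    define N where "N = \<Union>((\<lambda>V. span (std_column A ` V)) ` {V. span (std_column A ` V) \<noteq> UNIV})"
    have "negligible N" unfolding N_def
    proof (rule negligible_Union)
      fix T assume "T \<in> (\<lambda>V. span (std_column A ` V)) ` {V. span (std_column A ` V) \<noteq> UNIV}"
      then obtain V where T: "T = span (std_column A ` V)" "T \<noteq> UNIV" by blast
      have "dim T \<noteq> DIM(real^'m)" using T by (metis dim_eq_full span_span)
      then have "dim T < DIM(real^'m)" using dim_subset_UNIV[of T] by linarith
      then show "negligible T" by (rule negligible_lowdim)
    qed simp
    then obtain r' where r': "r' \<in> U" "r' \<notin> N"
      using \<open>\<not> negligible U\<close> negligible_subset by blast
    have le: "r' \<le> r" using r'(1) by (auto simp: U_def less_eq_vec_def intro: less_imp_le)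
    define S where "S = {x :: real^'n. r' \<le> A *v x \<and> 0 \<le> x}"
    have S: "closed S" "convex S" "S \<subseteq> {x. 0 \<le> x}"
      using polyhedron_primal_region[of r' A] polyhedron_imp_closed polyhedron_imp_convex
      by (auto simp: S_def)
    obtain x1 where x1: "x1 \<in> S" "\<And>x. x \<in> S \<Longrightarrow> c \<bullet> x1 \<le> c \<bullet> x"
      using primal_optimum_exists[OF x0(1) order_trans[OF le x0(2)], of p0 c] p0
      by (auto simp: S_def dual_region_def)
    obtain x where xe: "x extreme_point_of S" and xo: "\<And>y. y \<in> S \<Longrightarrow> c \<bullet> x \<le> c \<bullet> y"
      using extreme_minimiser_in_orthant[OF S _ x1(1), of "\<lambda>x. c \<bullet> x"] x1(2)
      by (auto simp: linear_iff inner_simps)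
    have xS: "r' \<le> A *v x" "0 \<le> x" using xe by (auto simp: extreme_point_of_def S_def)
    define u where "u = case_sum (\<lambda>j. x $ j) (\<lambda>i. (A *v x) $ i - r' $ i)"
    define W where "W = {w. u w \<noteq> 0}"
    have indep: "inj_on (std_column A) W" "independent (std_column A ` W)"
      using extreme_support_independent[OF xe[unfolded S_def]]
      by (auto intro!: independent_image_if_family_independent simp: W_def u_def)
    have "r' = (\<Sum>w\<in>UNIV. u w *\<^sub>R std_column A w)"
      unfolding sum_std_column by (simp add: u_def vec_eq_iff)
    also have "\<dots> = (\<Sum>w\<in>W. u w *\<^sub>R std_column A w)"
      by (rule sum.mono_neutral_right) (auto simp: W_def)
    also have "\<dots> \<in> span (std_column A ` W)"
      by (intro span_sum span_scale span_base imageI)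
    finally have full: "span (std_column A ` W) = UNIV" using r'(2) by (auto simp: N_def)
    then have "card (std_column A ` W) = CARD('m)"
      using dim_eq_card_independent[OF indep(2)] by (metis DIM_cart DIM_real dim_span dim_UNIV mult.right_neutral)
    then have W: "simplex_basis A W" using indep by (simp add: simplex_basis_def card_image)
    obtain p where p: "p \<in> dual_region A c" "r' \<bullet> p = c \<bullet> x"
      using strong_duality[OF xS(2,1), of c] xo by (auto simp: dual_region_def S_def)
    have p': "transpose A *v p \<le> c" "0 \<le> p" using p(1) by (auto simp: dual_region_def)
    \<comment> \<open>The two ends of this chain of inequalities agree, so all of them are
      equalities; this is complementary slackness.\<close>
    have "r' \<bullet> p \<le> p \<bullet> (A *v x)" using vec_inner_mono[OF p'(2) xS(1)] by (simp add: inner_commute)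
    moreover have "p \<bullet> (A *v x) = x \<bullet> (transpose A *v p)" by (metis inner_commute inner_transpose)
    moreover have "x \<bullet> (transpose A *v p) \<le> x \<bullet> c" by (rule vec_inner_mono[OF xS(2) p'(1)])
    ultimately have "p \<bullet> (A *v x - r') = 0" "x \<bullet> (c - transpose A *v p) = 0"
      using p(2) by (simp_all add: inner_diff_right inner_commute[of c] inner_commute[of r'])
    then have slack: "p $ i * ((A *v x) $ i - r' $ i) = 0" "x $ j * (c $ j - (transpose A *v p) $ j) = 0" for i j
      using xS p'
      by (simp_all add: inner_vec_def sum_nonneg_eq_0_iff less_eq_vec_def)
    have "dual_values A c W p"
      using slack unfolding dual_values_iff
      by (auto simp: W_def u_def inner_std_column split: sum.splits) (metis (no_types))
    then have "dual_feasible_basis A c W" using W p by (auto simp: dual_feasible_basis_def)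
    moreover have "primal_feasible_basis A r' W"
      using xS by (auto simp: primal_feasible_basis_def basic_solution_def W_def u_def intro!: exI[of _ x])
    ultimately have "r' \<in> G" by (auto simp: G_def)
    with r'(1) e show False by (auto simp: U_def)
  qed
  then show thesis using that by (auto simp: G_def optimal_basis_iff)
qed

section \<open>Exploring a subproblem\<close>

text \<open>The finitely many sets that miss \<open>x\<close> also miss a neighbourhood of
  \<open>x\<close>, so points slightly to its left are covered by a set that contains
  \<open>x\<close>.\<close>

lemma finite_closed_cover_left:
  fixes D :: "'i \<Rightarrow> real set"
  assumes "finite I" "\<And>i. i \<in> I \<Longrightarrow> closed (D i)" "{c<..<x} \<subseteq> (\<Union>i\<in>I. D i)" "c < x"
  obtains i b where "i \<in> I" "x \<in> D i" "b \<in> D i" "c < b" "b < x"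
proof -
  define G where "G = (\<Union>i\<in>{i \<in> I. x \<notin> D i}. D i)"
  have "closed G" unfolding G_def using assms(1,2) by (intro closed_UN ballI) auto
  moreover have "x \<notin> G" by (auto simp: G_def)
  ultimately obtain e where e: "0 < e" "ball x e \<subseteq> - G"
    using openE[of "- G" x] by (auto simp: open_closed)
  define b where "b = max ((c + x) / 2) (x - e / 2)"
  have "c < (c + x) / 2" using assms(4) by simp
  then have b: "c < b" "b < x" "b \<in> ball x e"
    using e(1) assms(4) by (auto simp: b_def dist_real_def less_max_iff_disj)
  then have "b \<in> (\<Union>i\<in>I. D i)" "b \<notin> G" using assms(3) e(2) by auto
  then show thesis using that b unfolding G_def by blast
qed

text \<open>Greedy descent: a set containing \<open>a0\<close> and a point to its left is followed
  down to its infimum, where the argument continues. The induction counts the sets whose infimum is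
  below the current point; the set just used drops out.\<close>

lemma interval_cover_chain:
  fixes D :: "'w::finite \<Rightarrow> real set"
  assumes D: "\<And>w. closed (D w)" "\<And>w. convex (D w)" "\<And>w. D w \<subseteq> {0..1}"
    and cover: "{0..1} \<subseteq> (\<Union>w. D w)"
    and a0: "0 < a0" "a0 \<le> 1"
  shows "\<exists>k a W. 1 \<le> k \<and> a 1 = a0 \<and> a (k + 1) = 0 \<and> (\<forall>i\<in>{1..k :: nat}.
    a (i + 1) < a i \<and> {a (i + 1)..a i} \<subseteq> D (W i) \<and> (\<forall>l\<in>D (W i). a (i + 1) \<le> l))"
  using a0
proof (induction "card {w. Inf (D w) < a0}" arbitrary: a0 rule: less_induct)
  case less
  have "{0<..<a0} \<subseteq> (\<Union>w\<in>UNIV. D w)" using cover less.prems by auto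
  from finite_closed_cover_left[OF finite_class.finite_UNIV D(1) this less.prems(1)]
  obtain w b where w: "a0 \<in> D w" "b \<in> D w" and b: "b < a0" by blast
  define a' where "a' = Inf (D w)"
  have bdd: "bdd_below (D w)" using bdd_below_mono[OF bdd_below_Icc D(3)] .
  have lower: "a' \<le> l" if "l \<in> D w" for l unfolding a'_def using cInf_lower[OF that bdd] .
  have a'D: "a' \<in> D w" unfolding a'_def using closed_contains_Inf[OF _ bdd D(1)] w by blast
  then have a'0: "0 \<le> a'" using D(3) by fastforce
  have a'a0: "a' < a0" using lower[OF w(2)] b by simp
  have sub: "{a'..a0} \<subseteq> D w"
    using closed_segment_subset[OF a'D w(1) D(2)] a'a0 by (simp add: closed_segment_eq_real_ivl)
  show ?case
  proof (cases "a' = 0")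
    case True
    then show ?thesis using a'a0 sub lower
      by (intro exI[of _ 1] exI[of _ "\<lambda>i. if i = 1 then a0 else 0"] exI[of _ "\<lambda>_. w"]) simp
  next
    case False
    have "{v. Inf (D v) < a'} \<subset> {v. Inf (D v) < a0}" using a'a0 by (auto simp: a'_def)
    then have "card {v. Inf (D v) < a'} < card {v. Inf (D v) < a0}" by (simp add: psubset_card_mono)
    from less.hyps[OF this] a'0 a'a0 False less.prems obtain k a W where IH: "1 \<le> k" "a 1 = a'"
      "a (k + 1) = 0" "\<forall>i\<in>{1..k :: nat}. a (i + 1) < a i \<and> {a (i + 1)..a i} \<subseteq> D (W i) \<and>
        (\<forall>l\<in>D (W i). a (i + 1) \<le> l)" by fastforce
    define a2 where "a2 i = (if i = 1 then a0 else a (i - 1))" for i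
    define W2 where "W2 i = (if i = 1 then w else W (i - 1))" for i
    have "a2 (i + 1) < a2 i \<and> {a2 (i + 1)..a2 i} \<subseteq> D (W2 i) \<and> (\<forall>l\<in>D (W2 i). a2 (i + 1) \<le> l)"
      if "i \<in> {1..k + 1}" for i
    proof (cases "i = 1")
      case True
      then show ?thesis using a'a0 sub lower IH(2) by (simp add: a2_def W2_def)
    next
      case False
      define j where "j = i - 1"
      have "i = j + 1" "j \<in> {1..k}" using that False by (auto simp: j_def)
      then show ?thesis using IH(4) by (auto simp: a2_def W2_def)
    qed
    then show ?thesis using IH(1,3)
      by (intro exI[of _ "k + 1"] exI[of _ a2] exI[of _ W2]) (simp add: a2_def)
  qed
qed

section \<open>Weighted sums, and the weights at which a basis is optimal\<close>

lemma weighted_segment: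
  "weighted l ((1 - u) *\<^sub>R z + u *\<^sub>R w) = (1 - u) * weighted l z + u * weighted l w"
  by (simp add: weighted_def algebra_simps)

lemma weighted_optimal_efficient:
  assumes "weighted_optimal S F l v" "0 < l" "l < 1"
  shows "v \<in> efficient S F"
proof -
  have "\<not> dominates (F w) (F v)" if "w \<in> S" for w
  proof
    assume d: "dominates (F w) (F v)"
    have "weighted l (F w) < weighted l (F v)"
    proof (cases "fst (F w) < fst (F v)")
      case True
      then show ?thesis using d assms unfolding weighted_def dominates_def
        by (intro add_less_le_mono mult_strict_left_mono mult_left_mono) auto
    next
      case False
      then have "snd (F w) < snd (F v)" using d by (auto simp: dominates_def prod_eq_iff)
      then show ?thesis using d assms unfolding weighted_def dominates_def
        by (intro add_le_less_mono mult_strict_left_mono mult_left_mono) auto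
    qed
    then show False using assms(1) that by (auto simp: weighted_optimal_def not_less[symmetric])
  qed
  then show ?thesis using assms(1) by (auto simp: efficient_def weighted_optimal_def)
qed

text \<open>If \<open>F v\<close> lies inside a segment of the image, each weighted sum minimised at
  \<open>v\<close> is constant on the segment. Two different weights are independent functionals, so
  the segment is a single point.\<close>

lemma weighted_optimal_two_extreme:
  assumes "weighted_optimal S F l v" "weighted_optimal S F l' v" "l \<noteq> l'"
  shows "F v extreme_point_of F ` S"
  unfolding extreme_point_of_def
proof (intro conjI ballI notI)
  show "F v \<in> F ` S" using assms by (auto simp: weighted_optimal_def)
  fix z w assume zw: "z \<in> F ` S" "w \<in> F ` S" "F v \<in> open_segment z w"
  then obtain u where u: "0 < u" "u < 1" "F v = (1 - u) *\<^sub>R z + u *\<^sub>R w" "z \<noteq> w"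
    by (auto simp: in_segment)
  have eq: "weighted m z = weighted m w" if "weighted_optimal S F m v" for m
  proof -
    have "weighted m (F v) = (1 - u) * weighted m z + u * weighted m w"
      by (simp add: u(3) weighted_segment)
    then have s: "(1 - u) * (weighted m z - weighted m (F v)) + u * (weighted m w - weighted m (F v)) = 0"
      by (simp add: algebra_simps)
    have n: "0 \<le> (1 - u) * (weighted m z - weighted m (F v))" "0 \<le> u * (weighted m w - weighted m (F v))"
      using u zw that by (auto simp: weighted_optimal_def)
    have "(1 - u) * (weighted m z - weighted m (F v)) = 0" "u * (weighted m w - weighted m (F v)) = 0"
      using s n by linarith+
    then show ?thesis using u by auto
  qed
  have d: "m * (fst z - fst w) + (1 - m) * (snd z - snd w) = 0" if "weighted_optimal S F m v" for m
    using eq[OF that] by (simp add: weighted_def algebra_simps)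
  have "(l - l') * ((fst z - fst w) - (snd z - snd w)) = 0"
    using d[OF assms(1)] d[OF assms(2)] by (simp add: algebra_simps)
  then have e: "fst z - fst w = snd z - snd w" using assms(3) by simp
  moreover have "snd z - snd w = 0" using d[OF assms(1)] unfolding e by (simp add: algebra_simps)
  ultimately show False using u(4) by (simp add: prod_eq_iff)
qed

lemma weighted_sub_objective: "weighted l (sub_objective P x) = cost P l \<bullet> x"
  by (simp add: weighted_def sub_objective_def cost_def inner_simps)

lemma dual_points_eq: "dual_points P l = {p. p extreme_point_of dual_region (Amat P) (cost P l)}"
  by (simp add: dual_points_def dual_region_def)

lemma dual_rays_eq:
  "dual_rays P = {r. r \<noteq> 0 \<and> {t *\<^sub>R r |t. 0 \<le> t} face_of dual_region (Amat P) 0}"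
  by (simp add: dual_rays_def dual_region_def)

lemma dual_rays_subset: "r \<in> dual_rays P \<Longrightarrow> r \<in> dual_region (Amat P) 0"
proof -
  assume r: "r \<in> dual_rays P"
  have "r \<in> {t *\<^sub>R r |t. 0 \<le> t}" by (auto intro: exI[of _ 1])
  with r show ?thesis unfolding dual_rays_eq by (blast dest: face_of_imp_subset)
qed

lemma dual_points_subset: "p \<in> dual_points P l \<Longrightarrow> p \<in> dual_region (Amat P) (cost P l)"
  by (simp add: dual_points_eq extreme_point_of_def)

lemma finite_dual_points: "finite (dual_points P l)"
  unfolding dual_points_eq by (rule finite_polyhedron_extreme_points[OF polyhedron_dual_region])

text \<open>With zero costs and bounds the multipliers in Farkas' lemma are the elements of the dual
  cone; one that violates the condition is then replaced by an extreme ray.\<close>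

lemma sub_infeasible_ray:
  assumes "sub_feasible P y = {}"
  obtains r where "r \<in> dual_rays P" "0 < sub_rhs P y \<bullet> r"
proof -
  have "\<exists>p\<in>dual_region (Amat P) 0. 0 < sub_rhs P y \<bullet> p"
  proof (rule ccontr)
    assume "\<not> ?thesis"
    then have "\<exists>x\<ge>0. sub_rhs P y \<le> Amat P *v x \<and> 0 \<bullet> x \<le> 0 \<and> 0 \<bullet> x \<le> 0"
      by (intro biobjective_farkas) (auto simp: dual_region_def not_less)
    with assms show False by (auto simp: sub_feasible_def)
  qed
  then obtain p where "p \<in> dual_region (Amat P) 0" "0 < sub_rhs P y \<bullet> p" by blast
  then obtain r where "r \<noteq> 0" "{t *\<^sub>R r |t. 0 \<le> t} face_of dual_region (Amat P) 0"
    "0 < sub_rhs P y \<bullet> r" by (rule extreme_ray_exists)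
  then show thesis by (intro that[of r]) (simp_all add: dual_rays_eq)
qed

lemma cost_eq: "cost P l = cvec2 P + l *\<^sub>R (cvec1 P - cvec2 P)"
  by (simp add: cost_def algebra_simps)

lemma dual_feasible_basis_weights:
  assumes "simplex_basis (Amat P) W"
    "dual_values (Amat P) (cvec1 P) W p1" "dual_values (Amat P) (cvec2 P) W p2"
  shows "dual_feasible_basis (Amat P) (cost P l) W \<longleftrightarrow>
    l *\<^sub>R p1 + (1 - l) *\<^sub>R p2 \<in> dual_region (Amat P) (cost P l)"
  using dual_values_combine[OF assms(2,3), of l "1 - l"] dual_values_unique[OF assms(1)] assms(1)
  by (auto simp: dual_feasible_basis_def cost_def)

text \<open>By uniqueness the dual values at weight \<open>l\<close> are affine in \<open>l\<close>,
  so dual feasibility is a finite system of linear inequalities in one number.\<close>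

lemma dual_feasible_weights_polyhedron: "polyhedron {l. dual_feasible_basis (Amat P) (cost P l) W}"
proof (cases "simplex_basis (Amat P) W")
  case True
  obtain p1 p2 where p: "dual_values (Amat P) (cvec1 P) W p1" "dual_values (Amat P) (cvec2 P) W p2"
    using dual_values_exist[OF True] by metis
  let ?T = "\<lambda>p. transpose (Amat P) *v p"
  have "{l. dual_feasible_basis (Amat P) (cost P l) W}
      = {l. l *\<^sub>R (?T p1 - ?T p2 - (cvec1 P - cvec2 P)) \<le> cvec2 P - ?T p2} \<inter>
        {l. - p2 \<le> l *\<^sub>R (p1 - p2)}"
    unfolding dual_feasible_basis_weights[OF True p]
    by (auto simp: dual_region_def cost_eq less_eq_vec_def matrix_vector_right_distrib
        matrix_vector_mult_scaleR algebra_simps)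
  then show ?thesis
    by (auto intro!: polyhedron_Int polyhedron_vec_le polyhedron_vec_ge simp: linear_iff scaleR_add_left)
qed (simp add: dual_feasible_basis_def)

text \<open>Left end points of the dual feasibility intervals of all bases, which serve every
  \<open>y\<close> at once. For an empty interval \<open>Inf\<close> contributes some unspecified
  number, which does not affect finiteness.\<close>

definition critical_weights ::
    "('n::finite, 'p::finite, 'm::finite, 'q::finite) blp \<Rightarrow> real set" where
  "critical_weights P = {0, 1} \<union>
     range (\<lambda>W. Inf {l \<in> {0..1}. dual_feasible_basis (Amat P) (cost P l) W})"

lemma finite_critical_weights: "finite (critical_weights P)"
  by (simp add: critical_weights_def)

text \<open>For fixed \<open>y\<close> each basis is optimal on a closed, possibly empty interval of
  weights. Every weight has an optimal basis, so these intervals cover the unit interval, and a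
  descending chain of them has the properties required of the parametric simplex output.\<close>

lemma explore_cuts_exist:
  assumes dual: "\<And>l. l \<in> {0..1} \<Longrightarrow> dual_region (Amat P) (cost P l) \<noteq> {}"
    and x0: "x0 \<in> sub_feasible P y"
  shows "\<exists>k a p1 p2. explore_cuts P y k a p1 p2"
proof -
  define D where "D W = {l \<in> {0..1}. optimal_basis (Amat P) (sub_rhs P y) (cost P l) W}" for W
  have DW: "D W = {0..1} \<inter> (if primal_feasible_basis (Amat P) (sub_rhs P y) W
      then {l. dual_feasible_basis (Amat P) (cost P l) W} else {})" for W
    by (auto simp: D_def optimal_basis_iff)
  have poly: "polyhedron (D W)" for W
    unfolding DW cbox_interval[symmetric]
    by (intro polyhedron_Int polyhedron_interval) (simp add: dual_feasible_weights_polyhedron)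
  have cover: "{0..1} \<subseteq> (\<Union>W. D W)"
  proof
    fix l :: real assume l: "l \<in> {0..1}"
    then obtain p where "p \<in> dual_region (Amat P) (cost P l)" using dual by blast
    then obtain W where "optimal_basis (Amat P) (sub_rhs P y) (cost P l) W"
      using optimal_basis_exists x0 unfolding sub_feasible_def by blast
    with l show "l \<in> (\<Union>W. D W)" by (auto simp: D_def)
  qed
  have "\<exists>k a W. 1 \<le> k \<and> a 1 = 1 \<and> a (k + 1) = 0 \<and> (\<forall>i\<in>{1..k :: nat}.
      a (i + 1) < a i \<and> {a (i + 1)..a i} \<subseteq> D (W i) \<and> (\<forall>l\<in>D (W i). a (i + 1) \<le> l))"
  proof (rule interval_cover_chain[OF _ _ _ cover])
    show "closed (D W)" "convex (D W)" for W
      using poly by (auto intro: polyhedron_imp_closed polyhedron_imp_convex)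
  qed (auto simp: D_def)
  then obtain k a W where chain: "1 \<le> k" "a 1 = 1" "a (k + 1) = 0"
    and chain': "\<forall>i\<in>{1..k :: nat}. a (i + 1) < a i \<and> {a (i + 1)..a i} \<subseteq> D (W i) \<and>
      (\<forall>l\<in>D (W i). a (i + 1) \<le> l)"
    by (elim exE conjE)
  have "\<exists>x p1 p2. x \<in> efficient_extreme (sub_feasible P y) (sub_objective P) \<and>
        basic_solution (Amat P) (sub_rhs P y) (W i) x \<and>
        dual_values (Amat P) (cvec1 P) (W i) p1 \<and>
        dual_values (Amat P) (cvec2 P) (W i) p2 \<and>
        (\<forall>l\<in>{a (i + 1)..a i}. weighted_optimal (sub_feasible P y) (sub_objective P) l x)"
    if i: "i \<in> {1..k}" for i
  proof -
    have Di: "a (i + 1) < a i" "{a (i + 1)..a i} \<subseteq> D (W i)" using bspec[OF chain' i] by blast+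
    then have in01: "l \<in> {0..1}" "optimal_basis (Amat P) (sub_rhs P y) (cost P l) (W i)"
      if "l \<in> {a (i + 1)..a i}" for l using that unfolding D_def by auto
    from in01(2)[of "a i"] Di(1) have sb: "simplex_basis (Amat P) (W i)"
      and "\<exists>x. basic_solution (Amat P) (sub_rhs P y) (W i) x \<and> 0 \<le> x \<and> sub_rhs P y \<le> Amat P *v x"
      by (auto simp: optimal_basis_def)
    then obtain x where x: "basic_solution (Amat P) (sub_rhs P y) (W i) x" "0 \<le> x"
      "sub_rhs P y \<le> Amat P *v x" by blast
    have opt: "weighted_optimal (sub_feasible P y) (sub_objective P) l x"
      if l: "l \<in> {a (i + 1)..a i}" for l
    proof -
      obtain p where p: "dual_values (Amat P) (cost P l) (W i) p"
        "transpose (Amat P) *v p \<le> cost P l" "0 \<le> p"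
        using in01(2)[OF l] by (auto simp: optimal_basis_def)
      have "cost P l \<bullet> x \<le> cost P l \<bullet> w" if "w \<in> sub_feasible P y" for w
        using basis_duality[OF x(1) p(1)] weak_duality[OF p(3,2), of w "sub_rhs P y"] that
        by (simp add: sub_feasible_def)
      with x show ?thesis
        by (simp add: weighted_optimal_def sub_feasible_def weighted_sub_objective)
    qed
    \<comment> \<open>The midpoint lies strictly between 0 and 1, where weighted optimality gives
      efficiency; the two distinct end points give extremality in objective space.\<close>
    define l where "l = (a (i + 1) + a i) / 2"
    have l: "l \<in> {a (i + 1)..a i}" "0 < l" "l < 1"
      using Di(1) in01(1)[of "a i"] in01(1)[of "a (i + 1)"] by (auto simp: l_def)
    have "x \<in> efficient (sub_feasible P y) (sub_objective P)"
      by (rule weighted_optimal_efficient[OF opt l(2,3)]) (rule l)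
    moreover have "sub_objective P x extreme_point_of sub_objective P ` sub_feasible P y"
      by (rule weighted_optimal_two_extreme[OF opt opt, of "a i" "a (i + 1)"]) (use Di(1) in auto)
    ultimately have "x \<in> efficient_extreme (sub_feasible P y) (sub_objective P)"
      by (simp add: efficient_extreme_def nondominated_extreme_def nondominated_def)
    moreover obtain p1 p2 where "dual_values (Amat P) (cvec1 P) (W i) p1"
      "dual_values (Amat P) (cvec2 P) (W i) p2" using dual_values_exist[OF sb] by metis
    ultimately show ?thesis using x(1) opt by blast
  qed
  then obtain x p1 p2 where xp: "\<And>i. i \<in> {1..k} \<Longrightarrow>
        x i \<in> efficient_extreme (sub_feasible P y) (sub_objective P) \<and>
        basic_solution (Amat P) (sub_rhs P y) (W i) (x i) \<and>
        dual_values (Amat P) (cvec1 P) (W i) (p1 i) \<and>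
        dual_values (Amat P) (cvec2 P) (W i) (p2 i) \<and>
        (\<forall>l\<in>{a (i + 1)..a i}. weighted_optimal (sub_feasible P y) (sub_objective P) l (x i))"
    by metis
  have "explore_cuts P y k a p1 p2"
    unfolding explore_cuts_def
  proof (intro conjI exI[of _ x] exI[of _ W] ballI; (rule chain)?)
    fix i assume i: "i \<in> {1..k}"
    note c = bspec[OF chain' i] and d = xp[OF i]
    show "a (i + 1) < a i" using c by blast
    show "x i \<in> efficient_extreme (sub_feasible P y) (sub_objective P)"
      "basic_solution (Amat P) (sub_rhs P y) (W i) (x i)"
      "dual_values (Amat P) (cvec1 P) (W i) (p1 i)"
      "dual_values (Amat P) (cvec2 P) (W i) (p2 i)" using d by blast+
    fix l
    show "weighted_optimal (sub_feasible P y) (sub_objective P) l (x i)"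
      "optimal_basis (Amat P) (sub_rhs P y) (cost P l) (W i)" if "l \<in> {a (i + 1)..a i}"
      using d c that unfolding D_def by blast+
    show "optimal_basis (Amat P) (sub_rhs P y) (cost P l) (W i) \<longrightarrow> a (i + 1) \<le> l" if "l \<in> {0..1}"
      using c that unfolding D_def by blast
  qed
  then show ?thesis by blast
qed

lemma explore_exists:
  assumes "\<And>l. l \<in> {0..1} \<Longrightarrow> dual_region (Amat P) (cost P l) \<noteq> {}"
  shows "(\<exists>r. explore_ray P y r) \<or> (\<exists>k a p1 p2. explore_cuts P y k a p1 p2)"
proof (cases "sub_feasible P y = {}")
  case True
  then show ?thesis by (metis explore_ray_def sub_infeasible_ray)
next
  case False
  then show ?thesis using explore_cuts_exist[OF assms] by blast
qed

context

  \<comment> \<open>Consequences of the data returned by an exploration\<close>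
  fixes P :: "('n::finite, 'p::finite, 'm::finite, 'q::finite) blp" and y k a p1 p2
  assumes cuts: "explore_cuts P y k a p1 p2"
begin

lemma explore_weight_ends: "1 \<le> k" "a 1 = 1" "a (k + 1) = 0"
  using cuts by (simp_all add: explore_cuts_def)

lemma explore_weight_decreasing: "i \<in> {1..k} \<Longrightarrow> a (i + 1) < a i"
  using cuts by (auto simp: explore_cuts_def)

lemma explore_weight_range:
  assumes "i \<in> {1..k + 1}"
  shows "a i \<in> {0..1}"
proof -
  have "a i \<le> 1" using assms
  proof (induction i)
    case (Suc i)
    show ?case
    proof (cases "i = 0")
      case False
      then show ?thesis using Suc explore_weight_decreasing[of i] by simp
    qed (use explore_weight_ends in simp)
  qed simp
  moreover have "j \<le> k \<Longrightarrow> 0 \<le> a (k + 1 - j)" for j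
  proof (induction j)
    case (Suc j)
    then have "k - j \<in> {1..k}" by auto
    from explore_weight_decreasing[OF this] Suc show ?case by (simp add: Suc_diff_le)
  qed (use explore_weight_ends in simp)
  from this[of "k + 1 - i"] assms have "0 \<le> a i" by auto
  ultimately show ?thesis by simp
qed

lemma explore_weight_interval:
  assumes "l \<in> {0..1}"
  obtains i where "i \<in> {1..k}" "l \<in> {a (i + 1)..a i}"
proof -
  \<comment> \<open>For the least such index the predecessor fails the condition, which reads
    \<open>l < a i\<close>.\<close>
  define i where "i = (LEAST i. 1 \<le> i \<and> a (i + 1) \<le> l)"
  have ex: "1 \<le> k \<and> a (k + 1) \<le> l" using explore_weight_ends assms by simp
  have i: "1 \<le> i" "a (i + 1) \<le> l" using LeastI[where P = "\<lambda>i. 1 \<le> i \<and> a (i + 1) \<le> l", OF ex] unfolding i_def by blast+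
  have "i \<le> k" unfolding i_def by (rule Least_le) (rule ex)
  moreover have "l \<le> a i"
  proof (cases "i = 1")
    case False
    have "i - 1 < (LEAST i. 1 \<le> i \<and> a (i + 1) \<le> l)" using i unfolding i_def by linarith
    then have "\<not> (1 \<le> i - 1 \<and> a (i - 1 + 1) \<le> l)" by (rule not_less_Least)
    with False i show ?thesis by auto
  qed (use explore_weight_ends assms in simp)
  ultimately show thesis using that i by auto
qed

text \<open>The last property removes \<open>y\<close>: since \<open>W i\<close> is primal feasible,
  its optimality at a weight is the same as its dual feasibility there, so \<open>a (i + 1)\<close>
  is the least weight of dual feasibility.\<close>

lemma explore_cut_optimal_basis:
  assumes i: "i \<in> {1..k}"
  obtains x W where
    "\<And>l. l \<in> {a (i + 1)..a i} \<Longrightarrow> weighted_optimal (sub_feasible P y) (sub_objective P) l x"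
    "\<And>l. l \<in> {a (i + 1)..a i} \<Longrightarrow> sub_rhs P y \<bullet> (l *\<^sub>R p1 i + (1 - l) *\<^sub>R p2 i) = cost P l \<bullet> x"
    "\<And>l. l \<in> {a (i + 1)..a i} \<Longrightarrow> l *\<^sub>R p1 i + (1 - l) *\<^sub>R p2 i \<in> dual_points P l"
    "a (i + 1) = Inf {l \<in> {0..1}. dual_feasible_basis (Amat P) (cost P l) W}"
proof -
  obtain x W where xW: "basic_solution (Amat P) (sub_rhs P y) (W i) (x i)"
      "dual_values (Amat P) (cvec1 P) (W i) (p1 i)"
      "dual_values (Amat P) (cvec2 P) (W i) (p2 i)"
      "\<And>l. l \<in> {a (i + 1)..a i} \<Longrightarrow> weighted_optimal (sub_feasible P y) (sub_objective P) l (x i) \<and>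
        optimal_basis (Amat P) (sub_rhs P y) (cost P l) (W i)"
      "\<And>l. l \<in> {0..1} \<Longrightarrow> optimal_basis (Amat P) (sub_rhs P y) (cost P l) (W i) \<Longrightarrow> a (i + 1) \<le> l"
    using cuts i unfolding explore_cuts_def by blast
  have dual: "dual_values (Amat P) (cost P l) (W i) (l *\<^sub>R p1 i + (1 - l) *\<^sub>R p2 i)" for l
    using dual_values_combine[OF xW(2,3)] by (simp add: cost_def)
  have ends: "a (i + 1) \<in> {a (i + 1)..a i}" "a (i + 1) \<in> {0..1}"
    using explore_weight_decreasing[OF i] explore_weight_range[of "i + 1"] i by auto
  have primal: "primal_feasible_basis (Amat P) (sub_rhs P y) (W i)"
    and sb: "simplex_basis (Amat P) (W i)"
    using xW(4)[OF ends(1)] by (auto simp: optimal_basis_iff dual_feasible_basis_def)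
  show thesis
  proof (rule that[of "x i" "W i"])
    fix l assume l: "l \<in> {a (i + 1)..a i}"
    then show "weighted_optimal (sub_feasible P y) (sub_objective P) l (x i)" using xW(4) by blast
    show "sub_rhs P y \<bullet> (l *\<^sub>R p1 i + (1 - l) *\<^sub>R p2 i) = cost P l \<bullet> x i"
      by (rule basis_duality[OF xW(1) dual])
    have "dual_feasible_basis (Amat P) (cost P l) (W i)"
      using xW(4)[OF l] by (simp add: optimal_basis_iff)
    then show "l *\<^sub>R p1 i + (1 - l) *\<^sub>R p2 i \<in> dual_points P l"
      unfolding dual_points_eq using dual_feasible_basis_weights[OF sb xW(2,3)] dual_values_extreme[OF sb dual] by simp
  next
    show "a (i + 1) = Inf {l \<in> {0..1}. dual_feasible_basis (Amat P) (cost P l) (W i)}"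
      by (rule cInf_eq_minimum[symmetric])
        (use xW(4)[OF ends(1)] ends(2) xW(5) primal in \<open>auto simp: optimal_basis_iff\<close>)
  qed
qed

lemma explore_points:
  assumes "i \<in> {1..k}"
  shows "a i *\<^sub>R p1 i + (1 - a i) *\<^sub>R p2 i \<in> dual_points P (a i)"
  using explore_cut_optimal_basis[OF assms] explore_weight_decreasing[OF assms]
  by (metis atLeastAtMost_iff less_imp_le order_refl)

lemma explore_last_point: "p2 k \<in> dual_points P 0"
proof -
  have k: "k \<in> {1..k}" using explore_weight_ends by simp
  have "0 \<in> {a (k + 1)..a k}" using explore_weight_ends explore_weight_decreasing[OF k] by simp
  then have "0 *\<^sub>R p1 k + (1 - 0) *\<^sub>R p2 k \<in> dual_points P 0"
    using explore_cut_optimal_basis[OF k] by metis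
  then show ?thesis by simp
qed

lemma explore_weights_critical: "a ` {1..k + 1} \<subseteq> critical_weights P"
proof
  fix l assume "l \<in> a ` {1..k + 1}"
  then obtain i where i: "i \<in> {1..k + 1}" "l = a i" by blast
  show "l \<in> critical_weights P"
  proof (cases "i = 1")
    case False
    \<comment> \<open>For \<open>i > 1\<close> the weight \<open>a i\<close> is the lower end of
      interval \<open>i - 1\<close>.\<close>
    then have "i - 1 \<in> {1..k}" "i - 1 + 1 = i" using i by auto
    from explore_cut_optimal_basis[OF this(1)] this(2) obtain W where
      "a i = Inf {l \<in> {0..1}. dual_feasible_basis (Amat P) (cost P l) W}" by metis
    then show ?thesis unfolding critical_weights_def i(2) by blast
  qed (use i(2) explore_weight_ends(2) in \<open>auto simp: critical_weights_def\<close>)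
qed

text \<open>On each interval of weights the value function of the subproblem is linear, so the cuts at
  the end points imply those at all weights in between.\<close>

lemma explore_cuts_complete:
  assumes cut: "\<And>i. i \<in> {1..k} \<Longrightarrow>
      sub_rhs P y \<bullet> (a i *\<^sub>R p1 i + (1 - a i) *\<^sub>R p2 i) \<le> a i * t1 + (1 - a i) * t2"
    and cut0: "sub_rhs P y \<bullet> p2 k \<le> t2"
  shows "\<exists>x\<in>sub_feasible P y. cvec1 P \<bullet> x \<le> t1 \<and> cvec2 P \<bullet> x \<le> t2"
proof -
  have val: "\<exists>x\<in>sub_feasible P y. cost P l \<bullet> x \<le> l * t1 + (1 - l) * t2" if l01: "l \<in> {0..1}" for l
  proof -
    obtain i where i: "i \<in> {1..k}" "l \<in> {a (i + 1)..a i}" using explore_weight_interval[OF l01] .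
    obtain x where x: "\<And>m. m \<in> {a (i + 1)..a i} \<Longrightarrow> weighted_optimal (sub_feasible P y) (sub_objective P) m x"
      "\<And>m. m \<in> {a (i + 1)..a i} \<Longrightarrow> sub_rhs P y \<bullet> (m *\<^sub>R p1 i + (1 - m) *\<^sub>R p2 i) = cost P m \<bullet> x"
      by (rule explore_cut_optimal_basis[OF i(1)]) blast
    note lt = explore_weight_decreasing[OF i(1)]
    \<comment> \<open>Excess of the subproblem value over what the master solution provides at
      weight \<open>m\<close>. As \<open>x\<close> is the same on the whole interval, it is affine
      in \<open>m\<close>, so the two end points decide.\<close>
    define g where "g m = cost P m \<bullet> x - (m * t1 + (1 - m) * t2)" for m
    have g: "g m = (cvec2 P \<bullet> x - t2) + m * ((cvec1 P \<bullet> x - cvec2 P \<bullet> x) - (t1 - t2))" for m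
      by (simp add: g_def cost_def inner_simps algebra_simps)
    have ga: "g (a i) \<le> 0" using cut[OF i(1)] x(2)[of "a i"] lt by (simp add: g_def)
    \<comment> \<open>The cuts are generated at upper end points. The one at this lower end comes
      from the next basis, whose solution has the same value at this weight; for
      \<open>i = k\<close> it is the extra cut from \<open>p2 k\<close>.\<close>
    have gb: "g (a (i + 1)) \<le> 0"
    proof (cases "i = k")
      case True
      then show ?thesis
        using cut0 x(2)[of 0] lt explore_weight_ends by (simp add: g_def)
    next
      case False
      then have j: "i + 1 \<in> {1..k}" using i(1) by auto
      obtain x' where x': "\<And>m. m \<in> {a (i + 1 + 1)..a (i + 1)} \<Longrightarrow>
          weighted_optimal (sub_feasible P y) (sub_objective P) m x'"
        "\<And>m. m \<in> {a (i + 1 + 1)..a (i + 1)} \<Longrightarrow>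
          sub_rhs P y \<bullet> (m *\<^sub>R p1 (i + 1) + (1 - m) *\<^sub>R p2 (i + 1)) = cost P m \<bullet> x'"
        by (rule explore_cut_optimal_basis[OF j]) blast
      have "a (i + 1) \<in> {a (i + 1 + 1)..a (i + 1)}" "a (i + 1) \<in> {a (i + 1)..a i}"
        using lt explore_weight_decreasing[OF j] by auto
      then have "cost P (a (i + 1)) \<bullet> x \<le> cost P (a (i + 1)) \<bullet> x'"
        "cost P (a (i + 1)) \<bullet> x' \<le> a (i + 1) * t1 + (1 - a (i + 1)) * t2"
        using x(1) x' cut[OF j] by (auto simp: weighted_optimal_def weighted_sub_objective)
      then show ?thesis by (simp add: g_def)
    qed
    have "convex {m. g m \<le> 0}"
    proof -
      have "{m. g m \<le> 0} = {m. m * ((cvec1 P \<bullet> x - cvec2 P \<bullet> x) - (t1 - t2)) \<le> - (cvec2 P \<bullet> x - t2)}"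
        unfolding g by auto
      also have "polyhedron \<dots>" by (rule polyhedron_linear_le) (simp add: linear_iff algebra_simps)
      finally show ?thesis by (rule polyhedron_imp_convex)
    qed
    from closed_segment_subset[OF _ _ this, of "a (i + 1)" "a i"] ga gb lt
    have "{a (i + 1)..a i} \<subseteq> {m. g m \<le> 0}" by (simp add: closed_segment_eq_real_ivl)
    then have "g l \<le> 0" using i(2) by blast
    then show ?thesis using x(1)[OF i(2)] by (auto simp: g_def weighted_optimal_def)
  qed
  \<comment> \<open>So far \<open>x\<close> depends on the weight; Farkas' lemma yields one
    \<open>x\<close> for both objectives. Its multipliers become a weight on division by their sum
    \<open>s\<close>. If \<open>s = 0\<close>, division gives \<open>l = 0\<close>, and
    \<open>b1 = s * l\<close> still holds.\<close>
  have "\<exists>x\<ge>0. sub_rhs P y \<le> Amat P *v x \<and> cvec1 P \<bullet> x \<le> t1 \<and> cvec2 P \<bullet> x \<le> t2"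
  proof (rule biobjective_farkas)
    fix p and b1 b2 :: real
    assume p: "0 \<le> p" "0 \<le> b1" "0 \<le> b2"
      "transpose (Amat P) *v p \<le> b1 *\<^sub>R cvec1 P + b2 *\<^sub>R cvec2 P"
    define s where "s = b1 + b2"
    define l where "l = b1 / s"
    have b: "b1 = s * l" using p(2,3) by (cases "s = 0") (auto simp: s_def l_def)
    then have b2: "b2 = s * (1 - l)" by (simp add: s_def algebra_simps)
    have l: "l \<in> {0..1}" using p(2,3) by (auto simp: s_def l_def divide_le_eq_1)
    obtain x where x: "x \<in> sub_feasible P y" "cost P l \<bullet> x \<le> l * t1 + (1 - l) * t2"
      using val[OF l] by blast
    have "sub_rhs P y \<bullet> p \<le> (b1 *\<^sub>R cvec1 P + b2 *\<^sub>R cvec2 P) \<bullet> x"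
      using weak_duality[OF p(1,4)] x(1) by (simp add: sub_feasible_def)
    also have "\<dots> = s * (cost P l \<bullet> x)" by (simp add: b b2 cost_def inner_simps algebra_simps)
    also have "\<dots> \<le> s * (l * t1 + (1 - l) * t2)"
      using x(2) p(2,3) by (intro mult_left_mono) (simp_all add: s_def)
    also have "\<dots> = b1 * t1 + b2 * t2" by (simp add: b b2 algebra_simps)
    finally show "sub_rhs P y \<bullet> p \<le> b1 * t1 + b2 * t2" .
  qed
  then show ?thesis by (auto simp: sub_feasible_def)
qed

end

section \<open>Pivots\<close>

text \<open>The smallest face containing \<open>u\<close> works: on its relative boundary
  \<open>u\<close> would lie in a facet of it, which is a smaller face of \<open>S\<close>.\<close>

lemma polyhedron_face_relative_interior:
  fixes S :: "'a::euclidean_space set"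
  assumes "polyhedron S" "u \<in> S"
  obtains G where "G face_of S" "u \<in> rel_interior G"
proof -
  define G where "G = \<Inter>{F. F face_of S \<and> u \<in> F}"
  have G: "G face_of S" unfolding G_def
    by (rule face_of_Inter) (use assms polyhedron_imp_convex face_of_refl in blast)+
  have "u \<in> rel_interior G"
  proof (rule ccontr)
    assume "u \<notin> rel_interior G"
    moreover have "u \<in> G" by (auto simp: G_def)
    ultimately obtain F where F: "F facet_of G" "u \<in> F"
      using rel_boundary_of_polyhedron[OF face_of_polyhedron_polyhedron[OF assms(1) G]] by blast
    then have "F face_of S" using G face_of_trans facet_of_imp_face_of by blast
    then have "G \<subseteq> F" using F(2) by (auto simp: G_def)
    then have "F = G" using F(1) facet_of_imp_subset by blast
    with F(1) show False by (simp add: facet_of_def)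
  qed
  with G show thesis by (rule that)
qed

text \<open>Slicing the polytope by a hyperplane that separates \<open>v\<close> from the other vertices turns the
  edges at \<open>v\<close> into vertices of the slice.\<close>

lemma polytope_descending_edge:
  fixes Q :: "'a::euclidean_space set" and g :: "'a \<Rightarrow> real"
  assumes Q: "polytope Q" and v: "v extreme_point_of Q" and g: "linear g"
    and q: "q \<in> Q" "g q < g v"
  obtains w where "w extreme_point_of Q" "closed_segment v w edge_of Q" "g w < g v"
proof -
  have pQ: "polyhedron Q" and cQ: "compact Q" "convex Q"
    using Q polytope_imp_polyhedron polytope_imp_compact polytope_imp_convex by auto
  have vQ: "v \<in> Q" using v by (simp add: extreme_point_of_def)
  have "{v} exposed_face_of Q"
    using v by (simp add: exposed_face_of_polyhedron[OF pQ] face_of_singleton)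
  then obtain a b where ab: "Q \<subseteq> {x. a \<bullet> x \<le> b}" "{v} = Q \<inter> {x. a \<bullet> x = b}"
    by (auto simp: exposed_face_of_def)
  have av: "a \<bullet> v = b" using ab(2) by blast
  have less: "a \<bullet> x < b" if "x \<in> Q" "x \<noteq> v" for x using ab that by force
  \<comment> \<open>Including \<open>q\<close> makes the set nonempty and puts \<open>q\<close>
    beyond the slice, so that the segment from \<open>v\<close> to \<open>q\<close> meets the
    slice.\<close>
  define E where "E = insert q {x. x extreme_point_of Q \<and> x \<noteq> v}"
  define m where "m = Max ((\<lambda>x. a \<bullet> x) ` E)"
  have "finite E" using finite_polyhedron_extreme_points[OF pQ] by (simp add: E_def)
  then have mE: "a \<bullet> x \<le> m" if "x \<in> E" for x using that by (simp add: m_def)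
  have "m \<in> (\<lambda>x. a \<bullet> x) ` E" unfolding m_def by (rule Max_in) (use \<open>finite E\<close> in \<open>auto simp: E_def\<close>)
  moreover have "q \<noteq> v" using q(2) by auto
  then have "a \<bullet> x < b" if "x \<in> E" for x
    using that less q(1) by (auto simp: E_def extreme_point_of_def)
  ultimately have "m < b" by auto
  define \<beta> where "\<beta> = (m + b) / 2"
  have \<beta>: "m < \<beta>" "\<beta> < b" using \<open>m < b\<close> by (auto simp: \<beta>_def)
  define N where "N = Q \<inter> {x. a \<bullet> x = \<beta>}"
  have N: "convex N" "closed N" "bounded N" unfolding N_def using cQ
    by (auto intro: convex_Int convex_hyperplane closed_Int closed_hyperplane compact_imp_closed
        compact_imp_bounded bounded_Int)
  obtain z where z: "z \<in> N" "g z < g v"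
  proof -
    have aq: "a \<bullet> q < \<beta>" using mE[of q] \<beta>(1) by (simp add: E_def)
    define t where "t = (b - \<beta>) / (b - a \<bullet> q)"
    have t: "0 < t" "t < 1" using aq \<beta> by (auto simp: t_def)
    define z where "z = (1 - t) *\<^sub>R v + t *\<^sub>R q"
    have "a \<bullet> z = b - t * (b - a \<bullet> q)" by (simp add: z_def inner_simps av algebra_simps)
    also have "\<dots> = \<beta>" using aq \<beta> by (simp add: t_def)
    finally have "z \<in> N" unfolding N_def z_def
      using cQ(2) vQ q(1) t by (auto intro: convexD_alt)
    moreover have "g z = g v - t * (g v - g q)"
      by (simp only: z_def linear_add[OF g] linear_cmul[OF g]) (simp add: algebra_simps)
    then have "g z < g v" using t q(2) by simp
    ultimately show thesis by (rule that)
  qed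
  define T where "T = {x \<in> N. \<forall>y\<in>N. g x \<le> g y}"
  have T: "T face_of N" unfolding T_def by (rule face_of_linear_argmin[OF N(1) g])
  have "\<exists>x\<in>N. \<forall>y\<in>N. g x \<le> g y"
    using N z(1) linear_continuous_on[OF linear_conv_bounded_linear[THEN iffD1, OF g]]
    by (intro continuous_attains_inf) (auto simp: compact_eq_bounded_closed)
  then have "T \<noteq> {}" by (auto simp: T_def)
  then obtain u where u: "u \<in> T" "u extreme_point_of N"
    using extreme_point_in_bounded_face[OF T N(2,1) bounded_subset[OF N(3) face_of_imp_subset[OF T]]] by blast
  have uN: "u \<in> Q" "a \<bullet> u = \<beta>" using u(1) by (auto simp: T_def N_def)
  have "g u \<le> g z" using u(1) z(1) by (simp add: T_def)
  then have gu: "g u < g v" using z(2) by simp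
  obtain G where G: "G face_of Q" "u \<in> rel_interior G"
    using polyhedron_face_relative_interior[OF pQ uN(1)] .
  have uG: "u \<in> G" using G(2) rel_interior_subset by blast
  have GQ: "G \<subseteq> Q" by (rule face_of_imp_subset[OF G(1)])
  have "polytope G" by (rule face_of_polytope_polytope[OF Q G(1)])
  then have cG: "compact G" "convex G" using polytope_imp_compact polytope_imp_convex by auto
  \<comment> \<open>Otherwise all vertices of the polytope \<open>G\<close> have level at most
    \<open>m\<close>, below the level \<beta> of \<open>u\<close>.\<close>
  have "v \<in> G"
  proof (rule ccontr)
    assume "v \<notin> G"
    then have "{x. x extreme_point_of G} \<subseteq> {x. a \<bullet> x \<le> m}"
      using mE extreme_point_of_face[OF G(1)] by (auto simp: E_def)
    then have "convex hull {x. x extreme_point_of G} \<subseteq> {x. a \<bullet> x \<le> m}"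
      by (intro hull_minimal) (auto simp: convex_halfspace_le)
    then have "a \<bullet> u \<le> m" using Krein_Milman_Minkowski[OF cG] uG by auto
    with uN(2) \<beta>(1) show False by simp
  qed
  \<comment> \<open>As \<open>u\<close> is relatively interior in \<open>G\<close>, a second point
    of this section would let \<open>u\<close> move both ways within \<open>N\<close>, against
    extremality. A hyperplane section reduced to one point leaves dimension one for
    \<open>G\<close>.\<close>
  have "affine hull G \<inter> {x. a \<bullet> x = \<beta>} = {u}"
  proof
    show "{u} \<subseteq> affine hull G \<inter> {x. a \<bullet> x = \<beta>}" using uG uN(2) hull_inc by fastforce
    show "affine hull G \<inter> {x. a \<bullet> x = \<beta>} \<subseteq> {u}"
    proof (rule subsetI, rule ccontr)
      fix y assume y: "y \<in> affine hull G \<inter> {x. a \<bullet> x = \<beta>}" "y \<notin> {u}"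
      obtain e where e: "0 < e" "cball u e \<inter> affine hull G \<subseteq> G"
        using G(2) by (auto simp: mem_rel_interior_cball)
      define d where "d = (e / norm (y - u)) *\<^sub>R (y - u)"
      have d: "norm d = e" using y e by (simp add: d_def)
      have ad: "a \<bullet> d = 0" using y uN(2) by (simp add: d_def inner_simps)
      have mem: "u + s *\<^sub>R d \<in> N" if "\<bar>s\<bar> = 1" for s
      proof -
        have "u + (s * (e / norm (y - u))) *\<^sub>R (y - u) \<in> affine hull G"
          using mem_affine_3_minus[OF affine_affine_hull hull_inc[OF uG] _ hull_inc[OF uG]] y by blast
        then have "u + s *\<^sub>R d \<in> cball u e \<inter> affine hull G"
          using that d by (auto simp: d_def dist_norm abs_mult)
        then show ?thesis using e(2) GQ ad uN(2) by (auto simp: N_def inner_simps)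
      qed
      have ne: "u + d \<noteq> u - d" using d e(1)
        by (metis add_diff_cancel_left' diff_add_cancel less_irrefl norm_zero scaleR_2 scaleR_eq_0_iff add_diff_eq diff_diff_eq2 zero_neq_numeral)
      have "u = midpoint (u + d) (u - d)" by (simp add: midpoint_def flip: scaleR_2)
      then have "u \<in> open_segment (u + d) (u - d)" using ne midpoint_in_open_segment by metis
      with u(2) mem[of 1] mem[of "- 1"] show False by (auto simp: extreme_point_of_def)
    qed
  qed
  then have "aff_dim (affine hull G \<inter> {x. a \<bullet> x = \<beta>}) = 0" by simp
  moreover have "\<not> affine hull G \<subseteq> {x. a \<bullet> x = \<beta>}"
    using \<open>v \<in> G\<close> av \<beta>(2) hull_inc[of v G] by auto
  ultimately have dim: "aff_dim G = 1"
    by (simp add: aff_dim_affine_Int_hyperplane split: if_splits)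
  then have "collinear G" by (simp add: collinear_aff_dim)
  then obtain c d where cd: "G = closed_segment c d"
    using compact_convex_collinear_segment[of G] cG uG by blast
  have "v extreme_point_of G" using v \<open>v \<in> G\<close> extreme_point_of_face[OF G(1)] by blast
  then have "v = c \<or> v = d" by (simp add: cd extreme_point_of_segment)
  then obtain w where w: "G = closed_segment v w" using cd closed_segment_commute by metis
  have "w extreme_point_of G" by (simp add: w extreme_point_of_segment)
  then have "w extreme_point_of Q" using extreme_point_of_face[OF G(1)] by blast
  moreover have "closed_segment v w edge_of Q" using G(1) dim by (simp add: edge_of_def w)
  moreover have "g w < g v"
  proof -
    obtain t where t: "0 \<le> t" "u = (1 - t) *\<^sub>R v + t *\<^sub>R w" using uG by (auto simp: w in_segment)
    have "g u = g v + t * (g w - g v)"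
      by (simp only: t(2) linear_add[OF g] linear_cmul[OF g]) (simp add: algebra_simps)
    with gu have "t * (g w - g v) < 0" by simp
    with t(1) show ?thesis by (auto simp: mult_less_0_iff)
  qed
  ultimately show thesis by (rule that)
qed

section \<open>Faces of weighted optima and the existence of pivots\<close>

lemma linear_weighted:
  assumes "linear F"
  shows "linear (\<lambda>x. weighted l (F x))"
  using assms by (simp add: weighted_def linear_iff algebra_simps)

lemma weighted_optimal_face:
  fixes S :: "'a::euclidean_space set"
  assumes "convex S" "linear F"
  shows "{x. weighted_optimal S F l x} face_of S"
  using face_of_linear_argmin[OF assms(1) linear_weighted[OF assms(2)], of l]
  by (simp add: weighted_optimal_def)

lemma weighted_optimal_bounded:
  assumes "well_posed S F" "0 < l" "l < 1"
  shows "bounded {x. weighted_optimal S F l x}"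
  by (rule bounded_subset[of "efficient S F"])
    (use assms weighted_optimal_efficient in \<open>auto simp: well_posed_def\<close>)

lemma closed_optimal_weights: "closed {l. weighted_optimal S F l v}"
proof -
  have "{l. weighted_optimal S F l v}
      = (if v \<in> S then \<Inter>w\<in>S. {l. weighted l (F v) \<le> weighted l (F w)} else {})"
    by (auto simp: weighted_optimal_def)
  then show ?thesis unfolding weighted_def
    by (auto intro!: closed_INT closed_Collect_le continuous_intros)
qed

text \<open>For weights strictly inside the unit interval the optimal face is bounded, since it
  consists of efficient points, and so contains a vertex. Finitely many vertices with closed sets of
  weights cover everything left of \<open>l\<close>, so one of them is optimal at \<open>l\<close>
  and slightly below.\<close>

lemma extreme_weighted_optimal_left:
  fixes S :: "'a::euclidean_space set"
  assumes S: "polyhedron S" and F: "linear F" and wp: "well_posed S F" and l: "0 < l" "l \<le> 1"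
  obtains q b where "q extreme_point_of S" "weighted_optimal S F l q" "weighted_optimal S F b q"
    "0 < b" "b < l"
proof -
  have cS: "convex S" "closed S" using S polyhedron_imp_convex polyhedron_imp_closed by auto
  have "{0<..<l} \<subseteq> (\<Union>q\<in>{q. q extreme_point_of S}. {b. weighted_optimal S F b q})"
  proof
    fix b assume b: "b \<in> {0<..<l}"
    have "{x. weighted_optimal S F b x} \<noteq> {}"
      using wp b l(2) by (auto simp: well_posed_def)
    moreover have "bounded {x. weighted_optimal S F b x}"
      using weighted_optimal_bounded[OF wp] b l(2) by simp
    ultimately obtain q where "q \<in> {x. weighted_optimal S F b x}" "q extreme_point_of S"
      using extreme_point_in_bounded_face[OF weighted_optimal_face[OF cS(1) F] cS(2,1)] by blast
    then show "b \<in> (\<Union>q\<in>{q. q extreme_point_of S}. {b. weighted_optimal S F b q})" by blast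
  qed
  from finite_closed_cover_left[OF finite_polyhedron_extreme_points[OF S] closed_optimal_weights this l(1)]
  show thesis using that by blast
qed

text \<open>A vertex optimal at weight 1 and at some interior weight: the former minimises the first
  objective, the latter gives efficiency.\<close>

lemma first_efficient_exists:
  fixes S :: "'a::euclidean_space set" and F :: "'a \<Rightarrow> real \<times> real"
  assumes "polyhedron S" "linear F" "well_posed S F"
  obtains v where "first_efficient S F v"
proof -
  obtain q b where q: "q extreme_point_of S" "weighted_optimal S F 1 q" "weighted_optimal S F b q"
    "0 < b" "b < 1" using extreme_weighted_optimal_left[OF assms, of 1] by auto
  then have "first_efficient S F q"
    using weighted_optimal_efficient[OF q(3-5)] by (auto simp: first_efficient_def weighted_optimal_def weighted_def)
  then show thesis by (rule that)
qed

text \<open>At the smallest weight for which \<open>v\<close> is optimal, the optimal face contains a point with a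
  smaller second objective.  This face consists of efficient solutions and hence is a polytope.\<close>

lemma pivot_exists:
  fixes S :: "'a::euclidean_space set"
  assumes S: "polyhedron S" and F: "linear F" and wp: "well_posed S F"
    and v: "v extreme_point_of S" "v \<in> efficient S F"
    and l0: "weighted_optimal S F l0 v" "l0 \<in> {0..1}"
    and w: "w \<in> S" "snd (F w) < snd (F v)"
  obtains u where "pivot S F v u"
proof -
  define T where "T = {0..1} \<inter> {l. weighted_optimal S F l v}"
  define l where "l = Inf T"
  have T: "closed T" "T \<noteq> {}" using l0 by (auto simp: T_def intro: closed_Int closed_optimal_weights)
  have bdd: "bdd_below T" unfolding T_def using bdd_below_mono[OF bdd_below_Icc Int_lower1] .
  have "l \<in> T" unfolding l_def by (rule closed_contains_Inf[OF T(2) bdd T(1)])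
  then have l: "0 \<le> l" "l \<le> 1" "weighted_optimal S F l v" by (auto simp: T_def)
  have "l \<noteq> 0" using l(3) w by (auto simp: weighted_optimal_def weighted_def)
  with l(1) have l_pos: "0 < l" by simp
  obtain q b where q: "q extreme_point_of S" "weighted_optimal S F l q" "weighted_optimal S F b q"
    "0 < b" "b < l" using extreme_weighted_optimal_left[OF S F wp l_pos l(2)] .
  have qS: "q \<in> S" using q(2) by (simp add: weighted_optimal_def)
  define d1 where "d1 = fst (F q) - fst (F v)"
  define d2 where "d2 = snd (F q) - snd (F v)"
  have eq: "l * d1 + (1 - l) * d2 = 0"
    using l(3) q(2) by (fastforce simp: weighted_optimal_def weighted_def d1_def d2_def algebra_simps)
  have "b \<notin> T" using q(5) cInf_lower[OF _ bdd, of b] by (auto simp: l_def)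
  then have "\<not> weighted_optimal S F b v" using q l by (auto simp: T_def)
  then obtain w' where "w' \<in> S" "weighted b (F w') < weighted b (F v)"
    using v(1) by (auto simp: weighted_optimal_def extreme_point_of_def not_le)
  then have "weighted b (F q) < weighted b (F v)" using q(3) by (force simp: weighted_optimal_def)
  then have "b * d1 + (1 - b) * d2 < 0" by (simp add: weighted_def d1_def d2_def algebra_simps)
  \<comment> \<open>The equality at \<open>l\<close>, multiplied by \<open>b\<close>, eliminates
    \<open>d1\<close> from the strict inequality at \<open>b\<close>, multiplied by
    \<open>l\<close>.\<close>
  then have "l * (b * d1 + (1 - b) * d2) < 0" using l_pos by (simp add: mult_pos_neg)
  also have "l * (b * d1 + (1 - b) * d2) = b * (l * d1 + (1 - l) * d2) + (l - b) * d2"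
    by (simp add: algebra_simps)
  finally have d2: "d2 < 0" using q(5) by (simp add: eq mult_less_0_iff)
  \<comment> \<open>At \<open>l = 1\<close> the equality says that \<open>q\<close> and
    \<open>v\<close> agree in the first objective, so \<open>q\<close> would dominate
    \<open>v\<close>.\<close>
  have "l \<noteq> 1"
  proof
    assume "l = 1"
    then have "dominates (F q) (F v)" using eq d2 by (auto simp: dominates_def d1_def d2_def)
    with v(2) qS show False by (auto simp: efficient_def)
  qed
  with l(2) have l1: "l < 1" by simp
  define Q where "Q = {x. weighted_optimal S F l x}"
  have Q: "Q face_of S" unfolding Q_def
    by (rule weighted_optimal_face[OF polyhedron_imp_convex[OF S] F])
  have "polytope Q" unfolding polytope_eq_bounded_polyhedron
    using face_of_polyhedron_polyhedron[OF S Q] weighted_optimal_bounded[OF wp l_pos l1] by (simp add: Q_def)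
  moreover have "v extreme_point_of Q" using extreme_point_of_face[OF Q] v(1) l(3) by (simp add: Q_def)
  moreover have "linear (\<lambda>x. snd (F x))" using F by (simp add: linear_iff)
  ultimately obtain u where u: "u extreme_point_of Q" "closed_segment v u edge_of Q" "snd (F u) < snd (F v)"
    using polytope_descending_edge[of Q v "\<lambda>x. snd (F x)" q] q(2) d2 by (auto simp: Q_def d2_def)
  have "pivot S F v u" unfolding pivot_def
    using v(1) u l(3) l_pos l1 Q extreme_point_of_face[OF Q] face_of_trans[OF _ Q]
    by (auto simp: edge_of_def Q_def intro!: bexI[of _ l])
  then show thesis by (rule that)
qed

lemma polyhedron_master_feasible:
  fixes P :: "('n::finite, 'p::finite, 'm::finite, 'q::finite) blp"
  assumes "finite Dr" "finite (Sigma L Dp)"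
  shows "polyhedron (master_feasible P Dr L Dp)"
proof -
  define H where "H r = {v :: real \<times> real \<times> (real^'p). - ((Bmat P *v snd (snd v)) \<bullet> r) \<le> - (bvec P \<bullet> r)}" for r
  define K where "K = (\<lambda>(l, p). {v :: real \<times> real \<times> (real^'p).
    - ((Bmat P *v snd (snd v)) \<bullet> p) - l * fst v - (1 - l) * fst (snd v) \<le> - (bvec P \<bullet> p)})"
  have "master_feasible P Dr L Dp =
      {v. dvec P \<le> Dmat P *v (snd (snd v))} \<inter> {v. 0 \<le> snd (snd v)} \<inter>
      \<Inter>(H ` Dr) \<inter> \<Inter>(K ` Sigma L Dp)"
    by (auto simp: master_feasible_def sub_rhs_def inner_diff_left H_def K_def) (force simp: algebra_simps)+
  moreover have "polyhedron {v :: real \<times> real \<times> (real^'p). dvec P \<le> Dmat P *v (snd (snd v))}"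
    "polyhedron {v :: real \<times> real \<times> (real^'p). 0 \<le> snd (snd v)}"
    by (rule polyhedron_vec_ge, simp add: linear_iff matrix_vector_right_distrib matrix_vector_mult_scaleR)+
  moreover have "polyhedron (H r)" for r unfolding H_def
    by (rule polyhedron_linear_le)
      (simp add: linear_iff matrix_vector_right_distrib matrix_vector_mult_scaleR inner_simps)
  moreover have "polyhedron (K c)" for c unfolding K_def
    by (cases c, simp only: prod.case, rule polyhedron_linear_le)
      (simp add: linear_iff matrix_vector_right_distrib matrix_vector_mult_scaleR inner_simps algebra_simps)
  ultimately show ?thesis using assms by (auto intro!: polyhedron_Int polyhedron_Inter)
qed

lemma linear_master_objective: "linear (master_objective P)"
  by (auto simp: linear_iff master_objective_def inner_simps algebra_simps)

section \<open>The master problem as a relaxation\<close>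

text \<open>\<open>S\<close> is a relaxation of \<open>R\<close> whose additional image points are
  weakly dominated by images of \<open>R\<close>. A segment in the larger image through a
  nondominated \<open>z\<close> is pushed down to end points in the smaller one; by convexity the
  corresponding point is attained and weakly dominates \<open>z\<close>, hence equals it, so the end
  points have not moved.\<close>

lemma nondominated_extreme_cong:
  assumes sub: "G ` R \<subseteq> F ` S" and conv: "convex (G ` R)"
    and cover: "\<And>w. w \<in> S \<Longrightarrow> \<exists>u\<in>R. fst (G u) \<le> fst (F w) \<and> snd (G u) \<le> snd (F w)"
  shows "nondominated_extreme S F = nondominated_extreme R G"
proof -
  have cov: "\<exists>u\<in>G ` R. u = w \<or> dominates u w" if "w \<in> F ` S" for w
    using that cover by (force simp: dominates_def)
  have nd: "nondominated T H = {z \<in> H ` T. \<forall>w\<in>H ` T. \<not> dominates w z}" for T and H :: "'x \<Rightarrow> real \<times> real"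
    by (auto simp: nondominated_def efficient_def)
  have trans: "dominates u z" if "dominates w z" "u = w \<or> dominates u w" for u w z
    using that by (auto simp: dominates_def prod_eq_iff)
  have eq: "nondominated S F = nondominated R G"
  proof (intro set_eqI iffI)
    fix z assume "z \<in> nondominated S F"
    then have z: "z \<in> F ` S" "\<And>w. w \<in> F ` S \<Longrightarrow> \<not> dominates w z" unfolding nd by blast+
    obtain u where u: "u \<in> G ` R" "u = z \<or> dominates u z" using cov[OF z(1)] by blast
    then have "z \<in> G ` R" using z(2)[of u] sub by auto
    then show "z \<in> nondominated R G" unfolding nd using z(2) subsetD[OF sub] by simp
  next
    fix z assume "z \<in> nondominated R G"
    then have z: "z \<in> G ` R" "\<And>w. w \<in> G ` R \<Longrightarrow> \<not> dominates w z" unfolding nd by blast+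
    have "\<not> dominates w z" if w: "w \<in> F ` S" for w
    proof
      assume d: "dominates w z"
      obtain u where "u \<in> G ` R" "u = w \<or> dominates u w" using cov[OF w] by blast
      with trans[OF d] z(2) show False by blast
    qed
    then show "z \<in> nondominated S F" unfolding nd using z(1) subsetD[OF sub] by simp
  qed
  have "z extreme_point_of F ` S \<longleftrightarrow> z extreme_point_of G ` R" if z: "z \<in> nondominated R G" for z
  proof
    assume "z extreme_point_of F ` S"
    moreover have "z \<in> G ` R" using z by (simp add: nd)
    ultimately show "z extreme_point_of G ` R"
      unfolding extreme_point_of_def using subsetD[OF sub] by (metis (no_types))
  next
    assume ext: "z extreme_point_of G ` R"
    show "z extreme_point_of F ` S"
      unfolding extreme_point_of_def
    proof (intro conjI ballI notI)
      show "z \<in> F ` S" using ext sub by (auto simp: extreme_point_of_def)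
      fix a b assume ab: "a \<in> F ` S" "b \<in> F ` S" "z \<in> open_segment a b"
      then obtain t where t: "0 < t" "t < 1" "z = (1 - t) *\<^sub>R a + t *\<^sub>R b" and "a \<noteq> b"
        by (auto simp: in_segment)
      obtain a' where a': "a' \<in> G ` R" "a' = a \<or> dominates a' a" using cov[OF ab(1)] by blast
      obtain b' where b': "b' \<in> G ` R" "b' = b \<or> dominates b' b" using cov[OF ab(2)] by blast
      define z' where "z' = (1 - t) *\<^sub>R a' + t *\<^sub>R b'"
      have "z' \<in> G ` R" unfolding z'_def using conv a' b' t by (auto intro: convexD_alt)
      moreover have le: "fst a' \<le> fst a" "snd a' \<le> snd a" "fst b' \<le> fst b" "snd b' \<le> snd b"
        using a' b' by (auto simp: dominates_def)
      then have "fst z' \<le> fst z" "snd z' \<le> snd z"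
        unfolding t(3) z'_def using t by (auto intro!: add_mono mult_left_mono)
      ultimately have "z' = z" using z by (auto simp: nd dominates_def)
      then have s: "(1 - t) * (fst a - fst a') + t * (fst b - fst b') = 0"
        "(1 - t) * (snd a - snd a') + t * (snd b - snd b') = 0"
        unfolding t(3) z'_def by (simp_all add: prod_eq_iff algebra_simps)
      have n: "0 \<le> (1 - t) * (fst a - fst a')" "0 \<le> t * (fst b - fst b')"
        "0 \<le> (1 - t) * (snd a - snd a')" "0 \<le> t * (snd b - snd b')" using t le by auto
      have "(1 - t) * (fst a - fst a') = 0" "t * (fst b - fst b') = 0"
        "(1 - t) * (snd a - snd a') = 0" "t * (snd b - snd b') = 0" using s n by linarith+
      then have "a' = a" "b' = b" using t by (auto simp: prod_eq_iff)
      with a' b' ext ab(3) show False by (auto simp: extreme_point_of_def)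
    qed
  qed
  with eq show ?thesis by (auto simp: nondominated_extreme_def)
qed

definition compatible ::
    "('n::finite, 'p::finite, 'm::finite, 'q::finite) blp \<Rightarrow> 'p master_sol \<Rightarrow> bool" where
  "compatible P v \<longleftrightarrow>
    (\<exists>x\<in>sub_feasible P (snd (snd v)). cvec1 P \<bullet> x \<le> fst v \<and> cvec2 P \<bullet> x \<le> fst (snd v))"

definition covered_above ::
    "('n::finite, 'p::finite, 'm::finite, 'q::finite) blp \<Rightarrow> 'p master_sol set \<Rightarrow> real \<Rightarrow> bool" where
  "covered_above P S t \<longleftrightarrow> (\<forall>w\<in>S. t \<le> snd (master_objective P w) \<longrightarrow>
    (\<exists>u\<in>blp_feasible P. fst (blp_objective P u) \<le> fst (master_objective P w) \<and>
      snd (blp_objective P u) \<le> snd (master_objective P w)))"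

text \<open>The supporting weight is recorded because \<open>pivot_exists\<close> starts from it;
  all three conditions are inherited by smaller feasible sets containing \<open>v\<close>.\<close>

definition efficient_vertex :: "'a::euclidean_space set \<Rightarrow> ('a \<Rightarrow> real \<times> real) \<Rightarrow> 'a \<Rightarrow> bool" where
  "efficient_vertex S F v \<longleftrightarrow> v extreme_point_of S \<and> v \<in> efficient S F \<and>
    (\<exists>l\<in>{0..1}. weighted_optimal S F l v)"

lemma efficient_vertex_subset:
  assumes "efficient_vertex S F v" "S' \<subseteq> S" "v \<in> S'"
  shows "efficient_vertex S' F v"
  using assms unfolding efficient_vertex_def extreme_point_of_def efficient_def weighted_optimal_def
  by blast

lemma covered_above_subset: "covered_above P S t \<Longrightarrow> S' \<subseteq> S \<Longrightarrow> covered_above P S' t"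
  unfolding covered_above_def by blast

lemma convex_blp_feasible: "convex (blp_feasible P)"
proof -
  have "polyhedron {v. bvec P \<le> Amat P *v fst v + Bmat P *v snd v}"
    "polyhedron {v :: (real^'a) \<times> (real^'b). dvec P \<le> Dmat P *v snd v}"
    "polyhedron {v :: (real^'a) \<times> (real^'b). 0 \<le> fst v}"
    "polyhedron {v :: (real^'a) \<times> (real^'b). 0 \<le> snd v}"
    by (rule polyhedron_vec_ge, simp add: linear_iff matrix_vector_right_distrib
        matrix_vector_mult_scaleR algebra_simps)+
  then have "convex ({v. bvec P \<le> Amat P *v fst v + Bmat P *v snd v} \<inter> {v. dvec P \<le> Dmat P *v snd v} \<inter>
      {v. 0 \<le> fst v} \<inter> {v. 0 \<le> snd v})"
    by (intro convex_Int polyhedron_imp_convex)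
  moreover have "blp_feasible P = {v. bvec P \<le> Amat P *v fst v + Bmat P *v snd v} \<inter>
      {v. dvec P \<le> Dmat P *v snd v} \<inter> {v. 0 \<le> fst v} \<inter> {v. 0 \<le> snd v}"
    by (auto simp: blp_feasible_def)
  ultimately show ?thesis by simp
qed

lemma linear_blp_objective: "linear (blp_objective P)"
  by (auto simp: linear_iff blp_objective_def inner_simps algebra_simps)

lemma blp_feasible_iff:
  "(x, y) \<in> blp_feasible P \<longleftrightarrow> x \<in> sub_feasible P y \<and> dvec P \<le> Dmat P *v y \<and> 0 \<le> y"
  by (auto simp: blp_feasible_def sub_feasible_def sub_rhs_def less_eq_vec_def algebra_simps)

lemma compatible_dominated:
  assumes "compatible P v" "dvec P \<le> Dmat P *v snd (snd v)" "0 \<le> snd (snd v)"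
  obtains u where "u \<in> blp_feasible P" "fst (blp_objective P u) \<le> fst (master_objective P v)"
    "snd (blp_objective P u) \<le> snd (master_objective P v)"
proof -
  obtain t1 t2 y where v: "v = (t1, t2, y)" by (cases v)
  obtain x where "x \<in> sub_feasible P y" "cvec1 P \<bullet> x \<le> t1" "cvec2 P \<bullet> x \<le> t2"
    using assms(1) by (auto simp: compatible_def v)
  with assms that[of "(x, y)"] show thesis
    by (simp add: blp_feasible_iff v blp_objective_def master_objective_def)
qed

text \<open>Weak duality for the subproblem solution \<open>x\<close> below \<open>v\<close>: every
  valid ray or point cut already holds at \<open>x\<close>, and increasing the objective bounds
  preserves it because the weights are in the unit interval.\<close>

lemma compatible_master_feasible:
  assumes valid: "Dr \<subseteq> dual_rays P" "L \<subseteq> {0..1}" "\<And>l. l \<in> L \<Longrightarrow> Dp l \<subseteq> dual_points P l"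
    and v: "compatible P v" "dvec P \<le> Dmat P *v snd (snd v)" "0 \<le> snd (snd v)"
  shows "v \<in> master_feasible P Dr L Dp"
proof -
  obtain t1 t2 y where vt: "v = (t1, t2, y)" by (cases v)
  obtain x where x: "0 \<le> x" "sub_rhs P y \<le> Amat P *v x" "cvec1 P \<bullet> x \<le> t1" "cvec2 P \<bullet> x \<le> t2"
    using v(1) by (auto simp: compatible_def sub_feasible_def vt)
  have "sub_rhs P y \<bullet> r \<le> 0" if "r \<in> Dr" for r
  proof -
    have "r \<in> dual_region (Amat P) 0" using that valid(1) dual_rays_subset by blast
    then show ?thesis using weak_duality[of r "Amat P" 0 x "sub_rhs P y"] x by (simp add: dual_region_def)
  qed
  moreover have "sub_rhs P y \<bullet> p \<le> l * t1 + (1 - l) * t2" if "l \<in> L" "p \<in> Dp l" for l p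
  proof -
    have "p \<in> dual_region (Amat P) (cost P l)" using that valid(3) dual_points_subset by blast
    then have "sub_rhs P y \<bullet> p \<le> cost P l \<bullet> x"
      using weak_duality[of p "Amat P" "cost P l" x "sub_rhs P y"] x by (simp add: dual_region_def)
    also have "\<dots> \<le> l * t1 + (1 - l) * t2"
      using x that(1) valid(2) by (auto simp: cost_def inner_simps intro!: add_mono mult_left_mono)
    finally show ?thesis .
  qed
  ultimately show ?thesis using v by (simp add: master_feasible_def vt)
qed

lemma master_feasible_compatible_image:
  assumes "u \<in> blp_feasible P"
  obtains v where "compatible P v" "dvec P \<le> Dmat P *v snd (snd v)" "0 \<le> snd (snd v)"
    "master_objective P v = blp_objective P u"
proof -
  obtain x y where u: "u = (x, y)" by (cases u)
  show thesis
    by (rule that[of "(cvec1 P \<bullet> x, cvec2 P \<bullet> x, y)"])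
      (use assms in \<open>auto simp: u blp_feasible_iff compatible_def master_objective_def blp_objective_def\<close>)
qed

text \<open>Only levels between \<open>w\<close> and \<open>v\<close> are new. There the common
  optimal weight puts \<open>z\<close> above the segment joining the two images, and a convex
  combination of original points below \<open>v\<close> and \<open>w\<close> weakly dominates the
  point of the segment at the level of \<open>z\<close>.\<close>

lemma pivot_covered:
  assumes piv: "pivot S (master_objective P) v w"
    and S: "\<And>u. u \<in> S \<Longrightarrow> dvec P \<le> Dmat P *v snd (snd u) \<and> 0 \<le> snd (snd u)"
    and comp: "compatible P v" "compatible P w"
    and cov: "covered_above P S (snd (master_objective P v))"
  shows "covered_above P S (snd (master_objective P w))"
  unfolding covered_above_def
proof (intro ballI impI)
  fix z assume z: "z \<in> S" "snd (master_objective P w) \<le> snd (master_objective P z)"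
  let ?F = "master_objective P" and ?G = "blp_objective P"
  show "\<exists>u\<in>blp_feasible P. fst (?G u) \<le> fst (?F z) \<and> snd (?G u) \<le> snd (?F z)"
  proof (cases "snd (?F v) \<le> snd (?F z)")
    case True
    then show ?thesis using cov z(1) by (simp add: covered_above_def)
  next
    case False
    obtain l where l: "0 < l" "l < 1" "weighted_optimal S ?F l v" "weighted_optimal S ?F l w"
      using piv by (auto simp: pivot_def)
    have vw: "v \<in> S" "w \<in> S" and lt: "snd (?F w) < snd (?F v)"
      using piv by (auto simp: pivot_def extreme_point_of_def)
    obtain a where a: "a \<in> blp_feasible P" "fst (?G a) \<le> fst (?F v)" "snd (?G a) \<le> snd (?F v)"
      using compatible_dominated[OF comp(1)] S[OF vw(1)] by blast
    obtain b where b: "b \<in> blp_feasible P" "fst (?G b) \<le> fst (?F w)" "snd (?G b) \<le> snd (?F w)"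
      using compatible_dominated[OF comp(2)] S[OF vw(2)] by blast
    \<comment> \<open>The parameter at which the segment from \<open>v\<close> to \<open>w\<close>
      has the second objective of \<open>z\<close>.\<close>
    define t where "t = (snd (?F v) - snd (?F z)) / (snd (?F v) - snd (?F w))"
    have t: "0 \<le> t" "t \<le> 1" using False lt z(2) by (auto simp: t_def divide_le_eq_1)
    have "t * (snd (?F v) - snd (?F w)) = snd (?F v) - snd (?F z)" using lt by (simp add: t_def)
    then have sz: "snd (?F z) = (1 - t) * snd (?F v) + t * snd (?F w)" by (simp add: algebra_simps)
    have "weighted l (?F v) \<le> weighted l (?F z)" "weighted l (?F w) \<le> weighted l (?F z)"
      using l z(1) by (auto simp: weighted_optimal_def)
    then have "(1 - t) * weighted l (?F v) + t * weighted l (?F w)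
        \<le> (1 - t) * weighted l (?F z) + t * weighted l (?F z)"
      using t by (intro add_mono mult_left_mono) auto
    also have "\<dots> = l * fst (?F z) + (1 - l) * snd (?F z)" by (simp add: weighted_def algebra_simps)
    finally have "l * ((1 - t) * fst (?F v) + t * fst (?F w)) \<le> l * fst (?F z)"
      unfolding sz by (simp add: weighted_def algebra_simps)
    then have fz: "(1 - t) * fst (?F v) + t * fst (?F w) \<le> fst (?F z)" using l(1) by simp
    define u where "u = (1 - t) *\<^sub>R a + t *\<^sub>R b"
    have "u \<in> blp_feasible P" unfolding u_def
      using convexD_alt[OF convex_blp_feasible a(1) b(1)] t by simp
    moreover have G: "?G u = (1 - t) *\<^sub>R ?G a + t *\<^sub>R ?G b"
      unfolding u_def by (simp only: linear_add[OF linear_blp_objective] linear_cmul[OF linear_blp_objective])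
    have "fst (?G u) \<le> (1 - t) * fst (?F v) + t * fst (?F w)"
      "snd (?G u) \<le> (1 - t) * snd (?F v) + t * snd (?F w)"
      unfolding G using a b t by (auto intro!: add_mono mult_left_mono)
    ultimately show ?thesis using fz sz by (intro bexI[of _ u]) auto
  qed
qed

lemma pivot_efficient_vertex:
  assumes "pivot S F v w"
  shows "efficient_vertex S F w"
  using assms weighted_optimal_efficient
  by (fastforce simp: pivot_def efficient_vertex_def greaterThanLessThan_iff)

text \<open>In an optimal solution \<open>(x, y)\<close> of the weighted problem, \<open>x\<close>
  is optimal for its subproblem, and strong duality applies. The dual region is independent of
  \<open>y\<close>, so the conclusion serves all subproblems.\<close>

lemma dual_regions_nonempty:
  assumes "well_posed (blp_feasible P) (blp_objective P)" "l \<in> {0..1}"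
  shows "dual_region (Amat P) (cost P l) \<noteq> {}"
proof -
  obtain x y where xy: "weighted_optimal (blp_feasible P) (blp_objective P) l (x, y)"
    using assms by (force simp: well_posed_def)
  then have x: "x \<in> sub_feasible P y" "dvec P \<le> Dmat P *v y" "0 \<le> y"
    by (auto simp: weighted_optimal_def blp_feasible_iff)
  have "cost P l \<bullet> x \<le> cost P l \<bullet> x'" if "x' \<in> sub_feasible P y" for x'
  proof -
    have "(x', y) \<in> blp_feasible P" using that x by (simp add: blp_feasible_iff)
    then have "weighted l (blp_objective P (x, y)) \<le> weighted l (blp_objective P (x', y))"
      using xy by (simp only: weighted_optimal_def)
    then show ?thesis by (simp add: weighted_def blp_objective_def cost_def inner_simps algebra_simps)
  qed
  then have "\<exists>p\<ge>0. transpose (Amat P) *v p \<le> cost P l \<and> sub_rhs P y \<bullet> p = cost P l \<bullet> x"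
    using x(1) by (intro strong_duality) (auto simp: sub_feasible_def)
  then show ?thesis by (auto simp: dual_region_def)
qed

definition unit_dual_rays ::
    "('n::finite, 'p::finite, 'm::finite, 'q::finite) blp \<Rightarrow> (real^'m) set" where
  "unit_dual_rays P = {r \<in> dual_rays P. norm r = 1}"

lemma finite_unit_dual_rays: "finite (unit_dual_rays P)"
  by (rule finite_subset[OF _ dual_region_rays_finite[of "Amat P"]])
    (auto simp: unit_dual_rays_def dual_rays_eq)

lemma sgn_dual_rays:
  assumes "r \<in> dual_rays P"
  shows "sgn r \<in> unit_dual_rays P"
proof -
  have r: "r \<noteq> 0" using assms by (simp add: dual_rays_def)
  have "{t *\<^sub>R sgn r |t. 0 \<le> t} = {t *\<^sub>R r |t. 0 \<le> t}"
  proof (intro set_eqI iffI)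
    fix x assume "x \<in> {t *\<^sub>R sgn r |t. 0 \<le> t}"
    then obtain t where "0 \<le> t" "x = t *\<^sub>R sgn r" by blast
    then show "x \<in> {t *\<^sub>R r |t. 0 \<le> t}"
      by (intro CollectI exI[of _ "t / norm r"]) (simp add: sgn_div_norm divide_inverse)
  next
    fix x assume "x \<in> {t *\<^sub>R r |t. 0 \<le> t}"
    then obtain t where "0 \<le> t" "x = t *\<^sub>R r" by blast
    then show "x \<in> {t *\<^sub>R sgn r |t. 0 \<le> t}" using r
      by (intro CollectI exI[of _ "t * norm r"]) (simp add: sgn_div_norm)
  qed
  then show ?thesis using assms r by (simp add: unit_dual_rays_def dual_rays_eq norm_sgn sgn_zero_iff)
qed

lemma inner_sgn_le_0_iff: "x \<bullet> sgn r \<le> 0 \<longleftrightarrow> x \<bullet> r \<le> (0 :: real)"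
  by (cases "r = 0") (auto simp: sgn_div_norm mult_le_0_iff inverse_eq_divide divide_le_0_iff)

text \<open>With all unit rays and all dual extreme points at weight 1, the relaxed master is exact
  for the first objective: rays force a feasible subproblem, and an extreme dual optimum bounds
  \<open>t1\<close> by its value.\<close>

lemma benders_first_exists:
  assumes wp: "well_posed (blp_feasible P) (blp_objective P)"
  obtains R Q v where "benders_first P R Q v"
proof -
  define M where "M = master_feasible P (unit_dual_rays P) {1} (\<lambda>l. if l = 1 then dual_points P 1 else {})"
  obtain x y where xy: "weighted_optimal (blp_feasible P) (blp_objective P) 1 (x, y)"
    using wp by (force simp: well_posed_def)
  then have xyf: "(x, y) \<in> blp_feasible P" by (simp add: weighted_optimal_def)
  then have x: "x \<in> sub_feasible P y" "dvec P \<le> Dmat P *v y" "0 \<le> y"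
    by (simp_all add: blp_feasible_iff)
  have min: "cvec1 P \<bullet> x + fvec1 P \<bullet> y \<le> cvec1 P \<bullet> x' + fvec1 P \<bullet> y'" if "(x', y') \<in> blp_feasible P" for x' y'
    using xy that by (fastforce simp: weighted_optimal_def weighted_def blp_objective_def)
  define v where "v = (cvec1 P \<bullet> x, cvec2 P \<bullet> x, y)"
  have "v \<in> M" unfolding M_def
    by (rule compatible_master_feasible) (use x in \<open>auto simp: v_def compatible_def unit_dual_rays_def\<close>)
  moreover have "fst (master_objective P v) \<le> fst (master_objective P w)" if w: "w \<in> M" for w
  proof -
    obtain t1 t2 y' where wt: "w = (t1, t2, y')" by (cases w)
    have y': "dvec P \<le> Dmat P *v y'" "0 \<le> y'"
      and ray: "\<And>r. r \<in> unit_dual_rays P \<Longrightarrow> sub_rhs P y' \<bullet> r \<le> 0"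
      and pt: "\<And>p. p \<in> dual_points P 1 \<Longrightarrow> sub_rhs P y' \<bullet> p \<le> t1"
      using w by (auto simp: M_def master_feasible_def wt)
    have "sub_feasible P y' \<noteq> {}"
      using sub_infeasible_ray[of P y'] ray sgn_dual_rays by (metis inner_sgn_le_0_iff not_less)
    then obtain x0 where x0: "0 \<le> x0" "sub_rhs P y' \<le> Amat P *v x0" by (auto simp: sub_feasible_def)
    obtain p0 where p0: "p0 \<in> dual_region (Amat P) (cost P 1)" using dual_regions_nonempty[OF wp, of 1] by auto
    obtain x' where x': "0 \<le> x'" "sub_rhs P y' \<le> Amat P *v x'"
      "\<And>x''. 0 \<le> x'' \<Longrightarrow> sub_rhs P y' \<le> Amat P *v x'' \<Longrightarrow> cost P 1 \<bullet> x' \<le> cost P 1 \<bullet> x''"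
      using primal_optimum_exists[OF x0, of p0 "cost P 1"] p0 by (auto simp: dual_region_def)
    obtain p where p: "p \<in> dual_region (Amat P) (cost P 1)" "sub_rhs P y' \<bullet> p = cost P 1 \<bullet> x'"
      using strong_duality[OF x'] by (auto simp: dual_region_def)
    have max: "- (sub_rhs P y' \<bullet> p) \<le> - (sub_rhs P y' \<bullet> q)" if "q \<in> dual_region (Amat P) (cost P 1)" for q
      using weak_duality[OF _ _ x'(1,2), of q "cost P 1"] that p(2) by (simp add: dual_region_def)
    have D: "closed (dual_region (Amat P) (cost P 1))" "convex (dual_region (Amat P) (cost P 1))"
      "dual_region (Amat P) (cost P 1) \<subseteq> {q. 0 \<le> q}"
      using polyhedron_dual_region polyhedron_imp_closed polyhedron_imp_convex
      by (blast, blast, auto simp: dual_region_def)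
    have "linear (\<lambda>q. - (sub_rhs P y' \<bullet> q))" by (simp add: linear_iff inner_simps)
    from extreme_minimiser_in_orthant[OF D this p(1) max] p(1)
    obtain q where q: "q extreme_point_of dual_region (Amat P) (cost P 1)"
      "- (sub_rhs P y' \<bullet> q) \<le> - (sub_rhs P y' \<bullet> p)" by metis
    have "cvec1 P \<bullet> x' \<le> t1" using pt[of q] q p(2) by (simp add: dual_points_eq cost_def)
    moreover have "(x', y') \<in> blp_feasible P" using x' y' by (simp add: blp_feasible_iff sub_feasible_def)
    ultimately show ?thesis using min[of x' y'] by (simp add: v_def wt master_objective_def)
  qed
  ultimately have "weighted_optimal M (master_objective P) 1 v"
    by (simp add: weighted_optimal_def weighted_def)
  moreover have "weighted_optimal (sub_feasible P y) (sub_objective P) 1 x"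
    using x min[of _ y] by (auto simp: weighted_optimal_def weighted_def sub_objective_def blp_feasible_iff)
  moreover have "unit_dual_rays P \<subseteq> dual_rays P" by (auto simp: unit_dual_rays_def)
  ultimately have "benders_first P (unit_dual_rays P) (dual_points P 1) v"
    unfolding benders_first_def M_def
    by (auto simp: v_def finite_unit_dual_rays finite_dual_points)
  then show thesis by (rule that)
qed

section \<open>Invariant and termination of the algorithm\<close>

text \<open>The condition on \<open>points\<close> is imposed at every \<open>l\<close>, so that it
  is available when \<open>l\<close> joins \<open>weights\<close> later.\<close>

definition valid_cuts ::
    "('n::finite, 'p::finite, 'm::finite, 'q::finite) blp \<Rightarrow> ('m, 'p) bbsa_state \<Rightarrow> bool" where
  "valid_cuts P s \<longleftrightarrow> finite (rays s) \<and> rays s \<subseteq> dual_rays P \<and>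
    weights s \<subseteq> {0..1} \<inter> critical_weights P \<and> (\<forall>l. points s l \<subseteq> dual_points P l)"

definition good_vertex ::
    "('n::finite, 'p::finite, 'm::finite, 'q::finite) blp \<Rightarrow> ('m, 'p) bbsa_state
     \<Rightarrow> 'p master_sol \<Rightarrow> bool" where
  "good_vertex P s v \<longleftrightarrow> efficient_vertex (bm_feasible P s) (master_objective P) v \<and>
    compatible P v \<and> covered_above P (bm_feasible P s) (snd (master_objective P v))"

text \<open>Both parts are conditional, since a candidate may be cut off by its own exploration and is known
  to be compatible only afterwards.\<close>

definition promising ::
    "('n::finite, 'p::finite, 'm::finite, 'q::finite) blp \<Rightarrow> ('m, 'p) bbsa_state
     \<Rightarrow> 'p master_sol \<Rightarrow> bool" where
  "promising P s v \<longleftrightarrow>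
    (v \<in> bm_feasible P s \<longrightarrow> efficient_vertex (bm_feasible P s) (master_objective P) v) \<and>
    (compatible P v \<longrightarrow> covered_above P (bm_feasible P s) (snd (master_objective P v)))"

text \<open>The exception \<open>explored s = {}\<close> in \<open>Step2\<close> is for the Benders
  candidate, which need not be a vertex. Feasibility in \<open>Step4\<close> while nothing is stored
  ensures that the first visit stores, so \<open>last_sol\<close> is set before a candidate can be
  rejected.\<close>

definition bbsa_invariant ::
    "('n::finite, 'p::finite, 'm::finite, 'q::finite) blp \<Rightarrow> ('m, 'p) bbsa_state \<Rightarrow> bool" where
  "bbsa_invariant P s \<longleftrightarrow> valid_cuts P s \<and>
    (\<forall>v\<in>bm_feasible P s. snd (snd v) \<in> explored s \<longrightarrow> compatible P v) \<and>
    (stored_sols s \<noteq> {} \<longrightarrow> good_vertex P s (last_sol s)) \<and>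
    (case phase s of
      Step1 \<Rightarrow> s = bbsa_start
    | Step2 \<Rightarrow> (explored s = {} \<or> candidate s extreme_point_of bm_feasible P s \<and>
          snd (snd (candidate s)) \<notin> explored s) \<and>
        (stored_sols s \<noteq> {} \<longrightarrow> promising P s (candidate s))
    | Step3 \<Rightarrow> stored_sols s \<noteq> {} \<longrightarrow>
        promising P s (candidate s) \<and> snd (snd (candidate s)) \<in> explored s
    | Step4 \<Rightarrow> promising P s (candidate s) \<and> snd (snd (candidate s)) \<in> explored s \<and>
        (stored_sols s = {} \<longrightarrow> candidate s \<in> bm_feasible P s)
    | Step5 \<Rightarrow> stored_sols s \<noteq> {} \<and> good_vertex P s (position s) \<and>
        snd (master_objective P (position s)) \<le> snd (master_objective P (last_sol s))
    | _ \<Rightarrow> \<forall>t. covered_above P (bm_feasible P s) t)"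

text \<open>Phrased with the two sets that are counted in \<open>missing_cuts\<close>, so that
  equality of these sets means equality of the master problems.\<close>

lemma bm_feasible_iff:
  "v \<in> bm_feasible P s \<longleftrightarrow> dvec P \<le> Dmat P *v snd (snd v) \<and> 0 \<le> snd (snd v) \<and>
    (\<forall>r\<in>sgn ` rays s. sub_rhs P (snd (snd v)) \<bullet> r \<le> 0) \<and>
    (\<forall>(l, p)\<in>Sigma (weights s) (points s).
      sub_rhs P (snd (snd v)) \<bullet> p \<le> l * fst v + (1 - l) * fst (snd v))"
  by (cases v) (auto simp: bm_feasible_def master_feasible_def inner_sgn_le_0_iff)

lemma bm_feasible_antimono:
  assumes "sgn ` rays s \<subseteq> sgn ` rays t" "Sigma (weights s) (points s) \<subseteq> Sigma (weights t) (points t)"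
  shows "bm_feasible P t \<subseteq> bm_feasible P s"
  using assms unfolding bm_feasible_iff subset_iff by blast

lemma bm_feasibleD:
  "v \<in> bm_feasible P s \<Longrightarrow> dvec P \<le> Dmat P *v snd (snd v) \<and> 0 \<le> snd (snd v)"
  by (simp add: bm_feasible_iff)

lemma valid_cuts_finite:
  assumes "valid_cuts P s"
  shows "finite (Sigma (weights s) (points s))"
    and "Sigma (weights s) (points s) \<subseteq> Sigma (critical_weights P) (dual_points P)"
    and "sgn ` rays s \<subseteq> unit_dual_rays P"
proof -
  show *: "Sigma (weights s) (points s) \<subseteq> Sigma (critical_weights P) (dual_points P)"
    using assms by (auto simp: valid_cuts_def)
  show "finite (Sigma (weights s) (points s))"
    by (rule finite_subset[OF *]) (simp add: finite_critical_weights finite_dual_points)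
  show "sgn ` rays s \<subseteq> unit_dual_rays P"
    using assms sgn_dual_rays unfolding valid_cuts_def by blast
qed

lemma bm_polyhedron: "valid_cuts P s \<Longrightarrow> polyhedron (bm_feasible P s)"
  unfolding bm_feasible_def
  by (rule polyhedron_master_feasible) (simp_all add: valid_cuts_finite(1), simp add: valid_cuts_def)

lemma compatible_bm_feasible:
  assumes "valid_cuts P s" "compatible P v" "dvec P \<le> Dmat P *v snd (snd v)" "0 \<le> snd (snd v)"
  shows "v \<in> bm_feasible P s"
  unfolding bm_feasible_def
  by (rule compatible_master_feasible) (use assms in \<open>auto simp: valid_cuts_def\<close>)

lemma good_vertex_feasible: "good_vertex P s v \<Longrightarrow> v \<in> bm_feasible P s"
  by (simp add: good_vertex_def efficient_vertex_def efficient_def)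

lemma good_vertex_shrink:
  assumes "good_vertex P s v" "valid_cuts P t" "bm_feasible P t \<subseteq> bm_feasible P s"
  shows "good_vertex P t v"
  using assms efficient_vertex_subset[OF _ assms(3)] covered_above_subset[OF _ assms(3)]
    compatible_bm_feasible[OF assms(2)] bm_feasibleD[OF good_vertex_feasible[OF assms(1)]]
  unfolding good_vertex_def by blast

lemma promising_shrink:
  assumes "promising P s v" "bm_feasible P t \<subseteq> bm_feasible P s"
  shows "promising P t v"
  using assms efficient_vertex_subset[OF _ assms(2)] covered_above_subset[OF _ assms(2)]
  unfolding promising_def by blast

lemma good_vertex_pivot:
  assumes "good_vertex P s v" "pivot (bm_feasible P s) (master_objective P) v w"
  shows "promising P s w"
  using assms pivot_efficient_vertex[OF assms(2)] pivot_covered[OF assms(2)] bm_feasibleD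
  unfolding promising_def good_vertex_def by blast

lemma promising_good_vertex:
  "promising P s v \<Longrightarrow> v \<in> bm_feasible P s \<Longrightarrow> compatible P v \<Longrightarrow> good_vertex P s v"
  by (simp add: promising_def good_vertex_def)

text \<open>As \<open>v\<close> minimises the first objective, it weakly dominates every point whose
  second objective is not smaller, and so does an original point below \<open>v\<close>.\<close>

lemma first_efficient_promising:
  assumes "first_efficient (bm_feasible P s) (master_objective P) v"
  shows "promising P s v"
proof -
  have v: "v \<in> bm_feasible P s" "\<And>w. w \<in> bm_feasible P s \<Longrightarrow> fst (master_objective P v) \<le> fst (master_objective P w)"
    using assms by (auto simp: first_efficient_def efficient_def)
  have "weighted_optimal (bm_feasible P s) (master_objective P) 1 v"
    using v by (simp add: weighted_optimal_def weighted_def)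
  moreover have "covered_above P (bm_feasible P s) (snd (master_objective P v))" if comp: "compatible P v"
  proof -
    obtain u where "u \<in> blp_feasible P" "fst (blp_objective P u) \<le> fst (master_objective P v)"
      "snd (blp_objective P u) \<le> snd (master_objective P v)"
      using compatible_dominated[OF comp] bm_feasibleD[OF v(1)] by blast
    then show ?thesis using v(2) unfolding covered_above_def by (meson order_trans)
  qed
  ultimately show ?thesis using assms
    by (auto simp: promising_def efficient_vertex_def first_efficient_def intro!: bexI[of _ 1])
qed

lemma explore_step:
  assumes inv: "bbsa_invariant P s" and step: "bbsa_step P s t" and ph: "phase s = Step2"
  shows "phase t = Step3" "explored t = insert (snd (snd (candidate s))) (explored s)"
    and "candidate t = candidate s" "last_sol t = last_sol s" "stored_sols t = stored_sols s"
    and "rays s \<subseteq> rays t" "Sigma (weights s) (points s) \<subseteq> Sigma (weights t) (points t)"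
    and "valid_cuts P t"
    and "\<And>v. v \<in> bm_feasible P t \<Longrightarrow> snd (snd v) = snd (snd (candidate s)) \<Longrightarrow> compatible P v"
proof -
  have val: "valid_cuts P s" using inv by (simp add: bbsa_invariant_def)
  have "phase t = Step3 \<and> explored t = insert (snd (snd (candidate s))) (explored s) \<and>
    candidate t = candidate s \<and> last_sol t = last_sol s \<and> stored_sols t = stored_sols s \<and>
    rays s \<subseteq> rays t \<and> Sigma (weights s) (points s) \<subseteq> Sigma (weights t) (points t) \<and>
    valid_cuts P t \<and>
    (\<forall>v\<in>bm_feasible P t. snd (snd v) = snd (snd (candidate s)) \<longrightarrow> compatible P v)"
    using step
  proof cases
    case (ray y r)
    then have "valid_cuts P t" using val by (auto simp: valid_cuts_def explore_ray_def)
    \<comment> \<open>The new cut removes all points with this \<open>y\<close>, so the claim about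
      them is vacuous.\<close>
    moreover have "snd (snd v) \<noteq> y" if "v \<in> bm_feasible P t" for v
      using that ray by (auto simp: bm_feasible_iff inner_sgn_le_0_iff explore_ray_def)
    ultimately show ?thesis using ray by auto
  next
    case (cuts y k a p1 p2)
    have pts: "points t l = points s l \<union>
        {a i *\<^sub>R p1 i + (1 - a i) *\<^sub>R p2 i |i. i \<in> {1..k} \<and> a i = l} \<union>
        (if l = 0 then {p2 k} else {})" for l
      by (simp add: cuts(1))
    have "valid_cuts P t"
      unfolding valid_cuts_def
    proof (intro conjI allI)
      show "finite (rays t)" "rays t \<subseteq> dual_rays P" using val cuts by (auto simp: valid_cuts_def)
      have "a ` {1..k + 1} \<subseteq> {0..1} \<inter> critical_weights P"
        using explore_weight_range[OF cuts(4)] explore_weights_critical[OF cuts(4)] by blast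
      then show "weights t \<subseteq> {0..1} \<inter> critical_weights P"
        using val cuts(1) by (auto simp: valid_cuts_def critical_weights_def)
      fix l
      have "a i *\<^sub>R p1 i + (1 - a i) *\<^sub>R p2 i \<in> dual_points P l"
        if "i \<in> {1..k}" "a i = l" for i
        using explore_points[OF cuts(4) that(1)] unfolding that(2) .
      then have "{a i *\<^sub>R p1 i + (1 - a i) *\<^sub>R p2 i |i. i \<in> {1..k} \<and> a i = l} \<subseteq> dual_points P l"
        by blast
      then show "points t l \<subseteq> dual_points P l"
        using val explore_last_point[OF cuts(4)] by (simp add: valid_cuts_def pts)
    qed
    moreover have "compatible P v" if v: "v \<in> bm_feasible P t" "snd (snd v) = y" for v
    proof -
      have cut: "sub_rhs P y \<bullet> p \<le> l * fst v + (1 - l) * fst (snd v)"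
        if "l \<in> weights t" "p \<in> points t l" for l p
        using v that by (auto simp: bm_feasible_iff)
      have "\<exists>x\<in>sub_feasible P y. cvec1 P \<bullet> x \<le> fst v \<and> cvec2 P \<bullet> x \<le> fst (snd v)"
      proof (rule explore_cuts_complete[OF cuts(4)])
        fix i assume i: "i \<in> {1..k}"
        then have "a i \<in> weights t" by (simp add: cuts(1))
        moreover have "a i *\<^sub>R p1 i + (1 - a i) *\<^sub>R p2 i \<in> points t (a i)"
          unfolding pts using i by blast
        ultimately show "sub_rhs P y \<bullet> (a i *\<^sub>R p1 i + (1 - a i) *\<^sub>R p2 i)
            \<le> a i * fst v + (1 - a i) * fst (snd v)" by (rule cut)
      next
        show "sub_rhs P y \<bullet> p2 k \<le> fst (snd v)"
          using cut[of 0 "p2 k"] by (auto simp: cuts(1))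
      qed
      then show ?thesis by (simp add: compatible_def v(2))
    qed
    ultimately show ?thesis using cuts by auto
  qed (use ph in auto)
  then show "phase t = Step3" "explored t = insert (snd (snd (candidate s))) (explored s)"
    "candidate t = candidate s" "last_sol t = last_sol s" "stored_sols t = stored_sols s"
    "rays s \<subseteq> rays t" "Sigma (weights s) (points s) \<subseteq> Sigma (weights t) (points t)"
    "valid_cuts P t"
    "\<And>v. v \<in> bm_feasible P t \<Longrightarrow> snd (snd v) = snd (snd (candidate s)) \<Longrightarrow> compatible P v"
    by blast+
qed

lemma bm_feasible_update [simp]:
  "bm_feasible P (s\<lparr>phase := a\<rparr>) = bm_feasible P s"
  "bm_feasible P (s\<lparr>candidate := v\<rparr>) = bm_feasible P s"
  "bm_feasible P (s\<lparr>last_sol := v\<rparr>) = bm_feasible P s"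
  "bm_feasible P (s\<lparr>position := v\<rparr>) = bm_feasible P s"
  "bm_feasible P (s\<lparr>stored_sols := V\<rparr>) = bm_feasible P s"
  "bm_feasible P (s\<lparr>stored_images := Z\<rparr>) = bm_feasible P s"
  by (simp_all add: bm_feasible_def)

lemma cut_state_update [simp]:
  "valid_cuts P (s\<lparr>phase := a\<rparr>) = valid_cuts P s"
  "valid_cuts P (s\<lparr>candidate := v\<rparr>) = valid_cuts P s"
  "valid_cuts P (s\<lparr>last_sol := v\<rparr>) = valid_cuts P s"
  "valid_cuts P (s\<lparr>position := v\<rparr>) = valid_cuts P s"
  "valid_cuts P (s\<lparr>stored_sols := V\<rparr>) = valid_cuts P s"
  "valid_cuts P (s\<lparr>stored_images := Z\<rparr>) = valid_cuts P s"
  "good_vertex P (s\<lparr>phase := a\<rparr>) = good_vertex P s"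
  "good_vertex P (s\<lparr>candidate := v\<rparr>) = good_vertex P s"
  "good_vertex P (s\<lparr>last_sol := v\<rparr>) = good_vertex P s"
  "good_vertex P (s\<lparr>position := v\<rparr>) = good_vertex P s"
  "good_vertex P (s\<lparr>stored_sols := V\<rparr>) = good_vertex P s"
  "good_vertex P (s\<lparr>stored_images := Z\<rparr>) = good_vertex P s"
  "promising P (s\<lparr>phase := a\<rparr>) = promising P s"
  "promising P (s\<lparr>candidate := v\<rparr>) = promising P s"
  "promising P (s\<lparr>last_sol := v\<rparr>) = promising P s"
  "promising P (s\<lparr>position := v\<rparr>) = promising P s"
  "promising P (s\<lparr>stored_sols := V\<rparr>) = promising P s"
  "promising P (s\<lparr>stored_images := Z\<rparr>) = promising P s"
  by (simp_all add: valid_cuts_def good_vertex_def promising_def fun_eq_iff)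

lemma invariant_start: "bbsa_invariant P bbsa_start"
  by (simp add: bbsa_invariant_def bbsa_start_def valid_cuts_def critical_weights_def)

lemma invariant_explore:
  assumes inv: "bbsa_invariant P s" and step: "bbsa_step P s t" and ph: "phase s = Step2"
  shows "bbsa_invariant P t"
proof -
  note eff = explore_step[OF assms]
  have sub: "bm_feasible P t \<subseteq> bm_feasible P s"
    by (rule bm_feasible_antimono) (use eff(6,7) in auto)
  have "compatible P v" if "v \<in> bm_feasible P t" "snd (snd v) \<in> explored t" for v
  proof (cases "snd (snd v) = snd (snd (candidate s))")
    case True
    with that(1) show ?thesis by (rule eff(9))
  next
    case False
    then have "snd (snd v) \<in> explored s" using that(2) by (simp add: eff(2))
    then show ?thesis using inv subsetD[OF sub that(1)] by (simp add: bbsa_invariant_def)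
  qed
  moreover have "good_vertex P t (last_sol t)" if "stored_sols t \<noteq> {}"
    using good_vertex_shrink[OF _ eff(8) sub] that inv eff(4,5) by (auto simp: bbsa_invariant_def)
  moreover have "promising P t (candidate t)" if "stored_sols t \<noteq> {}"
    using promising_shrink[OF _ sub] that inv eff(3,5) ph by (auto simp: bbsa_invariant_def)
  ultimately show ?thesis using eff(1,2,3,8) by (simp add: bbsa_invariant_def)
qed

text \<open>Without a pivot \<open>v\<close> minimises the second objective, so the part of the
  master problem covered above \<open>v\<close> is all of it.\<close>

lemma pivot_none_covered:
  assumes val: "valid_cuts P s" and wp: "well_posed (bm_feasible P s) (master_objective P)"
    and good: "good_vertex P s v"
    and none: "\<not> (\<exists>w. pivot (bm_feasible P s) (master_objective P) v w)"
  shows "covered_above P (bm_feasible P s) t"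
proof -
  have "snd (master_objective P v) \<le> snd (master_objective P w)" if "w \<in> bm_feasible P s" for w
  proof (rule ccontr)
    assume "\<not> ?thesis"
    moreover obtain l where "l \<in> {0..1}" "weighted_optimal (bm_feasible P s) (master_objective P) l v"
      using good by (auto simp: good_vertex_def efficient_vertex_def)
    ultimately show False
      using pivot_exists[OF bm_polyhedron[OF val] linear_master_objective wp, of v l w] that good none
      by (auto simp: good_vertex_def efficient_vertex_def)
  qed
  then show ?thesis using good unfolding good_vertex_def covered_above_def by blast
qed

lemma invariant_step:
  assumes inv: "bbsa_invariant P s" and step: "bbsa_step P s t"
    and wp: "phase s = Step5 \<Longrightarrow> well_posed (bm_feasible P s) (master_objective P)"
  shows "bbsa_invariant P t"
  using step
proof cases
  case (init R Q v)
  then have "s = bbsa_start" using inv by (simp add: bbsa_invariant_def)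
  then show ?thesis using init
    by (auto simp: bbsa_invariant_def bbsa_start_def valid_cuts_def benders_first_def critical_weights_def)
next
  case ray
  then show ?thesis using invariant_explore[OF inv step] by blast
next
  case cuts
  then show ?thesis using invariant_explore[OF inv step] by blast
next
  case (first v)
  have v: "v extreme_point_of bm_feasible P s" "v \<in> bm_feasible P s"
    using first by (auto simp: first_efficient_def extreme_point_of_def)
  show ?thesis using inv first v first_efficient_promising[OF first(4)]
    by (simp add: bbsa_invariant_def)
next
  case not_first
  then show ?thesis using inv by (simp add: bbsa_invariant_def)
next
  case store
  then have "good_vertex P s (candidate s)"
    using inv by (intro promising_good_vertex) (auto simp: bbsa_invariant_def)
  then show ?thesis using inv store by (simp add: bbsa_invariant_def)
next
  case reject
  then show ?thesis using inv by (auto simp: bbsa_invariant_def)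
next
  case (pivot_on w)
  have i: "stored_sols s \<noteq> {}" "good_vertex P s (position s)"
    "snd (master_objective P (position s)) \<le> snd (master_objective P (last_sol s))"
    using inv pivot_on(2) by (simp_all add: bbsa_invariant_def)
  have w: "w \<in> bm_feasible P s" "snd (master_objective P w) < snd (master_objective P (position s))"
    using pivot_on(3) by (auto simp: pivot_def extreme_point_of_def)
  \<comment> \<open>\<open>w\<close> lies below the last solution, so it can fail to be the next
    candidate only by being explored.\<close>
  then have "snd (snd w) \<in> explored s" using pivot_on(4) i(3) by (simp add: next_candidate_def)
  then have "compatible P w" using inv w(1) by (simp add: bbsa_invariant_def)
  then have "good_vertex P s w"
    using promising_good_vertex good_vertex_pivot[OF i(2) pivot_on(3)] w(1) by blast
  then show ?thesis using inv pivot_on(1,2) i w(2) by (simp add: bbsa_invariant_def)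
next
  case (pivot_found w)
  have i: "good_vertex P s (position s)" using inv pivot_found(2) by (simp add: bbsa_invariant_def)
  have "w extreme_point_of bm_feasible P s" using pivot_found(3) by (simp add: pivot_def)
  moreover have "snd (snd w) \<notin> explored s" using pivot_found(4) by (simp add: next_candidate_def)
  ultimately show ?thesis
    using inv pivot_found(1,2) good_vertex_pivot[OF i pivot_found(3)] by (simp add: bbsa_invariant_def)
next
  case pivot_none
  have i: "valid_cuts P s" "good_vertex P s (position s)"
    using inv pivot_none(2) by (simp_all add: bbsa_invariant_def)
  have "\<forall>t. covered_above P (bm_feasible P s) t"
    using pivot_none_covered[OF i(1) wp[OF pivot_none(2)] i(2) pivot_none(3)] by blast
  then show ?thesis using inv pivot_none(1,2) by (simp add: bbsa_invariant_def)
next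
  case discard
  then show ?thesis using inv by (auto simp: bbsa_invariant_def)
qed

section \<open>The termination order\<close>

primrec phase_rank :: "phase \<Rightarrow> nat" where
  "phase_rank Step1 = 0"
| "phase_rank Step2 = 0"
| "phase_rank Step3 = 4"
| "phase_rank Step4 = 3"
| "phase_rank Step5 = 2"
| "phase_rank Step6 = 1"
| "phase_rank Finished = 0"

text \<open>The first exploration gets a rank of its own: its candidate need not be a vertex, so the
  count of unexplored vertices need not drop.\<close>

definition start_rank :: "('m::finite, 'p::finite) bbsa_state \<Rightarrow> nat" where
  "start_rank s = (if phase s = Step1 then 2 else if explored s = {} then 1 else 0)"

definition missing_cuts ::
    "('n::finite, 'p::finite, 'm::finite, 'q::finite) blp \<Rightarrow> ('m, 'p) bbsa_state \<Rightarrow> nat" where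
  "missing_cuts P s = card (unit_dual_rays P - sgn ` rays s) +
    card (Sigma (critical_weights P) (dual_points P) - Sigma (weights s) (points s))"

definition unexplored_vertices ::
    "('n::finite, 'p::finite, 'm::finite, 'q::finite) blp \<Rightarrow> ('m, 'p) bbsa_state \<Rightarrow> nat" where
  "unexplored_vertices P s =
    card ((\<lambda>v. snd (snd v)) ` {v. v extreme_point_of bm_feasible P s} - explored s)"

definition lower_vertices ::
    "('n::finite, 'p::finite, 'm::finite, 'q::finite) blp \<Rightarrow> ('m, 'p) bbsa_state \<Rightarrow> nat" where
  "lower_vertices P s = card {w. w extreme_point_of bm_feasible P s \<and>
    snd (master_objective P w) < snd (master_objective P (position s))}"

text \<open>New cuts may create vertices, so \<open>missing_cuts\<close> precedes
  \<open>unexplored_vertices\<close>. Leaving \<open>Step2\<close> decreases a component before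
  \<open>phase_rank\<close>, which allows rank 0 there and makes every return to
  \<open>Step2\<close> a decrease. A rejection may raise \<open>position\<close>, so
  \<open>lower_vertices\<close> comes last and accounts for the pivots within
  \<open>Step5\<close>.\<close>

definition bbsa_order ::
    "('n::finite, 'p::finite, 'm::finite, 'q::finite) blp
     \<Rightarrow> (('m, 'p) bbsa_state \<times> ('m, 'p) bbsa_state) set" where
  "bbsa_order P = measures [start_rank, missing_cuts P, unexplored_vertices P,
    \<lambda>s. phase_rank (phase s), lower_vertices P]"

lemma card_Diff_antimono_strict:
  assumes "finite U" "X \<subseteq> Y" "Y \<subseteq> U" "X \<noteq> Y"
  shows "card (U - Y) < card (U - X)"
  using assms by (intro psubset_card_mono) auto

text \<open>An exploration that adds no new cut leaves the master problem unchanged, hence makes one of its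
  finitely many vertices explored.\<close>

lemma explore_decreases:
  assumes inv: "bbsa_invariant P s" and step: "bbsa_step P s t" and ph: "phase s = Step2"
  shows "(t, s) \<in> bbsa_order P"
proof -
  note eff = explore_step[OF assms]
  have val: "valid_cuts P s" using inv by (simp add: bbsa_invariant_def)
  show ?thesis
  proof (cases "explored s = {}")
    case True
    then show ?thesis using ph eff(1,2) by (simp add: bbsa_order_def start_rank_def)
  next
    case False
    then have cand: "candidate s extreme_point_of bm_feasible P s"
      "snd (snd (candidate s)) \<notin> explored s" using inv ph by (auto simp: bbsa_invariant_def)
    let ?R = "\<lambda>s. sgn ` rays s" and ?Q = "\<lambda>s. Sigma (weights s) (points s)"
    have sub: "?R s \<subseteq> ?R t" "?Q s \<subseteq> ?Q t" using eff(6,7) by auto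
    note fin = finite_unit_dual_rays finite_SigmaI[OF finite_critical_weights finite_dual_points]
    note bnd = valid_cuts_finite(3)[OF eff(8)] valid_cuts_finite(2)[OF eff(8)]
    have sr: "start_rank t = start_rank s" using False ph eff(1,2) by (simp add: start_rank_def)
    show ?thesis
    proof (cases "?R s = ?R t \<and> ?Q s = ?Q t")
      case True
      then have eq: "bm_feasible P t = bm_feasible P s"
        by (intro subset_antisym bm_feasible_antimono) auto
      have mc: "missing_cuts P t = missing_cuts P s" using True by (simp add: missing_cuts_def)
      have "finite {v. v extreme_point_of bm_feasible P s}"
        by (rule finite_polyhedron_extreme_points[OF bm_polyhedron[OF val]])
      then have "unexplored_vertices P t < unexplored_vertices P s"
        unfolding unexplored_vertices_def eq eff(2) using cand
        by (intro psubset_card_mono) auto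
      then show ?thesis using sr mc by (simp add: bbsa_order_def)
    next
      case False
      have "card (unit_dual_rays P - ?R t) \<le> card (unit_dual_rays P - ?R s)"
        "card (Sigma (critical_weights P) (dual_points P) - ?Q t)
          \<le> card (Sigma (critical_weights P) (dual_points P) - ?Q s)"
        using sub by (auto intro!: card_mono finite_Diff fin)
      then have "missing_cuts P t < missing_cuts P s"
        unfolding missing_cuts_def
        using False card_Diff_antimono_strict[OF fin(1) sub(1) bnd(1)]
          card_Diff_antimono_strict[OF fin(2) sub(2) bnd(2)] by linarith
      then show ?thesis using sr by (simp add: bbsa_order_def)
    qed
  qed
qed

lemma step_decreases:
  assumes inv: "bbsa_invariant P s" and step: "bbsa_step P s t"
  shows "(t, s) \<in> bbsa_order P"
  using step
proof cases
  case ray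
  then show ?thesis using explore_decreases[OF inv step] by blast
next
  case cuts
  then show ?thesis using explore_decreases[OF inv step] by blast
next
  case (pivot_on w)
  have "finite {v. v extreme_point_of bm_feasible P s}"
    using inv finite_polyhedron_extreme_points bm_polyhedron by (auto simp: bbsa_invariant_def)
  moreover have "w extreme_point_of bm_feasible P s"
    "snd (master_objective P w) < snd (master_objective P (position s))"
    using pivot_on(3) by (auto simp: pivot_def)
  ultimately have "lower_vertices P t < lower_vertices P s"
    unfolding lower_vertices_def pivot_on(1) by (intro psubset_card_mono) auto
  then show ?thesis using pivot_on
    by (simp add: bbsa_order_def start_rank_def missing_cuts_def unexplored_vertices_def)
qed (simp_all add: bbsa_order_def start_rank_def missing_cuts_def unexplored_vertices_def)

section \<open>Progress and equality at termination\<close>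

lemma progress:
  assumes inv: "bbsa_invariant P s" and blp: "well_posed (blp_feasible P) (blp_objective P)"
    and wp: "phase s = Step3 \<Longrightarrow> well_posed (bm_feasible P s) (master_objective P)"
    and stuck: "\<not> (\<exists>t. bbsa_step P s t)"
  shows "phase s = Finished"
proof (cases "phase s")
  case Step1
  then show ?thesis using stuck bbsa_step.init benders_first_exists[OF blp] by metis
next
  case Step2
  then show ?thesis using stuck bbsa_step.ray[OF Step2 refl] bbsa_step.cuts[OF Step2 refl]
      explore_exists[OF dual_regions_nonempty[OF blp]] by blast
next
  case Step3
  show ?thesis
  proof (cases "stored_sols s = {}")
    case True
    obtain v where "first_efficient (bm_feasible P s) (master_objective P) v"
      using first_efficient_exists[OF bm_polyhedron linear_master_objective wp[OF Step3]] inv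
      by (auto simp: bbsa_invariant_def)
    then show ?thesis using stuck bbsa_step.first[OF Step3 True] by blast
  next
    case False
    then show ?thesis using stuck bbsa_step.not_first[OF Step3] by blast
  qed
next
  case Step4
  then show ?thesis using stuck bbsa_step.store bbsa_step.reject by blast
next
  case Step5
  then show ?thesis
    using stuck bbsa_step.pivot_on[OF Step5] bbsa_step.pivot_found[OF Step5] bbsa_step.pivot_none[OF Step5]
    by blast
next
  case Step6
  then show ?thesis using stuck bbsa_step.discard by blast
qed

lemma finished_nondominated_extreme:
  assumes inv: "bbsa_invariant P s" and ph: "phase s = Finished"
  shows "nondominated_extreme (bm_feasible P s) (master_objective P)
    = nondominated_extreme (blp_feasible P) (blp_objective P)"
proof (rule nondominated_extreme_cong)
  have val: "valid_cuts P s" and cov: "\<And>t. covered_above P (bm_feasible P s) t"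
    using inv ph by (simp_all add: bbsa_invariant_def)
  show "blp_objective P ` blp_feasible P \<subseteq> master_objective P ` bm_feasible P s"
  proof (rule image_subsetI)
    fix u assume "u \<in> blp_feasible P"
    then obtain v where "compatible P v" "dvec P \<le> Dmat P *v snd (snd v)" "0 \<le> snd (snd v)"
      "master_objective P v = blp_objective P u" by (rule master_feasible_compatible_image)
    then show "blp_objective P u \<in> master_objective P ` bm_feasible P s"
      using compatible_bm_feasible[OF val] by (metis imageI)
  qed
  show "convex (blp_objective P ` blp_feasible P)"
    by (rule convex_linear_image[OF linear_blp_objective convex_blp_feasible])
  fix w assume "w \<in> bm_feasible P s"
  then show "\<exists>u\<in>blp_feasible P. fst (blp_objective P u) \<le> fst (master_objective P w) \<and>
      snd (blp_objective P u) \<le> snd (master_objective P w)"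
    using cov[of "snd (master_objective P w)"] by (simp add: covered_above_def)
qed

text \<open>Well-posedness of the master problems is assumed in \<open>Step3\<close> and
  \<open>Step5\<close> only. In the state reached by \<open>init\<close> the only weight is 1, so
  \<theta> for the second objective is unrestricted and weighted problems with weight below 1 have
  no optimum.\<close>

theorem proposition2:
  fixes P :: "('n::finite, 'p::finite, 'm::finite, 'q::finite) blp"
  assumes feasible: "blp_feasible P \<noteq> {}"
    and bounded_blp: "well_posed (blp_feasible P) (blp_objective P)"
    and bounded_masters: "\<And>s. (bbsa_step P)\<^sup>*\<^sup>* bbsa_start s \<Longrightarrow> phase s \<in> {Step3, Step5} \<Longrightarrow>
      well_posed (bm_feasible P s) (master_objective P)"
  shows "\<not> (\<exists>run :: nat \<Rightarrow> ('m, 'p) bbsa_state.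
         run 0 = bbsa_start \<and> (\<forall>i. bbsa_step P (run i) (run (Suc i)))) \<and>
      (\<forall>s. (bbsa_step P)\<^sup>*\<^sup>* bbsa_start s \<and> \<not> (\<exists>t. bbsa_step P s t) \<longrightarrow>
         phase s = Finished \<and> bm_valid P s \<and>
         nondominated_extreme (bm_feasible P s) (master_objective P)
           = nondominated_extreme (blp_feasible P) (blp_objective P))"
proof (intro conjI allI impI)
  have inv: "bbsa_invariant P s" if "(bbsa_step P)\<^sup>*\<^sup>* bbsa_start s" for s
    using that
  proof (induction rule: rtranclp_induct)
    case base
    show ?case by (rule invariant_start)
  next
    case (step s t)
    then show ?case using invariant_step[of P s t] bounded_masters[of s] by simp
  qed
  show "\<not> (\<exists>run :: nat \<Rightarrow> ('m, 'p) bbsa_state.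
      run 0 = bbsa_start \<and> (\<forall>i. bbsa_step P (run i) (run (Suc i))))"
  proof
    assume "\<exists>run :: nat \<Rightarrow> ('m, 'p) bbsa_state.
      run 0 = bbsa_start \<and> (\<forall>i. bbsa_step P (run i) (run (Suc i)))"
    then obtain run where run: "run 0 = bbsa_start" "\<And>i. bbsa_step P (run i) (run (Suc i))" by blast
    have "(bbsa_step P)\<^sup>*\<^sup>* bbsa_start (run i)" for i
      by (induction i) (use run in \<open>auto intro: rtranclp.rtrancl_into_rtrancl\<close>)
    then have "(run (Suc i), run i) \<in> bbsa_order P" for i using step_decreases inv run(2) by blast
    moreover have "wf (bbsa_order P)" by (simp add: bbsa_order_def)
    ultimately show False unfolding wf_iff_no_infinite_down_chain by blast
  qed
  fix s assume s: "(bbsa_step P)\<^sup>*\<^sup>* bbsa_start s \<and> \<not> (\<exists>t. bbsa_step P s t)"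
  then have i: "bbsa_invariant P s" by (blast intro: inv)
  show ph: "phase s = Finished"
    by (rule progress[OF i bounded_blp]) (use s bounded_masters[of s] in auto)
  show "bm_valid P s" using i by (auto simp: bbsa_invariant_def valid_cuts_def bm_valid_def)
  show "nondominated_extreme (bm_feasible P s) (master_objective P)
      = nondominated_extreme (blp_feasible P) (blp_objective P)"
    by (rule finished_nondominated_extreme[OF i ph])
qed

end
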